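(* Let $A_{-1}\in\mathbb{R}^{n\times n}$ and let $A_2,A_3$ be $n\times n$ matrix functions with entries in $L_2(-1,0)$. Let $X_1$ be the domain $D(\mathcal{A})$ with the graph norm, where $\mathcal{A}$ is the generator associated with the neutral type system $$\dot z(t)=A_{-1}\dot z(t-1)+\int_{-1}^0\left[A_2(\theta)\dot z(t+\theta)+A_3(\theta)z(t+\theta)\right]\mathrm{d}\theta ,$$ and let $F$ be the operator representing the relation $\tilde x_0=F\xi_0$ between the initial condition $\xi_0=(w(1)-A_{-1}w(0),\,w(\cdot+1))\in D(\mathcal{A})$ of this system and the initial condition $\tilde x_0=(w(0),\psi_0(\cdot))\in M_2$ of the equation $\dot x=\tilde{\mathcal{A}}x$ (both defined in the context). Then $F$ is linear, bounded and boundedly invertible from $X_1$ to $M_2=\mathbb{R}^n\times L_2(-1,0;\mathbb{R}^n)$.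
   Context: The operator $\mathcal{A}$ acts in $M_2$ by $\mathcal{A}(v,\varphi)=\big(\int_{-1}^0[A_2(\theta)\varphi'(\theta)+A_3(\theta)\varphi(\theta)]\,\mathrm{d}\theta,\ \varphi'\big)$ with $D(\mathcal{A})=\{(v,\varphi):\varphi\in H^1([-1,0];\mathbb{R}^n),\ v=\varphi(0)-A_{-1}\varphi(-1)\}$; it generates a $C_0$-semigroup, and $e^{\mathcal{A}t}(z(0)-A_{-1}z(-1),z_0)=(z(t)-A_{-1}z(t-1),z_t)$ with $z_t(\theta)=z(t+\theta)$. The operator $\tilde{\mathcal{A}}$ acts in $M_2$ by $\tilde{\mathcal{A}}(w,\psi)=\big(r(0),\,-r'+A_3(\cdot)w\big)$, where $r=\psi+A_2(\cdot)w$, with $D(\tilde{\mathcal{A}})=\{(w,\psi)\in M_2: r\in H^1([-1,0];\mathbb{R}^n),\ A_{-1}r(0)=r(-1)\}$; it generates a $C_0$-semigroup. Definition of $F$: given $\xi_0=(v(0),z_0)\in D(\mathcal{A})$, let $w$ be the function on $[0,\infty)$ determined by $e^{\mathcal{A}t}\xi_0=(w(t+1)-A_{-1}w(t),\,w(t+1+\cdot))$; in particular $w(s)=z_0(s-1)$ for $s\in[0,1]$. Then $F\xi_0=\tilde x_0=(w(0),\psi_0)$ is the initial state for which $e^{\tilde{\mathcal{A}}t}\tilde x_0=(w(t),\psi_t)$, $t\ge 0$, with this same function $w$ as first component. Explicitly, $$\psi_0(\theta)=\dot w(-\theta)+\int_0^\theta\left[A_2(\tau)\dot w(\tau-\theta)+A_3(\tau)w(\tau-\theta)\right]\mathrm{d}\tau-A_2(\theta)w(0),\qquad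 \theta\in[-1,0].$$ *)

theory Defs
  imports "HOL-Analysis.Analysis"
begin

section \<open>The Hilbert space of square integrable functions on the interval from -1 to 0\<close>

abbreviation leb_I :: "real measure" where
  "leb_I \<equiv> lebesgue_on {-1..0}"

definition sq_integrable :: "(real \<Rightarrow> 'a::euclidean_space) \<Rightarrow> bool" where
  "sq_integrable f \<longleftrightarrow>
     f \<in> borel_measurable leb_I \<and> integrable leb_I (\<lambda>\<theta>. (norm (f \<theta>))\<^sup>2)"

definition L2_rel :: "(real \<Rightarrow> 'a::euclidean_space) \<Rightarrow> (real \<Rightarrow> 'a) \<Rightarrow> bool" where
  "L2_rel f g \<longleftrightarrow>
     sq_integrable f \<and> sq_integrable g \<and> (AE \<theta> in leb_I. f \<theta> = g \<theta>)"

lemma sq_integrable_zero: "sq_integrable (\<lambda>_. 0)"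
  by (simp add: sq_integrable_def)

lemma sq_integrable_add:
  assumes "sq_integrable f" "sq_integrable g"
  shows "sq_integrable (\<lambda>\<theta>. f \<theta> + g \<theta>)"
proof -
  have "integrable leb_I (\<lambda>\<theta>. (norm (f \<theta> + g \<theta>))\<^sup>2)"
  proof (rule Bochner_Integration.integrable_bound)
    show "integrable leb_I (\<lambda>\<theta>. 2 * (norm (f \<theta>))\<^sup>2 + 2 * (norm (g \<theta>))\<^sup>2)"
      using assms by (simp add: sq_integrable_def)
    show "(\<lambda>\<theta>. (norm (f \<theta> + g \<theta>))\<^sup>2) \<in> borel_measurable leb_I"
      using assms by (auto simp: sq_integrable_def)
    have "(norm (f \<theta> + g \<theta>))\<^sup>2 \<le> 2 * (norm (f \<theta>))\<^sup>2 + 2 * (norm (g \<theta>))\<^sup>2" for \<theta>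
    proof -
      have "(norm (f \<theta> + g \<theta>))\<^sup>2 \<le> (norm (f \<theta>) + norm (g \<theta>))\<^sup>2"
        by (intro power_mono norm_triangle_ineq) simp
      also have "\<dots> \<le> 2 * (norm (f \<theta>))\<^sup>2 + 2 * (norm (g \<theta>))\<^sup>2"
        using sum_squares_bound[of "norm (f \<theta>)" "norm (g \<theta>)"] by (simp add: power2_sum)
      finally show ?thesis .
    qed
    then show "AE \<theta> in leb_I. norm ((norm (f \<theta> + g \<theta>))\<^sup>2)
        \<le> norm (2 * (norm (f \<theta>))\<^sup>2 + 2 * (norm (g \<theta>))\<^sup>2)"
      by simp
  qed
  then show ?thesis
    using assms by (auto simp: sq_integrable_def)
qed

lemma sq_integrable_scaleR:
  assumes "sq_integrable f"
  shows "sq_integrable (\<lambda>\<theta>. c *\<^sub>R f \<theta>)"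
  using assms by (auto simp: sq_integrable_def power_mult_distrib)

lemma sq_integrable_uminus:
  assumes "sq_integrable f"
  shows "sq_integrable (\<lambda>\<theta>. - f \<theta>)"
  using sq_integrable_scaleR[OF assms, of "-1"] by simp

lemma sq_integrable_diff:
  assumes "sq_integrable f" "sq_integrable g"
  shows "sq_integrable (\<lambda>\<theta>. f \<theta> - g \<theta>)"
  using sq_integrable_add[OF assms(1) sq_integrable_uminus[OF assms(2)]] by simp

lemma sq_integrable_inner:
  assumes "sq_integrable f" "sq_integrable g"
  shows "integrable leb_I (\<lambda>\<theta>. inner (f \<theta>) (g \<theta>))"
proof (rule Bochner_Integration.integrable_bound)
  show "integrable leb_I (\<lambda>\<theta>. (norm (f \<theta>))\<^sup>2 + (norm (g \<theta>))\<^sup>2)"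
    using assms by (simp add: sq_integrable_def)
  show "(\<lambda>\<theta>. inner (f \<theta>) (g \<theta>)) \<in> borel_measurable leb_I"
    using assms by (auto simp: sq_integrable_def)
  have "\<bar>inner (f \<theta>) (g \<theta>)\<bar> \<le> (norm (f \<theta>))\<^sup>2 + (norm (g \<theta>))\<^sup>2" for \<theta>
  proof -
    have "\<bar>inner (f \<theta>) (g \<theta>)\<bar> \<le> norm (f \<theta>) * norm (g \<theta>)"
      by (rule Cauchy_Schwarz_ineq2)
    also have "\<dots> \<le> (norm (f \<theta>))\<^sup>2 + (norm (g \<theta>))\<^sup>2"
    proof -
      have "0 \<le> norm (f \<theta>) * norm (g \<theta>)" by simp
      then show ?thesis
        using sum_squares_bound[of "norm (f \<theta>)" "norm (g \<theta>)"] by linarith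
    qed
    finally show ?thesis .
  qed
  then show "AE \<theta> in leb_I. norm (inner (f \<theta>) (g \<theta>))
      \<le> norm ((norm (f \<theta>))\<^sup>2 + (norm (g \<theta>))\<^sup>2)"
    by simp
qed

lemma part_equivp_L2_rel: "part_equivp L2_rel"
proof (rule part_equivpI)
  show "\<exists>f::real \<Rightarrow> 'a. L2_rel f f"
    using sq_integrable_zero by (auto simp: L2_rel_def)
  show "symp (L2_rel :: (real \<Rightarrow> 'a) \<Rightarrow> _)"
    by (auto simp: symp_def L2_rel_def elim: AE_mp)
  show "transp (L2_rel :: (real \<Rightarrow> 'a) \<Rightarrow> _)"
    unfolding transp_def L2_rel_def by (auto elim: eventually_elim2)
qed

quotient_type (overloaded) 'a L2 = "real \<Rightarrow> 'a::euclidean_space" / partial: L2_rel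
  morphisms rep_L2 L2_of
  by (rule part_equivp_L2_rel)

instantiation L2 :: (euclidean_space) real_vector
begin

lift_definition zero_L2 :: "'a L2" is "\<lambda>_. 0"
  by (simp add: L2_rel_def sq_integrable_zero)

lift_definition plus_L2 :: "'a L2 \<Rightarrow> 'a L2 \<Rightarrow> 'a L2" is "\<lambda>f g \<theta>. f \<theta> + g \<theta>"
  by (auto simp: L2_rel_def intro!: sq_integrable_add elim: eventually_elim2)

lift_definition minus_L2 :: "'a L2 \<Rightarrow> 'a L2 \<Rightarrow> 'a L2" is "\<lambda>f g \<theta>. f \<theta> - g \<theta>"
  by (auto simp: L2_rel_def intro!: sq_integrable_diff elim: eventually_elim2)

lift_definition uminus_L2 :: "'a L2 \<Rightarrow> 'a L2" is "\<lambda>f \<theta>. - f \<theta>"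
  by (auto simp: L2_rel_def intro!: sq_integrable_uminus elim: eventually_mono)

lift_definition scaleR_L2 :: "real \<Rightarrow> 'a L2 \<Rightarrow> 'a L2" is "\<lambda>c f \<theta>. c *\<^sub>R f \<theta>"
  by (auto simp: L2_rel_def intro!: sq_integrable_scaleR elim: eventually_mono)

instance
proof
  fix f g h :: "'a L2" and a b :: real
  show "f + g + h = f + (g + h)"
    by transfer (auto simp: L2_rel_def algebra_simps intro!: sq_integrable_add)
  show "f + g = g + f"
    by transfer (auto simp: L2_rel_def algebra_simps intro!: sq_integrable_add)
  show "0 + f = f"
    by transfer (auto simp: L2_rel_def)
  show "- f + f = 0"
    by transfer (auto simp: L2_rel_def sq_integrable_zero)
  show "f - g = f + - g"
    by transfer (auto simp: L2_rel_def intro!: sq_integrable_diff)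
  show "a *\<^sub>R (f + g) = a *\<^sub>R f + a *\<^sub>R g"
    by transfer (auto simp: L2_rel_def scaleR_add_right
        intro!: sq_integrable_add sq_integrable_scaleR)
  show "(a + b) *\<^sub>R f = a *\<^sub>R f + b *\<^sub>R f"
    by transfer (auto simp: L2_rel_def scaleR_add_left
        intro!: sq_integrable_add sq_integrable_scaleR)
  show "a *\<^sub>R b *\<^sub>R f = (a * b) *\<^sub>R f"
    by transfer (auto simp: L2_rel_def intro!: sq_integrable_scaleR)
  show "1 *\<^sub>R f = f"
    by transfer (auto simp: L2_rel_def)
qed

end

instantiation L2 :: (euclidean_space) real_inner
begin

lift_definition inner_L2 :: "'a L2 \<Rightarrow> 'a L2 \<Rightarrow> real"
  is "\<lambda>f g. LINT \<theta>|leb_I. inner (f \<theta>) (g \<theta>)"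
  by (rule integral_cong_AE)
     (auto simp: L2_rel_def sq_integrable_def elim: eventually_elim2)

definition norm_L2 :: "'a L2 \<Rightarrow> real" where
  "norm_L2 f = sqrt (inner f f)"

definition sgn_L2 :: "'a L2 \<Rightarrow> 'a L2" where
  "sgn_L2 f = f /\<^sub>R norm f"

definition dist_L2 :: "'a L2 \<Rightarrow> 'a L2 \<Rightarrow> real" where
  "dist_L2 f g = norm (f - g)"

definition uniformity_L2 :: "('a L2 \<times> 'a L2) filter" where
  "uniformity_L2 = (INF e\<in>{0<..}. principal {(f, g). dist f g < e})"

definition open_L2 :: "'a L2 set \<Rightarrow> bool" where
  "open_L2 U \<longleftrightarrow> (\<forall>f\<in>U. \<forall>\<^sub>F (f', g) in uniformity. f' = f \<longrightarrow> g \<in> U)"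

instance
proof
  fix f g h :: "'a L2" and a :: real
  show "sgn f = f /\<^sub>R norm f"
    by (rule sgn_L2_def)
  show "dist f g = norm (f - g)"
    by (rule dist_L2_def)
  show "(uniformity :: ('a L2 \<times> 'a L2) filter)
      = (INF e\<in>{0<..}. principal {(f, g). dist f g < e})"
    by (rule uniformity_L2_def)
  show "open U \<longleftrightarrow> (\<forall>f\<in>U. \<forall>\<^sub>F (f', g) in uniformity. f' = f \<longrightarrow> g \<in> U)" for U :: "'a L2 set"
    by (rule open_L2_def)
  show "inner f g = inner g f"
    by transfer (simp add: inner_commute)
  show "inner (f + g) h = inner f h + inner g h"
    by transfer (auto simp: L2_rel_def inner_add_left sq_integrable_inner)
  show "inner (a *\<^sub>R f) g = a * inner f g"
    by transfer (auto simp: L2_rel_def)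
  show "0 \<le> inner f f"
    by transfer auto
  show "inner f f = 0 \<longleftrightarrow> f = 0"
  proof transfer
    fix f :: "real \<Rightarrow> 'a"
    assume "L2_rel f f"
    then have f: "sq_integrable f" by (simp add: L2_rel_def)
    have "(LINT \<theta>|leb_I. inner (f \<theta>) (f \<theta>)) = 0 \<longleftrightarrow> (AE \<theta> in leb_I. inner (f \<theta>) (f \<theta>) = 0)"
      by (rule integral_nonneg_eq_0_iff_AE[OF sq_integrable_inner[OF f f]]) simp
    then show "((LINT \<theta>|leb_I. inner (f \<theta>) (f \<theta>)) = 0) = L2_rel f (\<lambda>_. 0)"
      using f by (simp add: L2_rel_def sq_integrable_zero)
  qed
  show "norm f = sqrt (inner f f)"
    by (rule norm_L2_def)
qed

end


section \<open>The Sobolev space of order one on the same interval\<close>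

text \<open>\<open>is_primitive f g\<close>: on the interval, \<open>f\<close> is absolutely continuous with
  almost everywhere derivative \<open>g\<close>.\<close>

definition is_primitive :: "(real \<Rightarrow> 'a::euclidean_space) \<Rightarrow> 'a L2 \<Rightarrow> bool" where
  "is_primitive f g \<longleftrightarrow>
     (\<forall>\<theta>\<in>{-1..0}. f \<theta> = f (-1) + (LINT s|lebesgue_on {-1..\<theta>}. rep_L2 g s))"

definition H1 :: "'a::euclidean_space L2 set" where
  "H1 = {\<phi>. \<exists>f g. is_primitive f g \<and> \<phi> = L2_of f}"

definition H1_deriv :: "'a::euclidean_space L2 \<Rightarrow> 'a L2" where
  "H1_deriv \<phi> = (THE g. \<exists>f. is_primitive f g \<and> \<phi> = L2_of f)"

text \<open>The continuous representative, used for the point values of an element of \<^const>\<open>H1\<close>; it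
  is unique on the interval only.\<close>

definition cont_rep :: "'a::euclidean_space L2 \<Rightarrow> real \<Rightarrow> 'a" where
  "cont_rep \<phi> = (SOME f. continuous_on {-1..0} f \<and> \<phi> = L2_of f)"


section \<open>Semigroups and their generators\<close>

definition C0_semigroup :: "(real \<Rightarrow> 'a \<Rightarrow> 'a::real_normed_vector) \<Rightarrow> bool" where
  "C0_semigroup T \<longleftrightarrow>
     (\<forall>t\<ge>0. bounded_linear (T t)) \<and>
     (\<forall>x. T 0 x = x) \<and>
     (\<forall>s\<ge>0. \<forall>t\<ge>0. \<forall>x. T (s + t) x = T s (T t x)) \<and>
     (\<forall>x. ((\<lambda>t. T t x) \<longlongrightarrow> x) (at_right 0))"

text \<open>\<open>generates D A T\<close>: the generator of \<open>T\<close> is the operator \<open>A\<close> with domain exactly \<open>D\<close>.\<close>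

definition generates ::
    "'a set \<Rightarrow> ('a \<Rightarrow> 'a) \<Rightarrow> (real \<Rightarrow> 'a \<Rightarrow> 'a::real_normed_vector) \<Rightarrow> bool" where
  "generates D A T \<longleftrightarrow>
     C0_semigroup T \<and>
     (\<forall>x y. ((\<lambda>h. (T h x - x) /\<^sub>R h) \<longlongrightarrow> y) (at_right 0) \<longleftrightarrow> x \<in> D \<and> y = A x)"

definition graph_norm :: "('a \<Rightarrow> 'a) \<Rightarrow> 'a::real_normed_vector \<Rightarrow> real" where
  "graph_norm A x = norm x + norm (A x)"


section \<open>The operators of the neutral type system\<close>

text \<open>\<open>Am1\<close>, \<open>A2\<close>, \<open>A3\<close> are the coefficients with indices -1, 2, 3. The norm of the product
  type is the Hilbert space norm. The \<open>dual\<close> names refer to the operator written with a tilde.\<close>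

type_synonym 'n M2 = "(real^'n) \<times> (real^'n) L2"

definition neutral_dom :: "real^'n^'n \<Rightarrow> 'n::finite M2 set" where
  "neutral_dom Am1 =
     {(v, \<phi>). \<phi> \<in> H1 \<and> v = cont_rep \<phi> 0 - Am1 *v cont_rep \<phi> (-1)}"

definition neutral_op ::
    "(real \<Rightarrow> real^'n^'n) \<Rightarrow> (real \<Rightarrow> real^'n^'n) \<Rightarrow> 'n::finite M2 \<Rightarrow> 'n M2" where
  "neutral_op A2 A3 = (\<lambda>(v, \<phi>).
     (LINT \<theta>|leb_I. A2 \<theta> *v rep_L2 (H1_deriv \<phi>) \<theta> + A3 \<theta> *v rep_L2 \<phi> \<theta>,
      H1_deriv \<phi>))"

definition dual_r :: "(real \<Rightarrow> real^'n^'n) \<Rightarrow> 'n::finite M2 \<Rightarrow> (real^'n) L2" where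
  "dual_r A2 = (\<lambda>(w, \<psi>). \<psi> + L2_of (\<lambda>\<theta>. A2 \<theta> *v w))"

definition dual_dom ::
    "real^'n^'n \<Rightarrow> (real \<Rightarrow> real^'n^'n) \<Rightarrow> 'n::finite M2 set" where
  "dual_dom Am1 A2 =
     {x. dual_r A2 x \<in> H1 \<and>
         Am1 *v cont_rep (dual_r A2 x) 0 = cont_rep (dual_r A2 x) (-1)}"

definition dual_op ::
    "(real \<Rightarrow> real^'n^'n) \<Rightarrow> (real \<Rightarrow> real^'n^'n) \<Rightarrow> 'n::finite M2 \<Rightarrow> 'n M2" where
  "dual_op A2 A3 = (\<lambda>(w, \<psi>).
     (cont_rep (dual_r A2 (w, \<psi>)) 0,
      - H1_deriv (dual_r A2 (w, \<psi>)) + L2_of (\<lambda>\<theta>. A3 \<theta> *v w)))"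


section \<open>The correspondence of initial states\<close>

text \<open>\<open>initial_states_related Am1 S T \<xi> x\<close>: the trajectory of \<open>\<xi>\<close> under \<open>S\<close> (generated by
  \<open>neutral_op\<close>) and the trajectory of \<open>x\<close> under \<open>T\<close> (generated by \<open>dual_op\<close>)
  come from one and the same function \<open>w\<close>. Continuity fixes the values of \<open>w\<close> before time one,
  which the second component determines only almost everywhere.\<close>

definition initial_states_related ::
    "real^'n^'n \<Rightarrow> (real \<Rightarrow> 'n M2 \<Rightarrow> 'n M2) \<Rightarrow> (real \<Rightarrow> 'n M2 \<Rightarrow> 'n M2)
      \<Rightarrow> 'n::finite M2 \<Rightarrow> 'n M2 \<Rightarrow> bool" where
  "initial_states_related Am1 S T \<xi> x \<longleftrightarrow>
     (\<exists>w. continuous_on {0..} w \<and>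
       (\<forall>t\<ge>0. S t \<xi> = (w (t + 1) - Am1 *v w t, L2_of (\<lambda>\<theta>. w (t + 1 + \<theta>)))) \<and>
       (\<forall>t\<ge>0. fst (T t x) = w t))"

text \<open>The explicit formula, with \<open>w s = z0 (s - 1)\<close> for \<open>s\<close> between 0 and 1. As \<open>\<theta>\<close> is not
  positive, the integral from \<open>0\<close> to \<open>\<theta>\<close> is minus the integral over the interval from \<open>\<theta>\<close> to
  \<open>0\<close>.\<close>

definition neutral_F ::
    "(real \<Rightarrow> real^'n^'n) \<Rightarrow> (real \<Rightarrow> real^'n^'n) \<Rightarrow> 'n::finite M2 \<Rightarrow> 'n M2" where
  "neutral_F A2 A3 = (\<lambda>(v, z0).
     let w = (\<lambda>s. cont_rep z0 (s - 1));
         dw = (\<lambda>s. rep_L2 (H1_deriv z0) (s - 1))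
     in (w 0,
         L2_of (\<lambda>\<theta>. dw (- \<theta>)
           - (LINT \<tau>|lebesgue_on {\<theta>..0}. A2 \<tau> *v dw (\<tau> - \<theta>) + A3 \<tau> *v w (\<tau> - \<theta>))
           - A2 \<theta> *v w 0)))"

end

theory Submission
  imports Defs
begin

text \<open>An element of the domain of the neutral operator is determined by \<open>c = w(0)\<close> and
  \<open>g = z0'\<close>, and its graph norm is equivalent to the norm of \<open>(c, g)\<close>. In these coordinates
  \<open>F\<close> is triangular: its first component is \<open>c\<close>, and the second one is, up to the reflection
  of the interval and a bounded function of \<open>c\<close>, the identity minus a Volterra convolution operator
  applied to \<open>g\<close>. The Neumann series of the latter converges, which gives the bounded inverse.

  For the trajectories, integration by parts in the convolution shows that \<open>F\<close> intertwines the two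
  generators on the domain of the square of the neutral operator. That domain is a core and solutions
  of the dual Cauchy problem are unique, so \<open>F\<close> intertwines the semigroups. Hence the first component
  of the dual trajectory is the value at \<open>-1\<close> of the second component of the neutral one,
  whose second components are translates of a single function.\<close>

section \<open>Completeness of the space of square integrable functions\<close>

text \<open>The substitution \<open>\<rho> = -1 - \<theta>\<close> makes the integral in F causal:
  its value at \<open>\<rho>\<close> involves the input only to the left of \<open>\<rho>\<close>.
  Pointwise bounds by the squared mass up to \<open>\<rho>\<close> can therefore be iterated, and
  kernels of any size are allowed. Completeness of the function space enters through the Neumann
  series, the Baire argument that bounds a semigroup near time zero, and the integrals of orbits.
  The obstacle for trajectories is that F is continuous only in the graph norm, so an orbit must be
  differentiable in that norm before F can be applied to its derivative. This forces the domain of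
  the square. There the two side conditions match: that the neutral operator maps the state back
  into its domain becomes, after integration by parts, the boundary condition of the dual domain.
  That at most one dual state is related to a given neutral state follows from surjectivity of F:
  every x is F of some \<open>\<eta>\<close>, and \<open>\<eta>\<close> can be recovered from w on
  the unit interval.\<close>

lemma Cauchy_Schwarz_integral:
  fixes p q :: "'b \<Rightarrow> real"
  assumes [measurable]: "p \<in> borel_measurable M" "q \<in> borel_measurable M"
    and p: "integrable M (\<lambda>x. (p x)\<^sup>2)" and q: "integrable M (\<lambda>x. (q x)\<^sup>2)"
  shows integrable_mult_square_integrable: "integrable M (\<lambda>x. p x * q x)"
    and "(\<integral>x. p x * q x \<partial>M)\<^sup>2 \<le> (\<integral>x. (p x)\<^sup>2 \<partial>M) * (\<integral>x. (q x)\<^sup>2 \<partial>M)"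
proof -
  have "\<bar>a * b\<bar> \<le> a\<^sup>2 + b\<^sup>2" for a b :: real
  proof -
    have "0 \<le> (\<bar>a\<bar> - \<bar>b\<bar>)\<^sup>2" "0 \<le> \<bar>a\<bar> * \<bar>b\<bar>" by auto
    then show ?thesis unfolding power2_diff abs_mult power2_abs by linarith
  qed
  then show pq: "integrable M (\<lambda>x. p x * q x)"
    by (intro Bochner_Integration.integrable_bound[OF Bochner_Integration.integrable_add[OF p q]]) auto
  let ?a = "\<integral>x. (p x)\<^sup>2 \<partial>M" and ?b = "\<integral>x. p x * q x \<partial>M" and ?c = "\<integral>x. (q x)\<^sup>2 \<partial>M"
  \<comment> \<open>The choice \<open>t = ?b / ?c\<close> minimises this quadratic and gives the
    inequality; if \<open>?c = 0\<close> the expression is affine in \<open>t\<close>, which forces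
    \<open>?b = 0\<close>.\<close>
  have nn: "0 \<le> ?a - 2 * t * ?b + t\<^sup>2 * ?c" for t
  proof -
    have "0 \<le> (\<integral>x. (p x - t * q x)\<^sup>2 \<partial>M)" by simp
    also have "\<dots> = (\<integral>x. (p x)\<^sup>2 - 2 * t * (p x * q x) + t\<^sup>2 * (q x)\<^sup>2 \<partial>M)"
      by (simp add: power2_diff power_mult_distrib algebra_simps)
    also have "\<dots> = ?a - 2 * t * ?b + t\<^sup>2 * ?c"
      using p q pq by simp
    finally show ?thesis .
  qed
  have "0 \<le> ?c" by simp
  show "?b\<^sup>2 \<le> ?a * ?c"
  proof (cases "?c = 0")
    case True
    have "?b = 0"
    proof (rule ccontr)
      assume "?b \<noteq> 0"
      \<comment> \<open>For this \<open>t\<close> the expression equals -1.\<close>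
      then show False using nn[of "(?a + 1) / (2 * ?b)"] True by simp
    qed
    then show ?thesis by simp
  next
    case False
    with \<open>0 \<le> ?c\<close> have c: "0 < ?c" by (metis order_le_less)
    have "0 \<le> ?c * (?a - 2 * (?b / ?c) * ?b + (?b / ?c)\<^sup>2 * ?c)"
      by (intro mult_nonneg_nonneg nn) simp
    also have "\<dots> = ?a * ?c - ?b\<^sup>2"
      using c by (simp add: field_simps power2_eq_square)
    finally show ?thesis by simp
  qed
qed

section \<open>Classes and their representatives\<close>

lemma L2_of_rep [simp]: "L2_of (rep_L2 f) = f"
  using Quotient3_L2 by (rule Quotient3_abs_rep)

lemma sq_integrable_rep: "sq_integrable (rep_L2 f)"
  using Quotient3_rep_reflp[OF Quotient3_L2, of f] by (simp add: L2_rel_def)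

lemma L2_of_eqI:
  assumes "sq_integrable f" "sq_integrable g" "AE x in leb_I. f x = g x"
  shows "L2_of f = L2_of g"
  using assms by (intro Quotient3_rel_abs[OF Quotient3_L2]) (simp add: L2_rel_def)

lemma AE_rep_L2_of:
  assumes "sq_integrable f"
  shows "AE x in leb_I. rep_L2 (L2_of f) x = f x"
proof -
  have "L2_rel (rep_L2 (L2_of f)) f"
    using assms sq_integrable_rep[of "L2_of f"]
    by (subst Quotient3_rel[OF Quotient3_L2, symmetric]) (simp add: L2_rel_def)
  then show ?thesis by (simp add: L2_rel_def)
qed

lemma AE_leb_I_iff: "(AE x in leb_I. P x) \<longleftrightarrow> (AE x in lborel. x \<in> {-1..0} \<longrightarrow> P x)"
  by (subst AE_restrict_space_iff) (auto simp: AE_completion_iff)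

lemma sq_integrable_of_borel:
  assumes [measurable]: "h \<in> borel_measurable borel" and "integrable lborel (\<lambda>x. (norm (h x))\<^sup>2)"
  shows "sq_integrable h"
proof -
  have h: "h \<in> borel_measurable leb_I"
    by (intro measurable_restrict_space1 measurable_completion) simp
  have "integrable lebesgue (\<lambda>x. (norm (h x))\<^sup>2)"
    using assms by (simp add: integrable_completion)
  then have "integrable leb_I (\<lambda>x. (norm (h x))\<^sup>2)"
    by (subst integrable_restrict_space) (auto intro!: integrable_mult_indicator simp del: real_scaleR_def)
  with h show ?thesis by (simp add: sq_integrable_def)
qed

text \<open>Each coordinate is Lebesgue measurable, hence almost everywhere equal to a Borel
  function; finitely many coordinates give finitely many null sets.\<close>

lemma ex_borel_rep:
  fixes f :: "'a::euclidean_space L2"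
  shows "\<exists>h. h \<in> borel_measurable borel \<and> (\<forall>x. x \<notin> {-1..0} \<longrightarrow> h x = 0) \<and>
    (AE x in leb_I. rep_L2 f x = h x)"
proof -
  define F where "F x = (if x \<in> {-1..0} then rep_L2 f x else 0)" for x
  have F: "F \<in> borel_measurable lebesgue"
    unfolding F_def using sq_integrable_rep[of f]
    by (subst borel_measurable_if) (auto simp: sq_integrable_def)
  have "\<exists>g\<in>borel_measurable lborel. AE x in lborel. F x \<bullet> b = g x" for b
    by (rule completion_ex_borel_measurable_real) (use F in measurable)
  then obtain g where g: "\<And>b. g b \<in> borel_measurable lborel" "\<And>b. AE x in lborel. F x \<bullet> b = g b x"
    by metis
  define h where "h x = indicator {-1..0} x *\<^sub>R (\<Sum>b\<in>Basis. g b x *\<^sub>R b)" for x :: real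
  have "h \<in> borel_measurable borel"
    unfolding h_def using g(1) by measurable
  moreover have "AE x in lborel. \<forall>b\<in>Basis. F x \<bullet> b = g b x"
    using g(2) by (intro AE_finite_allI) auto
  then have "AE x in lborel. x \<in> {-1..0} \<longrightarrow> rep_L2 f x = h x"
  proof eventually_elim
    case (elim x)
    then show ?case
      using euclidean_representation[of "F x"] by (auto simp: h_def F_def)
  qed
  ultimately show ?thesis
    by (intro exI[of _ h]) (auto simp: AE_leb_I_iff h_def)
qed

text \<open>A Borel measurable representative, extended by zero to the whole line, so that translations
  and Fubini's theorem for the Lebesgue--Borel measure apply to it.\<close>

definition brep :: "'a::euclidean_space L2 \<Rightarrow> real \<Rightarrow> 'a" where
  "brep f = (SOME h. h \<in> borel_measurable borel \<and> (\<forall>x. x \<notin> {-1..0} \<longrightarrow> h x = 0) \<and>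
    (AE x in leb_I. rep_L2 f x = h x))"

lemma
  shows brep_measurable [measurable]: "brep f \<in> borel_measurable borel"
    and brep_eq_0: "x \<notin> {-1..0} \<Longrightarrow> brep f x = 0"
    and AE_rep_eq_brep: "AE x in leb_I. rep_L2 f x = brep f x"
  using someI_ex[OF ex_borel_rep[of f]] unfolding brep_def by blast+

lemma sq_integrable_brep: "sq_integrable (brep f)"
proof -
  have m: "brep f \<in> borel_measurable leb_I"
    by (intro measurable_restrict_space1 measurable_completion) simp
  then have "integrable leb_I (\<lambda>x. (norm (brep f x))\<^sup>2)"
    using sq_integrable_rep[of f] AE_rep_eq_brep[of f] unfolding sq_integrable_def
    by (subst integrable_cong_AE[of _ _ "\<lambda>x. (norm (rep_L2 f x))\<^sup>2"]) (auto elim: eventually_mono)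
  with m show ?thesis by (simp add: sq_integrable_def)
qed

lemma L2_of_brep [simp]: "L2_of (brep f) = f"
proof -
  have "L2_of (brep f) = L2_of (rep_L2 f)"
    by (rule L2_of_eqI) (use sq_integrable_brep sq_integrable_rep AE_rep_eq_brep[of f] in \<open>auto elim: eventually_mono\<close>)
  then show ?thesis by simp
qed

lemma AE_brep_L2_of:
  assumes "sq_integrable h"
  shows "AE x in lborel. x \<in> {-1..0} \<longrightarrow> brep (L2_of h) x = h x"
  using AE_rep_L2_of[OF assms] AE_rep_eq_brep[of "L2_of h"]
  unfolding AE_leb_I_iff by eventually_elim auto

lemma leb_I_eq_lborel:
  fixes h :: "real \<Rightarrow> 'b::{banach, second_countable_topology}"
  assumes [measurable]: "h \<in> borel_measurable borel" and h: "\<And>x. x \<notin> {-1..0} \<Longrightarrow> h x = 0"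
  shows integrable_leb_I_iff: "integrable leb_I h \<longleftrightarrow> integrable lborel h"
    and integral_leb_I: "integral\<^sup>L leb_I h = integral\<^sup>L lborel h"
proof -
  have *: "(\<lambda>x. indicator {-1..0} x *\<^sub>R h x) = h"
    using h by (auto simp: indicator_def)
  show "integrable leb_I h \<longleftrightarrow> integrable lborel h"
    by (subst integrable_restrict_space) (auto simp: * integrable_completion)
  show "integral\<^sup>L leb_I h = integral\<^sup>L lborel h"
    by (subst integral_restrict_space) (auto simp: * integral_completion)
qed

lemma integrable_norm2_brep: "integrable lborel (\<lambda>x. (norm (brep f x))\<^sup>2)"
  using sq_integrable_brep[of f] unfolding sq_integrable_def
  by (subst (asm) integrable_leb_I_iff) (auto simp: brep_eq_0)

lemma norm_L2_sq: "(norm f)\<^sup>2 = (\<integral>x. (norm (brep f x))\<^sup>2 \<partial>lborel)"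
proof -
  have "(norm f)\<^sup>2 = inner (L2_of (brep f)) (L2_of (brep f))"
    by (simp add: power2_norm_eq_inner)
  also have "\<dots> = (LINT x|leb_I. inner (brep f x) (brep f x))"
  proof -
    have "inner f f = (LINT x|leb_I. inner (rep_L2 f x) (rep_L2 f x))"
      by (simp add: inner_L2_def)
    also have "\<dots> = (LINT x|leb_I. inner (brep f x) (brep f x))"
      using AE_rep_eq_brep[of f] sq_integrable_rep[of f] sq_integrable_brep[of f]
      by (intro integral_cong_AE) (auto simp: sq_integrable_def elim: eventually_mono)
    finally show ?thesis by simp
  qed
  also have "\<dots> = (\<integral>x. (norm (brep f x))\<^sup>2 \<partial>lborel)"
    by (subst integral_leb_I) (auto simp: brep_eq_0 power2_norm_eq_inner)
  finally show ?thesis .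
qed

lemma norm_L2_of_sq:
  assumes "sq_integrable h"
  shows "(norm (L2_of h))\<^sup>2 = (LINT x|leb_I. (norm (h x))\<^sup>2)"
proof -
  have "(norm (L2_of h))\<^sup>2 = (LINT x|leb_I. inner (rep_L2 (L2_of h) x) (rep_L2 (L2_of h) x))"
    by (simp add: power2_norm_eq_inner inner_L2_def)
  also have "\<dots> = (LINT x|leb_I. (norm (h x))\<^sup>2)"
    using AE_rep_L2_of[OF assms] sq_integrable_rep[of "L2_of h"] assms
    by (intro integral_cong_AE) (auto simp: sq_integrable_def power2_norm_eq_inner elim: eventually_mono)
  finally show ?thesis .
qed

lemma L2_of_add: "sq_integrable f \<Longrightarrow> sq_integrable g \<Longrightarrow> L2_of f + L2_of g = L2_of (\<lambda>x. f x + g x)"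
  and L2_of_diff: "sq_integrable f \<Longrightarrow> sq_integrable g \<Longrightarrow> L2_of f - L2_of g = L2_of (\<lambda>x. f x - g x)"
  and L2_of_scaleR: "sq_integrable f \<Longrightarrow> c *\<^sub>R L2_of f = L2_of (\<lambda>x. c *\<^sub>R f x)"
  by (simp_all add: plus_L2.abs_eq minus_L2.abs_eq scaleR_L2.abs_eq L2_rel_def)

text \<open>On the interval both sides represent the same class, and off it both vanish. Used to
  turn identities between classes into identities on the whole line, where translation and
  reflection act.\<close>

lemma AE_brep_eqI:
  assumes "f = L2_of h" "sq_integrable h" "\<And>x. x \<notin> {-1..0} \<Longrightarrow> h x = 0"
  shows "AE x in lborel. brep f x = h x"
  using AE_brep_L2_of[OF assms(2)]
proof eventually_elim
  case (elim x)
  then show ?case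
    using assms(1) assms(3)[of x] brep_eq_0[of x f] by (cases "x \<in> {-1..0}") auto
qed

lemma brep_add: "AE x in lborel. brep (f + g) x = brep f x + brep g x"
  by (rule AE_brep_eqI) (simp_all only: L2_of_add[symmetric] sq_integrable_brep sq_integrable_add L2_of_brep brep_eq_0 add_0_left not_False_eq_True)

lemma brep_diff: "AE x in lborel. brep (f - g) x = brep f x - brep g x"
  by (rule AE_brep_eqI) (simp_all only: L2_of_diff[symmetric] sq_integrable_brep sq_integrable_diff L2_of_brep brep_eq_0 diff_0_right not_False_eq_True)

lemma brep_scaleR: "AE x in lborel. brep (c *\<^sub>R f) x = c *\<^sub>R brep f x"
  by (rule AE_brep_eqI) (simp_all only: L2_of_scaleR[symmetric] sq_integrable_brep sq_integrable_scaleR L2_of_brep brep_eq_0 scaleR_zero_right not_False_eq_True)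

lemma integrable_indicator_I: "integrable lborel (\<lambda>x. indicator {-1..0::real} x :: real)"
  by (simp add: integrable_indicator_iff)

lemma integrable_norm_brep: "integrable lborel (\<lambda>x. norm (brep f x))"
proof -
  have "integrable lborel (\<lambda>x. indicator {-1..0::real} x * norm (brep f x))"
  proof (rule integrable_mult_square_integrable)
    have "(\<lambda>x. (indicator {-1..0::real} x :: real)\<^sup>2) = indicator {-1..0}"
      by (auto simp: indicator_def)
    then show "integrable lborel (\<lambda>x. (indicator {-1..0::real} x :: real)\<^sup>2)"
      using integrable_indicator_I by simp
  qed (use integrable_norm2_brep in auto)
  moreover have "(\<lambda>x. indicator {-1..0::real} x * norm (brep f x)) = (\<lambda>x. norm (brep f x))"
    using brep_eq_0[of _ f] by (intro ext) (auto simp: indicator_def)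
  ultimately show ?thesis by simp
qed

lemma integrable_brep: "integrable lborel (brep f)"
  using integrable_norm_brep[of f] by (simp add: integrable_norm_iff)

text \<open>Cauchy-Schwarz against the indicator of the interval. It supplies the modulus of
  continuity of primitives.\<close>

lemma integral_indicator_norm_brep_le:
  assumes "a \<le> b"
  shows "(\<integral>x. indicator {a..b} x * norm (brep f x) \<partial>lborel) \<le> sqrt (b - a) * norm f"
proof -
  have eq: "(\<lambda>x. (indicator {a..b} x :: real)\<^sup>2) = indicator {a..b}"
    by (auto simp: indicator_def)
  have "(\<integral>x. indicator {a..b} x * norm (brep f x) \<partial>lborel)\<^sup>2
      \<le> (\<integral>x. (indicator {a..b} x)\<^sup>2 \<partial>lborel) * (\<integral>x. (norm (brep f x))\<^sup>2 \<partial>lborel)"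
    by (rule Cauchy_Schwarz_integral) (auto simp: eq integrable_norm2_brep emeasure_lborel_Icc_eq)
  also have "\<dots> = (b - a) * (norm f)\<^sup>2"
    using assms by (simp add: eq norm_L2_sq)
  also have "\<dots> = (sqrt (b - a) * norm f)\<^sup>2"
    using assms by (simp add: power_mult_distrib)
  finally show ?thesis
    using assms by (subst (asm) power2_le_iff_abs_le) auto
qed

lemma integral_norm_brep_le: "(\<integral>x. norm (brep f x) \<partial>lborel) \<le> norm f"
proof -
  have "(\<lambda>x. indicator {-1..0::real} x * norm (brep f x)) = (\<lambda>x. norm (brep f x))"
    using brep_eq_0[of _ f] by (intro ext) (auto simp: indicator_def)
  then show ?thesis
    using integral_indicator_norm_brep_le[of "-1" 0 f] by simp
qed

section \<open>The Riesz-Fischer theorem\<close>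

text \<open>On an interval of length one the integral of the norm is at most the L2 norm, so the
  increments are summable in L1. Hence the sum of their pointwise norms is finite almost everywhere
  and the telescoping series converges there.\<close>

lemma AE_convergent_brep:
  fixes Y :: "nat \<Rightarrow> 'a::euclidean_space L2"
  assumes "\<And>n. norm (Y (Suc n) - Y n) \<le> (1/2) ^ n"
  shows "AE x in lborel. convergent (\<lambda>n. brep (Y n) x)"
proof -
  define d where "d n x = norm (brep (Y (Suc n) - Y n) x)" for n x
  have [measurable]: "d n \<in> borel_measurable borel" for n
    unfolding d_def by measurable
  have "(\<integral>\<^sup>+x. (\<Sum>n. ennreal (d n x)) \<partial>lborel) = (\<Sum>n. \<integral>\<^sup>+x. ennreal (d n x) \<partial>lborel)"
    by (rule nn_integral_suminf) measurable
  also have "\<dots> \<le> (\<Sum>n. ennreal ((1/2) ^ n))"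
  proof (rule suminf_le)
    fix n
    have "(\<integral>\<^sup>+x. ennreal (d n x) \<partial>lborel) = ennreal (\<integral>x. d n x \<partial>lborel)"
      unfolding d_def by (intro nn_integral_eq_integral integrable_norm_brep) auto
    also have "\<dots> \<le> ennreal ((1/2) ^ n)"
      using integral_norm_brep_le[of "Y (Suc n) - Y n"] assms[of n]
      by (intro ennreal_leI) (simp add: d_def)
    finally show "(\<integral>\<^sup>+x. ennreal (d n x) \<partial>lborel) \<le> ennreal ((1/2) ^ n)" .
  qed (rule summableI)+
  also have "\<dots> < \<infinity>"
    unfolding infinity_ennreal_def less_top[symmetric]
    by (rule ennreal_suminf_neq_top[OF summable_geometric]) auto
  finally have "AE x in lborel. (\<Sum>n. ennreal (d n x)) \<noteq> \<infinity>"
    by (intro nn_integral_PInf_AE) auto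
  moreover have "AE x in lborel. \<forall>n. brep (Y (Suc n) - Y n) x = brep (Y (Suc n)) x - brep (Y n) x"
    unfolding AE_all_countable using brep_diff by blast
  ultimately show ?thesis
  proof eventually_elim
    case (elim x)
    have "summable (\<lambda>n. d n x)"
      using elim(1) by (intro summable_suminf_not_top) (auto simp: d_def)
    then have "summable (\<lambda>n. brep (Y (Suc n)) x - brep (Y n) x)"
      using elim(2) by (simp add: d_def summable_norm_cancel)
    then have "convergent (\<lambda>n. \<Sum>i<n. brep (Y (Suc i)) x - brep (Y i) x)"
      by (simp add: summable_iff_convergent)
    then have "convergent (\<lambda>n. brep (Y n) x - brep (Y 0) x)"
      by (simp only: sum_lessThan_telescope[of "\<lambda>n. brep (Y n) x"])
    then have "convergent (\<lambda>n. (brep (Y n) x - brep (Y 0) x) + brep (Y 0) x)"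
      by (rule convergent_add[OF _ convergent_const])
    then show ?case by simp
  qed
qed

text \<open>The hypothesis is a nonnegative integral, the form that Fatou's lemma delivers; square
  integrability of \<open>h\<close> is then a conclusion, from that of
  \<open>h - brep f\<close>.\<close>

lemma norm_L2_of_diff_le:
  assumes [measurable]: "h \<in> borel_measurable borel"
    and le: "(\<integral>\<^sup>+x. ennreal ((norm (h x - brep f x))\<^sup>2) \<partial>lborel) \<le> ennreal (c\<^sup>2)" and "0 \<le> c"
  shows "sq_integrable h" and "norm (L2_of h - f) \<le> c"
proof -
  define g where "g x = h x - brep f x" for x
  have [measurable]: "g \<in> borel_measurable borel"
    unfolding g_def by measurable
  have int: "integrable lborel (\<lambda>x. (norm (g x))\<^sup>2)"
    using le by (intro integrableI_nonneg) (auto simp: g_def intro: le_less_trans)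
  then have g: "sq_integrable g"
    by (intro sq_integrable_of_borel) measurable
  have h: "h = (\<lambda>x. g x + brep f x)"
    by (simp add: g_def)
  show "sq_integrable h"
    unfolding h by (intro sq_integrable_add g sq_integrable_brep)
  then have "L2_of h - f = L2_of g"
    using L2_of_diff[OF _ sq_integrable_brep[of f], of h] by (simp add: g_def[abs_def])
  then have "(norm (L2_of h - f))\<^sup>2 = (LINT x|leb_I. (norm (g x))\<^sup>2)"
    using norm_L2_of_sq[OF g] by simp
  also have "\<dots> = (\<integral>x. indicator {-1..0} x *\<^sub>R (norm (g x))\<^sup>2 \<partial>lborel)"
    by (subst integral_restrict_space) (auto intro!: integral_completion)
  also have "\<dots> \<le> (\<integral>x. (norm (g x))\<^sup>2 \<partial>lborel)"
    using int by (intro integral_mono integrable_mult_indicator) (auto simp: indicator_def)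
  also have "\<dots> \<le> c\<^sup>2"
    using le int unfolding g_def[symmetric]
    by (subst (asm) nn_integral_eq_integral) auto
  finally show "norm (L2_of h - f) \<le> c"
    using \<open>0 \<le> c\<close> by (rule power2_le_imp_le)
qed

text \<open>Fatou's lemma, applied to the differences with a fixed \<open>Y n\<close>, bounds the
  distance from the pointwise limit to \<open>Y n\<close> by the tail of the geometric
  series.\<close>

lemma Riesz_Fischer:
  fixes Y :: "nat \<Rightarrow> 'a::euclidean_space L2"
  assumes Y: "\<And>n. norm (Y (Suc n) - Y n) \<le> (1/2) ^ n"
  shows "convergent Y"
proof -
  \<comment> \<open>The exact partial sum of the geometric series is kept so that the induction
    closes; only \<open>2 * (1/2) ^ n\<close> is used later.\<close>
  have dist: "norm (Y (n + k) - Y n) \<le> 2 * (1/2) ^ n - 2 * (1/2) ^ (n + k)" for n k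
  proof (induction k)
    case (Suc k)
    have "norm (Y (n + Suc k) - Y n) \<le> norm (Y (Suc (n + k)) - Y (n + k)) + norm (Y (n + k) - Y n)"
      using norm_triangle_ineq[of "Y (Suc (n + k)) - Y (n + k)" "Y (n + k) - Y n"] by simp
    then show ?case
      using Suc Y[of "n + k"] by simp
  qed simp
  \<comment> \<open>Where the sequence diverges \<open>lim\<close> has some unspecified value; this
    happens only on a null set, and \<open>h\<close> is measurable all the same.\<close>
  define h where "h x = lim (\<lambda>n. brep (Y n) x)" for x
  have hm [measurable]: "h \<in> borel_measurable borel"
    unfolding h_def by (rule borel_measurable_lim_metric) measurable
  have le: "(\<integral>\<^sup>+x. ennreal ((norm (h x - brep (Y n) x))\<^sup>2) \<partial>lborel) \<le> ennreal ((2 * (1/2) ^ n)\<^sup>2)" for n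
  proof -
    have "AE x in lborel. ennreal ((norm (h x - brep (Y n) x))\<^sup>2)
        = liminf (\<lambda>k. ennreal ((norm (brep (Y (n + k)) x - brep (Y n) x))\<^sup>2))"
      using AE_convergent_brep[OF Y]
    proof eventually_elim
      case (elim x)
      then have "(\<lambda>k. brep (Y k) x) \<longlonglongrightarrow> h x"
        unfolding h_def by (simp add: convergent_LIMSEQ_iff)
      then have "(\<lambda>k. brep (Y (k + n)) x) \<longlonglongrightarrow> h x"
        by (rule LIMSEQ_ignore_initial_segment)
      then have "(\<lambda>k. ennreal ((norm (brep (Y (n + k)) x - brep (Y n) x))\<^sup>2))
          \<longlonglongrightarrow> ennreal ((norm (h x - brep (Y n) x))\<^sup>2)"
        by (intro tendsto_intros) (simp add: add.commute)
      then show ?case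
        by (intro lim_imp_Liminf[symmetric]) auto
    qed
    then have "(\<integral>\<^sup>+x. ennreal ((norm (h x - brep (Y n) x))\<^sup>2) \<partial>lborel)
        = (\<integral>\<^sup>+x. liminf (\<lambda>k. ennreal ((norm (brep (Y (n + k)) x - brep (Y n) x))\<^sup>2)) \<partial>lborel)"
      by (rule nn_integral_cong_AE)
    also have "\<dots> \<le> liminf (\<lambda>k. \<integral>\<^sup>+x. ennreal ((norm (brep (Y (n + k)) x - brep (Y n) x))\<^sup>2) \<partial>lborel)"
      by (rule nn_integral_liminf) measurable
    also have "\<dots> \<le> ennreal ((2 * (1/2) ^ n)\<^sup>2)"
    proof (rule order_trans[OF Liminf_mono Liminf_const[THEN eq_refl]])
      show "\<forall>\<^sub>F k in sequentially. (\<integral>\<^sup>+x. ennreal ((norm (brep (Y (n + k)) x - brep (Y n) x))\<^sup>2) \<partial>lborel)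
          \<le> ennreal ((2 * (1/2) ^ n)\<^sup>2)"
      proof (intro always_eventually allI)
        fix k
        have "(\<integral>\<^sup>+x. ennreal ((norm (brep (Y (n + k)) x - brep (Y n) x))\<^sup>2) \<partial>lborel)
            = (\<integral>\<^sup>+x. ennreal ((norm (brep (Y (n + k) - Y n) x))\<^sup>2) \<partial>lborel)"
          using brep_diff[of "Y (n + k)" "Y n"] by (intro nn_integral_cong_AE) (auto elim: eventually_mono)
        also have "\<dots> = ennreal ((norm (Y (n + k) - Y n))\<^sup>2)"
          unfolding norm_L2_sq by (intro nn_integral_eq_integral integrable_norm2_brep) auto
        also have "\<dots> \<le> ennreal ((2 * (1/2) ^ n)\<^sup>2)"
        proof (intro ennreal_leI power_mono norm_ge_zero)
          have "0 \<le> (1/2 :: real) ^ (n + k)" by simp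
          then show "norm (Y (n + k) - Y n) \<le> 2 * (1/2) ^ n"
            using dist[of n k] by linarith
        qed
        finally show "(\<integral>\<^sup>+x. ennreal ((norm (brep (Y (n + k)) x - brep (Y n) x))\<^sup>2) \<partial>lborel)
            \<le> ennreal ((2 * (1/2) ^ n)\<^sup>2)" .
      qed
    qed simp
    finally show ?thesis .
  qed
  have "(\<lambda>n. norm (Y n - L2_of h)) \<longlonglongrightarrow> 0"
  proof (rule tendsto_sandwich[OF _ _ tendsto_const])
    show "\<forall>\<^sub>F n in sequentially. norm (Y n - L2_of h) \<le> 2 * (1/2) ^ n"
      using norm_L2_of_diff_le(2)[OF hm le] by (simp add: norm_minus_commute)
    show "(\<lambda>n. 2 * (1/2 :: real) ^ n) \<longlonglongrightarrow> 0"
      by (intro tendsto_mult_right_zero LIMSEQ_power_zero) simp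
  qed simp
  then show ?thesis
    unfolding convergent_def using Lim_null tendsto_norm_zero_iff by blast
qed

instance L2 :: (euclidean_space) banach
proof
  fix X :: "nat \<Rightarrow> 'a L2"
  assume X: "Cauchy X"
  have "\<exists>N. \<forall>m\<ge>N. \<forall>n\<ge>N. norm (X m - X n) < (1/2) ^ k" for k :: nat
    using X unfolding Cauchy_iff by simp
  then obtain N where N: "\<And>k m n. m \<ge> N k \<Longrightarrow> n \<ge> N k \<Longrightarrow> norm (X m - X n) < (1/2 :: real) ^ k"
    by metis
  \<comment> \<open>The sum makes \<open>r k\<close> at least \<open>N k\<close>, and the summand
    \<open>k\<close> makes \<open>r\<close> strictly increasing. The subsequence then has
    geometrically small increments, and its limit is the limit of the whole Cauchy sequence.\<close>
  define r where "r k = k + (\<Sum>i\<le>k. N i)" for k :: nat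
  have rN: "N k \<le> r k" for k
    unfolding r_def by (rule trans_le_add2) (auto intro: member_le_sum)
  have r: "strict_mono r"
    unfolding strict_mono_Suc_iff r_def by auto
  have "convergent (X \<circ> r)"
  proof (rule Riesz_Fischer)
    fix k
    have "N k \<le> r (Suc k)"
      using rN[of k] strict_monoD[OF r, of k "Suc k"] by simp
    then show "norm ((X \<circ> r) (Suc k) - (X \<circ> r) k) \<le> (1/2) ^ k"
      using N[of k "r (Suc k)" "r k"] rN[of k] by simp
  qed
  then obtain l where "(X \<circ> r) \<longlonglongrightarrow> l"
    by (auto simp: convergent_def)
  with X r have "X \<longlonglongrightarrow> l"
    using Cauchy_converges_subseq by blast
  then show "convergent X"
    by (rule convergentI)
qed

section \<open>Primitives\<close>

text \<open>Since \<open>brep g\<close> vanishes off the interval, this is the primitive that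
  vanishes at -1, extended to the whole line by constants. The extension matters in convolutions,
  where arguments leave the interval.\<close>

definition prim :: "'a::euclidean_space L2 \<Rightarrow> real \<Rightarrow> 'a" where
  "prim g b = (\<integral>x. indicator {..b} x *\<^sub>R brep g x \<partial>lborel)"

lemma integrable_indicator_brep: "A \<in> sets borel \<Longrightarrow> integrable lborel (\<lambda>x. indicator A x *\<^sub>R brep g x)"
  by (intro integrable_mult_indicator integrable_brep) auto

lemma lebesgue_integral_rep_eq_prim:
  assumes "b \<le> 0"
  shows "(LINT s|lebesgue_on {-1..b}. rep_L2 g s) = prim g b"
proof -
  have sub: "{-1..b} \<subseteq> {-1..0}" using assms by auto
  have AE: "AE x in lebesgue_on {-1..b}. rep_L2 g x = brep g x"
    using AE_rep_eq_brep[of g] sub unfolding AE_leb_I_iff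
    by (subst AE_restrict_space_iff) (auto simp: AE_completion_iff elim!: eventually_mono)
  have "(LINT s|lebesgue_on {-1..b}. rep_L2 g s) = (LINT s|lebesgue_on {-1..b}. brep g s)"
    using AE sq_integrable_rep[of g] sq_integrable_brep[of g] measurable_restrict_mono[OF _ sub]
    by (intro integral_cong_AE) (auto simp: sq_integrable_def)
  also have "\<dots> = (\<integral>s. indicator {-1..b} s *\<^sub>R brep g s \<partial>lebesgue)"
    by (subst integral_restrict_space) auto
  also have "\<dots> = (\<integral>s. indicator {-1..b} s *\<^sub>R brep g s \<partial>lborel)"
    by (rule integral_completion) measurable
  also have "(\<lambda>s. indicator {-1..b} s *\<^sub>R brep g s) = (\<lambda>s. indicator {..b} s *\<^sub>R brep g s)"
    using brep_eq_0[of _ g] by (intro ext) (auto simp: indicator_def)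
  finally show ?thesis by (simp add: prim_def)
qed

lemma prim_add: "prim (f + g) b = prim f b + prim g b"
proof -
  have "prim (f + g) b = (\<integral>x. indicator {..b} x *\<^sub>R brep f x + indicator {..b} x *\<^sub>R brep g x \<partial>lborel)"
    unfolding prim_def using brep_add[of f g]
    by (intro integral_cong_AE) (auto elim!: eventually_mono simp: scaleR_add_right)
  then show ?thesis
    by (simp add: prim_def integrable_indicator_brep)
qed

lemma prim_scaleR: "prim (c *\<^sub>R f) b = c *\<^sub>R prim f b"
proof -
  have "prim (c *\<^sub>R f) b = (\<integral>x. c *\<^sub>R (indicator {..b} x *\<^sub>R brep f x) \<partial>lborel)"
    unfolding prim_def using brep_scaleR[of c f]
    by (intro integral_cong_AE) (auto elim!: eventually_mono)
  then show ?thesis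
    by (simp only: prim_def integral_scaleR_right)
qed

lemma norm_prim_le: "norm (prim g b) \<le> norm g"
proof -
  have "norm (prim g b) \<le> (\<integral>x. norm (indicator {..b} x *\<^sub>R brep g x) \<partial>lborel)"
    unfolding prim_def by (rule integral_norm_bound)
  also have "\<dots> \<le> (\<integral>x. norm (brep g x) \<partial>lborel)"
    by (intro integral_mono integrable_norm integrable_indicator_brep integrable_norm_brep)
      (auto simp: indicator_def)
  finally show ?thesis
    using integral_norm_brep_le[of g] by linarith
qed

lemma bounded_linear_prim: "bounded_linear (\<lambda>g. prim g b)"
  by (rule bounded_linear_intro[where K = 1]) (auto simp: prim_add prim_scaleR norm_prim_le)

lemma prim_zero [simp]: "prim 0 b = 0"
  and prim_diff: "prim (f - g) b = prim f b - prim g b"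
  and prim_minus: "prim (- f) b = - prim f b"
  using bounded_linear.linear[OF bounded_linear_prim[of b]] linear_0 linear_diff linear_neg by blast+

text \<open>Cauchy-Schwarz on the short interval: primitives of square integrable functions are
  Hoelder continuous with exponent 1/2.\<close>

lemma norm_prim_diff_le:
  assumes "a \<le> b"
  shows "norm (prim g b - prim g a) \<le> sqrt (b - a) * norm g"
proof -
  have "prim g b - prim g a = (\<integral>x. indicator {..b} x *\<^sub>R brep g x - indicator {..a} x *\<^sub>R brep g x \<partial>lborel)"
    by (simp add: prim_def integrable_indicator_brep)
  also have "norm \<dots> \<le> (\<integral>x. norm (indicator {..b} x *\<^sub>R brep g x - indicator {..a} x *\<^sub>R brep g x) \<partial>lborel)"
    by (rule integral_norm_bound)
  also have "\<dots> \<le> (\<integral>x. indicator {a..b} x *\<^sub>R norm (brep g x) \<partial>lborel)"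
    using assms by (intro integral_mono integrable_norm Bochner_Integration.integrable_diff
        integrable_indicator_brep integrable_mult_indicator integrable_norm_brep)
      (auto simp: indicator_def)
  also have "\<dots> \<le> sqrt (b - a) * norm g"
    using integral_indicator_norm_brep_le[OF assms] by simp
  finally show ?thesis .
qed

lemma continuous_on_prim [continuous_intros]: "continuous_on A (prim g)"
proof (rule continuous_on_subset)
  show "continuous_on UNIV (prim g)"
    unfolding continuous_on_iff
  proof (intro ballI allI impI)
    fix x e :: real
    assume e: "0 < e"
    \<comment> \<open>Solves \<open>sqrt d * (norm g + 1) = e\<close>; the added 1 avoids division
      by zero.\<close>
    define d where "d = (e / (norm g + 1))\<^sup>2"
    have g1: "0 < norm g + 1" by (simp add: add_nonneg_pos)
    then have d: "0 < d" "sqrt d = e / (norm g + 1)"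
      using e by (auto simp: d_def real_sqrt_unique zero_less_power)
    have "dist (prim g y) (prim g x) < e" if "dist y x < d" for y
    proof -
      have "dist (prim g y) (prim g x) \<le> sqrt \<bar>y - x\<bar> * norm g"
        using norm_prim_diff_le[of x y g] norm_prim_diff_le[of y x g]
        by (cases "x \<le> y") (auto simp: dist_norm norm_minus_commute)
      also have "\<dots> \<le> sqrt d * norm g"
        using that by (intro mult_right_mono) (auto simp: dist_real_def)
      also have "\<dots> < sqrt d * (norm g + 1)"
        using d(1) by simp
      also have "\<dots> = e" using d g1 by simp
      finally show ?thesis .
    qed
    with d show "\<exists>d>0. \<forall>x'\<in>UNIV. dist x' x < d \<longrightarrow> dist (prim g x') (prim g x) < e"
      by blast
  qed
qed simp

lemma prim_left [simp]: "prim g (-1) = 0"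
proof -
  have "AE x in lborel. x \<noteq> (-1::real)"
    by (rule AE_lborel_singleton)
  then have "prim g (-1) = (\<integral>x. 0 \<partial>(lborel :: real measure))"
    unfolding prim_def using brep_eq_0[of _ g]
    by (intro integral_cong_AE) (auto elim!: eventually_mono simp: indicator_def)
  then show ?thesis by simp
qed

text \<open>The positive and the negative part of \<open>h\<close>, taken as densities, define
  measures that agree and are finite on all half lines, hence coincide. Uniqueness of densities
  makes the two parts equal almost everywhere, which is possible only if both vanish.\<close>

lemma AE_eq_0_if_integral_greaterThan_eq_0:
  fixes h :: "real \<Rightarrow> real"
  assumes h: "integrable lborel h"
    and 0: "\<And>a. (\<integral>x. indicator {a<..} x * h x \<partial>lborel) = 0"
  shows "AE x in lborel. h x = 0"
proof -
  have [measurable]: "h \<in> borel_measurable borel"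
    using h by auto
  have int: "integrable lborel (\<lambda>x. max 0 (h x))" "integrable lborel (\<lambda>x. max 0 (- h x))"
    using h by auto
  have int': "integrable lborel (\<lambda>x. max 0 (h x) * indicator {a<..} x)"
    "integrable lborel (\<lambda>x. max 0 (- h x) * indicator {a<..} x)" for a
    using int by (auto intro: integrable_real_mult_indicator)
  have "density lborel (\<lambda>x. ennreal (max 0 (h x))) = density lborel (\<lambda>x. ennreal (max 0 (- h x)))"
  proof (rule measure_eqI_lessThan)
    fix a :: real
    have em: "emeasure (density lborel (\<lambda>x. ennreal (f x))) {a<..} = ennreal (\<integral>x. f x * indicator {a<..} x \<partial>lborel)"
      if [measurable]: "f \<in> borel_measurable borel" and "integrable lborel (\<lambda>x. f x * indicator {a<..} x)"
        "\<And>x. 0 \<le> f x" for f :: "real \<Rightarrow> real"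
    proof -
      have "emeasure (density lborel (\<lambda>x. ennreal (f x))) {a<..} = (\<integral>\<^sup>+x. ennreal (f x * indicator {a<..} x) \<partial>lborel)"
        by (subst emeasure_density) (auto simp: indicator_def intro!: nn_integral_cong)
      also have "\<dots> = ennreal (\<integral>x. f x * indicator {a<..} x \<partial>lborel)"
        using that by (intro nn_integral_eq_integral) auto
      finally show ?thesis .
    qed
    show "emeasure (density lborel (\<lambda>x. ennreal (max 0 (h x)))) {a<..} < \<infinity>"
      by (subst em) (use int' in auto)
    have "0 = (\<integral>x. indicator {a<..} x * h x \<partial>lborel)"
      using 0 by simp
    also have "\<dots> = (\<integral>x. max 0 (h x) * indicator {a<..} x - max 0 (- h x) * indicator {a<..} x \<partial>lborel)"
      by (intro Bochner_Integration.integral_cong) (auto simp: indicator_def)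
    also have "\<dots> = (\<integral>x. max 0 (h x) * indicator {a<..} x \<partial>lborel) - (\<integral>x. max 0 (- h x) * indicator {a<..} x \<partial>lborel)"
      using int' by simp
    finally show "emeasure (density lborel (\<lambda>x. ennreal (max 0 (h x)))) {a<..}
        = emeasure (density lborel (\<lambda>x. ennreal (max 0 (- h x)))) {a<..}"
      using int' by (simp add: em)
  qed auto
  then have "AE x in lborel. ennreal (max 0 (h x)) = ennreal (max 0 (- h x))"
    by (intro sigma_finite_measure.density_unique[OF sigma_finite_lborel]) auto
  then show ?thesis
    by eventually_elim (auto simp: max_def split: if_splits)
qed

text \<open>Uniqueness of the weak derivative. The integral over a right half line is the total
  minus a value of the primitive, so all these integrals vanish and the previous lemma applies to
  each coordinate.\<close>

lemma eq_0_if_prim_eq_0: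
  fixes g :: "'a::euclidean_space L2"
  assumes "\<And>b. b \<in> {-1..0} \<Longrightarrow> prim g b = 0"
  shows "g = 0"
proof -
  \<comment> \<open>The primitive is constant on either side of the interval, so its vanishing
    extends to all real arguments.\<close>
  have all: "prim g b = 0" for b
  proof -
    consider "b \<le> -1" | "b \<in> {-1..0}" | "0 \<le> b" by force
    then show ?thesis
    proof cases
      case 1
      have "AE x in lborel. x \<noteq> (-1::real)"
        by (rule AE_lborel_singleton)
      then have "prim g b = (\<integral>x. 0 \<partial>(lborel :: real measure))"
        unfolding prim_def using brep_eq_0[of _ g] 1
        by (intro integral_cong_AE) (auto elim!: eventually_mono simp: indicator_def)
      then show ?thesis by simp
    next
      case 3
      then have "prim g b = prim g 0"
        unfolding prim_def using brep_eq_0[of _ g]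
        by (intro Bochner_Integration.integral_cong) (auto simp: indicator_def)
      then show ?thesis using assms[of 0] by simp
    qed (use assms in auto)
  qed
  have total: "(\<integral>x. brep g x \<partial>lborel) = 0"
  proof -
    have "(\<integral>x. brep g x \<partial>lborel) = prim g 0"
      unfolding prim_def using brep_eq_0[of _ g]
      by (intro Bochner_Integration.integral_cong) (auto simp: indicator_def)
    then show ?thesis using all by simp
  qed
  have "AE x in lborel. brep g x \<bullet> i = 0" for i
  proof (rule AE_eq_0_if_integral_greaterThan_eq_0)
    show "integrable lborel (\<lambda>x. brep g x \<bullet> i)"
      by (intro integrable_inner_left integrable_brep)
    fix a :: real
    have "(\<integral>x. indicator {a<..} x *\<^sub>R brep g x \<partial>lborel)
        = (\<integral>x. brep g x - indicator {..a} x *\<^sub>R brep g x \<partial>lborel)"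
      by (intro Bochner_Integration.integral_cong) (auto simp: indicator_def)
    also have "\<dots> = 0"
      using all[of a] total by (simp add: prim_def integrable_indicator_brep integrable_brep)
    finally have "(\<integral>x. indicator {a<..} x *\<^sub>R brep g x \<partial>lborel) \<bullet> i = 0" by simp
    then show "(\<integral>x. indicator {a<..} x * (brep g x \<bullet> i) \<partial>lborel) = 0"
      by (subst (asm) integral_inner_left[symmetric]) (auto intro!: integrable_indicator_brep)
  qed
  then have "AE x in lborel. \<forall>i\<in>Basis. brep g x \<bullet> i = 0"
    by (intro AE_finite_allI) auto
  then have "AE x in lborel. x \<in> {-1..0} \<longrightarrow> brep g x = 0"
    by eventually_elim (simp add: euclidean_all_zero_iff)
  then have "L2_of (brep g) = L2_of (\<lambda>_. 0)"
    by (intro L2_of_eqI sq_integrable_brep sq_integrable_zero) (simp add: AE_leb_I_iff)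
  then show ?thesis by (simp add: zero_L2_def)
qed

section \<open>Point values and coordinates of Sobolev functions\<close>

lemma sq_integrable_continuous:
  fixes f :: "real \<Rightarrow> 'a::euclidean_space"
  assumes "continuous_on {-1..0} f"
  shows "sq_integrable f"
proof -
  have "f \<in> borel_measurable leb_I"
    by (rule continuous_imp_measurable_on_sets_lebesgue[OF assms]) auto
  moreover have "integrable leb_I (\<lambda>x. (norm (f x))\<^sup>2)"
    by (rule continuous_imp_integrable_real) (intro continuous_intros assms)
  ultimately show ?thesis by (simp add: sq_integrable_def)
qed

lemma sq_integrable_cong:
  assumes "\<And>x. x \<in> {-1..0} \<Longrightarrow> f x = g x"
  shows "sq_integrable f \<longleftrightarrow> sq_integrable g"
proof -
  have "f \<in> borel_measurable leb_I \<longleftrightarrow> g \<in> borel_measurable leb_I"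
    by (rule measurable_cong) (use assms in auto)
  moreover have "integrable leb_I (\<lambda>x. (norm (f x))\<^sup>2) \<longleftrightarrow> integrable leb_I (\<lambda>x. (norm (g x))\<^sup>2)"
    by (rule Bochner_Integration.integrable_cong) (use assms in auto)
  ultimately show ?thesis by (simp add: sq_integrable_def)
qed

lemma L2_of_cong:
  assumes "sq_integrable g" "\<And>x. x \<in> {-1..0} \<Longrightarrow> f x = g x"
  shows "L2_of f = L2_of g"
proof (rule L2_of_eqI)
  show "sq_integrable f"
    using sq_integrable_cong[of f g] assms by auto
qed (use assms in \<open>auto simp: AE_leb_I_iff\<close>)

text \<open>The squared distance \<open>?d\<close> is continuous and nonnegative with integral zero,
  so it vanishes everywhere. This makes the values of \<open>cont_rep\<close> on the interval
  independent of the choice behind it.\<close>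

lemma L2_of_continuous_inject:
  fixes f g :: "real \<Rightarrow> 'a::euclidean_space"
  assumes f: "continuous_on {-1..0} f" and g: "continuous_on {-1..0} g"
    and "L2_of f = L2_of g" and x: "x \<in> {-1..0}"
  shows "f x = g x"
proof -
  let ?d = "\<lambda>x. (norm (f x - g x))\<^sup>2"
  have d: "continuous_on {-1..0} ?d"
    using f g by (intro continuous_intros)
  have "sq_integrable (\<lambda>x. f x - g x)"
    using f g by (intro sq_integrable_continuous continuous_intros)
  then have "(LINT x|leb_I. ?d x) = (norm (L2_of (\<lambda>x. f x - g x)))\<^sup>2"
    by (simp add: norm_L2_of_sq)
  also have "L2_of (\<lambda>x. f x - g x) = 0"
    using assms L2_of_diff[of f g] by (simp add: sq_integrable_continuous)
  finally have "(?d has_integral 0) {-1..0}"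
    using has_integral_integral_lebesgue_on[of "{-1..0}" ?d] d
    by (simp add: continuous_imp_integrable_real)
  then have "?d x = 0"
    using has_integral_0_cbox_imp_0[of "-1" 0 ?d x] d x by simp
  then show ?thesis by simp
qed

lemma cont_rep_eq:
  assumes "continuous_on {-1..0} f" "x \<in> {-1..0}"
  shows "cont_rep (L2_of f) x = f x"
proof -
  have "continuous_on {-1..0} (cont_rep (L2_of f)) \<and> L2_of f = L2_of (cont_rep (L2_of f))"
    unfolding cont_rep_def by (rule someI[of _ f]) (use assms in auto)
  then show ?thesis
    using L2_of_continuous_inject[of "cont_rep (L2_of f)" f x] assms by metis
qed

text \<open>Coordinates on \<open>H1\<close>: the value at the left end point and the weak
  derivative. The left end is chosen because \<open>z0 (-1)\<close> is \<open>w 0\<close>, the first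
  component of F.\<close>

definition H1_of :: "'a::euclidean_space \<Rightarrow> 'a L2 \<Rightarrow> 'a L2" where
  "H1_of c g = L2_of (\<lambda>\<theta>. c + prim g \<theta>)"

lemma continuous_on_const_add_prim: "continuous_on A (\<lambda>\<theta>. c + prim g \<theta>)"
  by (intro continuous_intros)

lemma sq_integrable_const_add_prim: "sq_integrable (\<lambda>\<theta>. c + prim g \<theta>)"
  by (intro sq_integrable_continuous continuous_on_const_add_prim)

lemma cont_rep_H1_of: "\<theta> \<in> {-1..0} \<Longrightarrow> cont_rep (H1_of c g) \<theta> = c + prim g \<theta>"
  unfolding H1_of_def by (rule cont_rep_eq[OF continuous_on_const_add_prim])

lemma is_primitive_iff: "is_primitive f g \<longleftrightarrow> (\<forall>\<theta>\<in>{-1..0}. f \<theta> = f (-1) + prim g \<theta>)"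
  unfolding is_primitive_def by (rule ball_cong) (simp_all add: lebesgue_integral_rep_eq_prim)

lemma is_primitive_imp_H1_of:
  assumes "is_primitive f g"
  shows "L2_of f = H1_of (f (-1)) g"
  unfolding H1_of_def
  by (rule L2_of_cong[OF sq_integrable_const_add_prim]) (use assms in \<open>unfold is_primitive_iff, blast\<close>)

lemma H1_eq: "H1 = {H1_of c g | c g. True}"
proof -
  have "is_primitive (\<lambda>\<theta>. c + prim g \<theta>) g" for c and g :: "'a L2"
    by (auto simp: is_primitive_iff)
  then have "H1_of c g \<in> H1" for c and g :: "'a L2"
    unfolding H1_def H1_of_def by blast
  then show ?thesis
    using is_primitive_imp_H1_of by (fastforce simp: H1_def)
qed

lemma H1_of_inject: "H1_of c g = H1_of c' g' \<longleftrightarrow> c = c' \<and> g = g'"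
proof
  assume eq: "H1_of c g = H1_of c' g'"
  have v: "c + prim g \<theta> = c' + prim g' \<theta>" if "\<theta> \<in> {-1..0}" for \<theta>
    using cont_rep_H1_of[OF that] eq by metis
  from v[of "-1"] have c: "c = c'" by simp
  have "g - g' = 0"
    by (rule eq_0_if_prim_eq_0) (use v c in \<open>auto simp: prim_diff\<close>)
  with c show "c = c' \<and> g = g'" by simp
qed simp

lemma H1_deriv_H1_of: "H1_deriv (H1_of c g) = g"
  unfolding H1_deriv_def
proof (rule the_equality)
  show "\<exists>f. is_primitive f g \<and> H1_of c g = L2_of f"
    by (rule exI[of _ "\<lambda>\<theta>. c + prim g \<theta>"]) (auto simp: is_primitive_iff H1_of_def)
next
  fix g' assume "\<exists>f. is_primitive f g' \<and> H1_of c g = L2_of f"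
  then show "g' = g"
    using is_primitive_imp_H1_of H1_of_inject by metis
qed

lemma H1_of_add: "H1_of (c + c') (g + g') = H1_of c g + H1_of c' g'"
  unfolding H1_of_def
  by (subst L2_of_add) (simp_all only: sq_integrable_const_add_prim prim_add ac_simps)

lemma H1_of_scaleR: "H1_of (r *\<^sub>R c) (r *\<^sub>R g) = r *\<^sub>R H1_of c g"
  unfolding H1_of_def
  by (subst L2_of_scaleR) (simp_all only: sq_integrable_const_add_prim prim_scaleR scaleR_add_right)

lemma linear_H1_of: "linear (\<lambda>(c, g). H1_of c g)"
  by (rule linearI) (auto simp: H1_of_add H1_of_scaleR)

lemma H1_of_diff: "H1_of (c - c') (g - g') = H1_of c g - H1_of c' g'"
  using linear_diff[OF linear_H1_of, of "(c, g)" "(c', g')"] by simp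

text \<open>No factor appears because the interval has length one.\<close>

lemma norm_L2_of_le:
  assumes f: "sq_integrable f" and "\<And>x. x \<in> {-1..0} \<Longrightarrow> norm (f x) \<le> K"
  shows "norm (L2_of f) \<le> K"
proof -
  have K: "0 \<le> K"
    using order_trans[OF norm_ge_zero assms(2)[of 0]] by simp
  have "(norm (L2_of f))\<^sup>2 \<le> (LINT x|leb_I. K\<^sup>2)"
    unfolding norm_L2_of_sq[OF f] using f assms(2)
    by (intro integral_mono) (auto simp: sq_integrable_def intro!: continuous_imp_integrable_real power_mono)
  also have "\<dots> = K\<^sup>2"
    by (simp add: measure_restrict_space)
  finally show ?thesis
    using K by (rule power2_le_imp_le)
qed

lemma norm_H1_of_const: "norm (H1_of c 0) = norm c"
proof -
  have "(norm (H1_of c 0))\<^sup>2 = (norm c)\<^sup>2"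
    unfolding H1_of_def by (subst norm_L2_of_sq[OF sq_integrable_const_add_prim])
      (simp add: measure_restrict_space)
  then show ?thesis by (rule power2_eq_imp_eq) auto
qed

lemma norm_H1_of_le: "norm (H1_of c g) \<le> norm c + norm g"
  unfolding H1_of_def
proof (rule norm_L2_of_le[OF sq_integrable_const_add_prim])
  show "norm (c + prim g x) \<le> norm c + norm g" for x
    using norm_triangle_ineq[of c "prim g x"] norm_prim_le[of g x] by linarith
qed

text \<open>Trace estimate at the left end point: subtracting the part that vanishes there leaves a
  constant, whose L2 norm is its modulus.\<close>

lemma norm_value_le: "norm c \<le> norm (H1_of c g) + norm g"
proof -
  have "norm c = norm (H1_of c g - H1_of 0 g)"
    by (simp add: H1_of_diff[symmetric] norm_H1_of_const)
  also have "\<dots> \<le> norm (H1_of c g) + norm (H1_of 0 g)"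
    by (rule norm_triangle_ineq4)
  finally show ?thesis
    using norm_H1_of_le[of 0 g] by simp
qed

lemma brep_H1_of: "AE x in lborel. brep (H1_of c g) x = indicator {-1..0} x *\<^sub>R (c + prim g x)"
  using AE_brep_L2_of[OF sq_integrable_const_add_prim[of c g]]
proof eventually_elim
  case (elim x)
  then show ?case
    using brep_eq_0[of x "H1_of c g"] by (cases "x \<in> {-1..0}") (auto simp: H1_of_def)
qed

section \<open>Reflection and multiplication\<close>

text \<open>The predicate need not be measurable, so the exceptional set is first enclosed in a
  Borel null set, whose affine preimage is again null.\<close>

lemma AE_lborel_affine:
  fixes c t :: real
  assumes "AE x in lborel. P x" and c: "c \<noteq> 0"
  shows "AE x in lborel. P (t + c * x)"
proof -
  obtain N where N: "{x \<in> space lborel. \<not> P x} \<subseteq> N" "N \<in> sets lborel" "emeasure lborel N = 0"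
    using assms(1) by (rule AE_E)
  have "AE x in lborel. x \<notin> N"
    using N by (intro AE_not_in) auto
  then have "AE x in lborel. t + c * x \<notin> N"
    using N(2) by (intro AE_borel_affine[OF c, of "\<lambda>x. x \<notin> N"]) auto
  then show ?thesis
    by eventually_elim (use N(1) in auto)
qed

text \<open>Holds because Lebesgue measure is complete. It is the source of measurability for
  integrands built from \<open>rep_L2\<close> and \<open>cont_rep\<close>, which are known only up
  to null sets after a shift or a reflection.\<close>

lemma borel_measurable_lebesgue_on_AE:
  fixes f g :: "real \<Rightarrow> 'a::euclidean_space"
  assumes AE: "AE x in lborel. x \<in> S \<longrightarrow> f x = g x"
    and [measurable]: "S \<in> sets borel" "g \<in> borel_measurable borel"
  shows "f \<in> borel_measurable (lebesgue_on S)"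
proof -
  define F G where "F x = (if x \<in> S then f x else 0)" and "G x = (if x \<in> S then g x else 0)" for x
  have [measurable]: "G \<in> borel_measurable borel"
    unfolding G_def by measurable
  have "F \<in> borel_measurable lebesgue"
  proof (rule measurableI)
    fix A :: "'a set"
    assume "A \<in> sets borel"
    then have "G -` A \<in> sets borel"
      using measurable_sets[of G borel borel A] by simp
    moreover have "AE x in lebesgue. x \<in> G -` A \<longleftrightarrow> x \<in> F -` A"
      unfolding AE_completion_iff using AE by eventually_elim (auto simp: F_def G_def)
    ultimately show "F -` A \<inter> space lebesgue \<in> sets lebesgue"
      using completion.in_sets_AE[of "G -` A" "F -` A" lborel] by simp
  qed auto
  then show ?thesis
    unfolding F_def by (subst (asm) borel_measurable_if) auto
qed

text \<open>The interval is reflected about its midpoint. This occurs in F because w'(-\<theta>) is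
  the derivative of \<open>z0\<close> at -1 - \<theta>.\<close>

definition reflect :: "'a::euclidean_space L2 \<Rightarrow> 'a L2" where
  "reflect f = L2_of (\<lambda>x. brep f (-1 - x))"

lemma integrable_reflect_iff:
  fixes h :: "real \<Rightarrow> 'b::{banach, second_countable_topology}"
  shows "integrable lborel (\<lambda>x. h (-1 - x)) \<longleftrightarrow> integrable lborel h"
  using lborel_integrable_real_affine_iff[of "-1" h "-1"] by simp

lemma integral_reflect:
  fixes h :: "real \<Rightarrow> 'b::{banach, second_countable_topology}"
  shows "(\<integral>x. h (-1 - x) \<partial>lborel) = (\<integral>x. h x \<partial>lborel)"
  using lborel_integral_real_affine[of "-1" h "-1"] by simp

lemma sq_integrable_reflect: "sq_integrable (\<lambda>x. brep f (-1 - x))"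
proof (rule sq_integrable_of_borel)
  show "integrable lborel (\<lambda>x. (norm (brep f (-1 - x)))\<^sup>2)"
    using integrable_reflect_iff[of "\<lambda>x. (norm (brep f x))\<^sup>2"] integrable_norm2_brep[of f] by simp
qed measurable

lemma brep_reflect: "AE x in lborel. brep (reflect f) x = brep f (-1 - x)"
  by (rule AE_brep_eqI[OF reflect_def sq_integrable_reflect]) (auto intro!: brep_eq_0)

lemma L2_eqI:
  assumes "AE x in lborel. brep f x = brep g x"
  shows "f = g"
proof -
  have "L2_of (brep f) = L2_of (brep g)"
    by (rule L2_of_eqI[OF sq_integrable_brep sq_integrable_brep])
      (use assms in \<open>auto simp: AE_leb_I_iff elim!: eventually_mono\<close>)
  then show ?thesis by simp
qed

lemma AE_reflect:
  assumes "AE x in lborel. P x"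
  shows "AE x in lborel. P (-1 - x :: real)"
  using AE_lborel_affine[OF assms, of "-1" "-1"] by simp

lemma reflect_L2_of:
  assumes "sq_integrable h"
  shows "sq_integrable (\<lambda>x. h (-1 - x))" "reflect (L2_of h) = L2_of (\<lambda>x. h (-1 - x))"
proof -
  have AE: "AE x in lborel. x \<in> {-1..0} \<longrightarrow> brep (L2_of h) (-1 - x) = h (-1 - x)"
    using AE_reflect[OF AE_brep_L2_of[OF assms]] by eventually_elim auto
  then have AE': "AE x in leb_I. brep (L2_of h) (-1 - x) = h (-1 - x)"
    by (simp add: AE_leb_I_iff)
  have m: "(\<lambda>x. h (-1 - x)) \<in> borel_measurable leb_I"
  proof (rule borel_measurable_lebesgue_on_AE)
    show "AE x in lborel. x \<in> {-1..0} \<longrightarrow> h (-1 - x) = brep (L2_of h) (-1 - x)"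
      using AE by eventually_elim auto
  qed measurable
  show sq: "sq_integrable (\<lambda>x. h (-1 - x))"
    unfolding sq_integrable_def
  proof
    show "integrable leb_I (\<lambda>x. (norm (h (-1 - x)))\<^sup>2)"
      using sq_integrable_reflect[of "L2_of h"] m AE' unfolding sq_integrable_def
      by (subst integrable_cong_AE[of _ _ "\<lambda>x. (norm (brep (L2_of h) (-1 - x)))\<^sup>2"]) (auto elim!: eventually_mono)
  qed (rule m)
  show "reflect (L2_of h) = L2_of (\<lambda>x. h (-1 - x))"
    unfolding reflect_def by (rule L2_of_eqI[OF sq_integrable_reflect sq AE'])
qed

lemma reflect_reflect [simp]: "reflect (reflect f) = f"
  by (rule L2_eqI) (use brep_reflect[of "reflect f"] AE_reflect[OF brep_reflect[of f]] in eventually_elim, simp)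

lemma reflect_add: "reflect (f + g) = reflect f + reflect g"
  by (rule L2_eqI)
    (use brep_reflect[of "f + g"] AE_reflect[OF brep_add[of f g]] brep_add[of "reflect f" "reflect g"]
      brep_reflect[of f] brep_reflect[of g] in eventually_elim, simp)

lemma reflect_scaleR: "reflect (c *\<^sub>R f) = c *\<^sub>R reflect f"
  by (rule L2_eqI)
    (use brep_reflect[of "c *\<^sub>R f"] AE_reflect[OF brep_scaleR[of c f]] brep_scaleR[of c "reflect f"]
      brep_reflect[of f] in eventually_elim, simp)

lemma norm_reflect [simp]: "norm (reflect f) = norm f"
proof -
  have "(norm (reflect f))\<^sup>2 = (\<integral>x. (norm (brep f (-1 - x)))\<^sup>2 \<partial>lborel)"
    unfolding norm_L2_sq using brep_reflect[of f] by (intro integral_cong_AE) (auto elim!: eventually_mono)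
  also have "\<dots> = (norm f)\<^sup>2"
    unfolding norm_L2_sq by (rule integral_reflect)
  finally show ?thesis by (rule power2_eq_imp_eq) auto
qed

lemma bounded_linear_reflect: "bounded_linear reflect"
  by (rule bounded_linear_intro[where K = 1]) (auto simp: reflect_add reflect_scaleR)

text \<open>The mass to the left of -1 - \<theta> is the total mass minus that to the right, which
  the reflection carries to the left of \<theta>; the common end point is a null set.\<close>

lemma prim_eq_total_minus:
  assumes "\<theta> \<in> {-1..0}"
  shows "prim g (-1 - \<theta>) = prim g 0 - prim (reflect g) \<theta>"
proof -
  have "AE x in lborel. x \<noteq> -1 - \<theta>"
    by (rule AE_lborel_singleton)
  then have "prim g (-1 - \<theta>) = (\<integral>x. indicator {..0} x *\<^sub>R brep g x - indicator {..\<theta>} (-1 - x) *\<^sub>R brep g x \<partial>lborel)"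
    unfolding prim_def using brep_eq_0[of _ g] assms
    by (intro integral_cong_AE) (auto elim!: eventually_mono simp: indicator_def)
  also have "\<dots> = prim g 0 - (\<integral>x. indicator {..\<theta>} (-1 - x) *\<^sub>R brep g x \<partial>lborel)"
  proof -
    have "(\<lambda>x. indicator {..\<theta>} (-1 - x) *\<^sub>R brep g x) = (\<lambda>x. indicator {-1 - \<theta>..} x *\<^sub>R brep g x)"
      by (intro ext) (auto simp: indicator_def)
    then have "integrable lborel (\<lambda>x. indicator {..\<theta>} (-1 - x) *\<^sub>R brep g x)"
      by (simp add: integrable_indicator_brep)
    then show ?thesis
      by (simp add: prim_def integrable_indicator_brep)
  qed
  also have "(\<integral>x. indicator {..\<theta>} (-1 - x) *\<^sub>R brep g x \<partial>lborel) = (\<integral>x. indicator {..\<theta>} x *\<^sub>R brep g (-1 - x) \<partial>lborel)"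
    using integral_reflect[of "\<lambda>x. indicator {..\<theta>} x *\<^sub>R brep g (-1 - x)"] by simp
  also have "\<dots> = prim (reflect g) \<theta>"
    unfolding prim_def using brep_reflect[of g] by (intro integral_cong_AE) (auto elim!: eventually_mono)
  finally show ?thesis .
qed

text \<open>Reflection exchanges the end points, so the new left value is the old right value, and
  the chain rule changes the sign of the derivative.\<close>

lemma reflect_H1_of: "reflect (H1_of a d) = H1_of (a + prim d 0) (- reflect d)"
  unfolding H1_of_def reflect_L2_of(2)[OF sq_integrable_const_add_prim]
  by (rule L2_of_cong[OF sq_integrable_const_add_prim]) (simp add: prim_eq_total_minus prim_minus)

section \<open>Products of matrices and vectors\<close>

lemma bounded_bilinear_matrix_vector_mult:
  "bounded_bilinear (\<lambda>(A :: real^'n^'m) (x :: real^'n). A *v x)"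
proof -
  have "bilinear (\<lambda>(A :: real^'n^'m) (x :: real^'n). A *v x)"
    unfolding bilinear_def
    by (auto intro!: linearI simp: matrix_vector_mult_add_rdistrib matrix_vector_right_distrib
        scaleR_matrix_vector_assoc[symmetric] matrix_vector_mult_scaleR)
  then show ?thesis
    by (simp add: bilinear_conv_bounded_bilinear)
qed

lemma matrix_vector_mult_norm_bound:
  obtains K where "0 < K" "\<And>(A :: real^'n^'m) (x :: real^'n). norm (A *v x) \<le> norm A * norm x * K"
  using bounded_bilinear.pos_bounded[OF bounded_bilinear_matrix_vector_mult] by auto

lemma borel_measurable_matrix_vector_mult [measurable (raw)]:
  fixes f :: "'b \<Rightarrow> real^'n^'m"
  assumes "f \<in> borel_measurable M" "g \<in> borel_measurable M"
  shows "(\<lambda>x. f x *v g x) \<in> borel_measurable M"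
  using assms bounded_bilinear.continuous_on[OF bounded_bilinear_matrix_vector_mult]
  by (rule borel_measurable_continuous_Pair) (auto intro: continuous_intros)

lemma sq_integrable_matrix:
  fixes A :: "real \<Rightarrow> real^'n^'m"
  assumes "\<And>i j. sq_integrable (\<lambda>\<theta>. A \<theta> $ i $ j)"
  shows "sq_integrable A"
proof -
  have "integrable leb_I (\<lambda>\<theta>. \<Sum>i\<in>UNIV. \<Sum>j\<in>UNIV. (norm (A \<theta> $ i $ j))\<^sup>2)"
    using assms by (auto simp: sq_integrable_def)
  moreover have "(\<lambda>\<theta>. \<Sum>i\<in>UNIV. \<Sum>j\<in>UNIV. (norm (A \<theta> $ i $ j))\<^sup>2) = (\<lambda>\<theta>. (norm (A \<theta>))\<^sup>2)"
    by (simp add: norm_vec_def L2_set_def sum_nonneg)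
  moreover have "(\<lambda>\<theta>. A \<theta> \<bullet> b) \<in> borel_measurable leb_I" if "b \<in> Basis" for b
    using that assms by (auto simp: Basis_vec_def inner_axis sq_integrable_def)
  then have "A \<in> borel_measurable leb_I"
    by (subst borel_measurable_euclidean_space) auto
  ultimately show ?thesis by (simp add: sq_integrable_def)
qed

definition mul :: "(real^'n^'m) L2 \<Rightarrow> real^'n \<Rightarrow> (real^'m) L2" where
  "mul k c = L2_of (\<lambda>\<theta>. brep k \<theta> *v c)"

lemma sq_integrable_matrix_vector_mult:
  fixes A :: "real \<Rightarrow> real^'n^'m"
  assumes "sq_integrable A"
  shows "sq_integrable (\<lambda>\<theta>. A \<theta> *v c)"
proof -
  obtain K where K: "0 < K" "\<And>(A :: real^'n^'m) (x :: real^'n). norm (A *v x) \<le> norm A * norm x * K"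
    by (rule matrix_vector_mult_norm_bound) auto
  have m: "(\<lambda>\<theta>. A \<theta> *v c) \<in> borel_measurable leb_I"
    using assms by (auto simp: sq_integrable_def)
  have "integrable leb_I (\<lambda>\<theta>. (norm (A \<theta> *v c))\<^sup>2)"
  proof (rule Bochner_Integration.integrable_bound)
    show "integrable leb_I (\<lambda>\<theta>. (norm c * K)\<^sup>2 * (norm (A \<theta>))\<^sup>2)"
      using assms by (auto simp: sq_integrable_def)
    have "(norm (A \<theta> *v c))\<^sup>2 \<le> (norm c * K)\<^sup>2 * (norm (A \<theta>))\<^sup>2" for \<theta>
      using power_mono[OF K(2)[of "A \<theta>" c], of 2] by (simp add: power_mult_distrib mult_ac)
    then show "AE \<theta> in leb_I. norm ((norm (A \<theta> *v c))\<^sup>2) \<le> norm ((norm c * K)\<^sup>2 * (norm (A \<theta>))\<^sup>2)"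
      by simp
  qed (use m in measurable)
  with m show ?thesis by (simp add: sq_integrable_def)
qed

lemma mul_L2_of:
  assumes "sq_integrable A"
  shows "mul (L2_of A) c = L2_of (\<lambda>\<theta>. A \<theta> *v c)"
  unfolding mul_def
  by (rule L2_of_eqI[OF sq_integrable_matrix_vector_mult[OF sq_integrable_brep]
        sq_integrable_matrix_vector_mult[OF assms]])
    (use AE_brep_L2_of[OF assms] in \<open>auto simp: AE_leb_I_iff elim!: eventually_mono\<close>)

lemma brep_mul: "AE x in lborel. brep (mul k c) x = brep k x *v c"
  by (rule AE_brep_eqI[OF mul_def sq_integrable_matrix_vector_mult[OF sq_integrable_brep]]) (simp add: brep_eq_0)

lemma mul_add: "mul k (c + d) = mul k c + mul k d"
  unfolding mul_def
  by (subst L2_of_add) (simp_all add: sq_integrable_matrix_vector_mult sq_integrable_brep matrix_vector_right_distrib)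

lemma mul_scaleR: "mul k (r *\<^sub>R c) = r *\<^sub>R mul k c"
  unfolding mul_def
  by (subst L2_of_scaleR) (simp_all add: sq_integrable_matrix_vector_mult sq_integrable_brep matrix_vector_mult_scaleR)

lemma bounded_linear_mul: "bounded_linear (mul k)"
  by (intro linear_conv_bounded_linear[THEN iffD1] linearI mul_add mul_scaleR)

section \<open>Convolution operators of Volterra type\<close>

text \<open>For \<open>\<rho>\<close> in the interval the integrand vanishes unless \<open>\<tau>\<close> lies between \<open>-1 - \<rho>\<close> and 0, since
  both representatives are extended by zero.\<close>

definition conv_fun :: "(real^'n^'m) L2 \<Rightarrow> (real^'n) L2 \<Rightarrow> real \<Rightarrow> real^'m" where
  "conv_fun k f \<rho> = (\<integral>\<tau>. brep k \<tau> *v brep f (\<tau> + \<rho>) \<partial>lborel)"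

definition conv :: "(real^'n^'m) L2 \<Rightarrow> (real^'n) L2 \<Rightarrow> (real^'m) L2" where
  "conv k f = L2_of (conv_fun k f)"

text \<open>The squared mass of \<open>f\<close> up to \<open>\<rho>\<close>. Estimating by it, not
  by the full norm, retains the causality that makes iterates decay.\<close>

definition energy :: "'a::euclidean_space L2 \<Rightarrow> real \<Rightarrow> real" where
  "energy f \<rho> = (\<integral>x. indicator {..\<rho>} x * (norm (brep f x))\<^sup>2 \<partial>lborel)"

lemma integrable_energy: "A \<in> sets borel \<Longrightarrow> integrable lborel (\<lambda>x. indicator A x * (norm (brep f x))\<^sup>2)"
  using integrable_mult_indicator[OF _ integrable_norm2_brep[of f], of A] by simp

lemma energy_nonneg: "0 \<le> energy f \<rho>"
  unfolding energy_def by (intro integral_nonneg_AE) auto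

lemma energy_mono: "\<rho> \<le> \<sigma> \<Longrightarrow> energy f \<rho> \<le> energy f \<sigma>"
  unfolding energy_def by (intro integral_mono integrable_energy) (auto simp: indicator_def)

lemma energy_le_norm: "energy f \<rho> \<le> (norm f)\<^sup>2"
  unfolding energy_def norm_L2_sq
  by (intro integral_mono integrable_energy integrable_norm2_brep) (auto simp: indicator_def)

lemma energy_0: "energy f 0 = (norm f)\<^sup>2"
  unfolding energy_def norm_L2_sq using brep_eq_0[of _ f]
  by (intro Bochner_Integration.integral_cong) (auto simp: indicator_def)

lemma integrable_translate_iff:
  fixes h :: "real \<Rightarrow> 'b::{banach, second_countable_topology}"
  shows "integrable lborel (\<lambda>x. h (x + \<rho>)) \<longleftrightarrow> integrable lborel h"
  using lborel_integrable_real_affine_iff[of 1 h \<rho>] by (simp add: add.commute)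

lemma integral_translate:
  fixes h :: "real \<Rightarrow> 'b::{banach, second_countable_topology}"
  shows "(\<integral>x. h (x + \<rho>) \<partial>lborel) = (\<integral>x. h x \<partial>lborel)"
  using lborel_integral_real_affine[of 1 h \<rho>] by (simp add: add.commute)

lemma integrable_conv:
  fixes k :: "(real^'n^'m) L2" and f :: "(real^'n) L2"
  shows "integrable lborel (\<lambda>\<tau>. brep k \<tau> *v brep f (\<tau> + \<rho>))"
proof -
  have int: "integrable lborel (\<lambda>\<tau>. norm (brep k \<tau>) * norm (brep f (\<tau> + \<rho>)))"
    by (rule integrable_mult_square_integrable)
      (use integrable_translate_iff[of "\<lambda>x. (norm (brep f x))\<^sup>2"] integrable_norm2_brep in auto)
  obtain K where K: "0 < K" "\<And>(A :: real^'n^'m) (x :: real^'n). norm (A *v x) \<le> norm A * norm x * K"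
    by (rule matrix_vector_mult_norm_bound) auto
  show "integrable lborel (\<lambda>\<tau>. brep k \<tau> *v brep f (\<tau> + \<rho>))"
  proof (rule Bochner_Integration.integrable_bound)
    show "integrable lborel (\<lambda>\<tau>. norm (brep k \<tau>) * norm (brep f (\<tau> + \<rho>)) * K)"
      using int by simp
    show "AE \<tau> in lborel. norm (brep k \<tau> *v brep f (\<tau> + \<rho>)) \<le> norm (norm (brep k \<tau>) * norm (brep f (\<tau> + \<rho>)) * K)"
      using K by (auto simp: abs_mult)
  qed measurable
qed

lemma conv_fun_measurable [measurable]: "conv_fun k f \<in> borel_measurable borel"
proof -
  have "(\<lambda>\<rho>. \<integral>\<tau>. brep k \<tau> *v brep f (\<tau> + \<rho>) \<partial>lborel) \<in> borel_measurable lborel"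
    by (rule lborel.borel_measurable_lebesgue_integral) measurable
  then show ?thesis
    unfolding conv_fun_def[abs_def] by simp
qed

text \<open>The kernel lives on nonpositive \<open>\<tau>\<close>, so only values of
  \<open>f\<close> at arguments up to \<open>\<rho>\<close> enter; Cauchy-Schwarz and translation
  invariance give the bound.\<close>

lemma conv_fun_bound:
  obtains C where "0 \<le> C"
    "\<And>(f :: (real^'n) L2) \<rho>. \<rho> \<le> 0 \<Longrightarrow> (norm (conv_fun (k :: (real^'n^'m) L2) f \<rho>))\<^sup>2 \<le> C * energy f \<rho>"
proof -
  obtain K where K: "0 < K" "\<And>(A :: real^'n^'m) (x :: real^'n). norm (A *v x) \<le> norm A * norm x * K"
    by (rule matrix_vector_mult_norm_bound) auto
  have bound: "(norm (conv_fun k f \<rho>))\<^sup>2 \<le> (K\<^sup>2 * (norm k)\<^sup>2) * energy f \<rho>" if "\<rho> \<le> 0" for f :: "(real^'n) L2" and \<rho>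
  proof -
    \<comment> \<open>The cutoff loses nothing: \<open>\<tau> + \<rho>\<close> exceeds
      \<open>\<rho>\<close> only where the kernel vanishes.\<close>
    let ?q = "\<lambda>\<tau>. indicator {..\<rho>} (\<tau> + \<rho>) * norm (brep f (\<tau> + \<rho>))"
    have q2: "(\<lambda>\<tau>. (?q \<tau>)\<^sup>2) = (\<lambda>\<tau>. (\<lambda>x. indicator {..\<rho>} x * (norm (brep f x))\<^sup>2) (\<tau> + \<rho>))"
      by (auto simp: indicator_def)
    have intq: "integrable lborel (\<lambda>\<tau>. (?q \<tau>)\<^sup>2)"
      unfolding q2 using integrable_translate_iff[of "\<lambda>x. indicator {..\<rho>} x * (norm (brep f x))\<^sup>2" \<rho>]
      by (simp only: integrable_energy atMost_borel)
    have "norm (conv_fun k f \<rho>) \<le> (\<integral>\<tau>. norm (brep k \<tau> *v brep f (\<tau> + \<rho>)) \<partial>lborel)"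
      unfolding conv_fun_def by (rule integral_norm_bound)
    also have "\<dots> \<le> (\<integral>\<tau>. K * (norm (brep k \<tau>) * ?q \<tau>) \<partial>lborel)"
    proof (intro integral_mono integrable_norm integrable_conv integrable_mult_right integrable_mult_square_integrable intq)
      show "norm (brep k \<tau> *v brep f (\<tau> + \<rho>)) \<le> K * (norm (brep k \<tau>) * ?q \<tau>)" for \<tau>
        using K(2)[of "brep k \<tau>" "brep f (\<tau> + \<rho>)"] brep_eq_0[of \<tau> k]
        by (cases "\<tau> \<le> 0") (auto simp: mult_ac)
    qed (auto simp: integrable_norm2_brep)
    also have "\<dots> = K * (\<integral>\<tau>. norm (brep k \<tau>) * ?q \<tau> \<partial>lborel)"
      by simp
    finally have "(norm (conv_fun k f \<rho>))\<^sup>2 \<le> (K * (\<integral>\<tau>. norm (brep k \<tau>) * ?q \<tau> \<partial>lborel))\<^sup>2"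
      by (intro power_mono) auto
    also have "\<dots> \<le> K\<^sup>2 * ((\<integral>\<tau>. (norm (brep k \<tau>))\<^sup>2 \<partial>lborel) * (\<integral>\<tau>. (?q \<tau>)\<^sup>2 \<partial>lborel))"
      by (subst power_mult_distrib, intro mult_left_mono Cauchy_Schwarz_integral(2)) (use intq integrable_norm2_brep in auto)
    also have "(\<integral>\<tau>. (?q \<tau>)\<^sup>2 \<partial>lborel) = energy f \<rho>"
      unfolding q2 energy_def by (rule integral_translate)
    finally show ?thesis
      by (simp add: norm_L2_sq mult_ac)
  qed
  show ?thesis
    by (rule that[OF _ bound]) auto
qed

lemma sq_integrable_of_bounded_borel:
  fixes h :: "real \<Rightarrow> 'a::euclidean_space"
  assumes [measurable]: "h \<in> borel_measurable borel" and "\<And>x. x \<in> {-1..0} \<Longrightarrow> (norm (h x))\<^sup>2 \<le> M"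
  shows "sq_integrable h"
  unfolding sq_integrable_def
proof
  show m: "h \<in> borel_measurable leb_I"
    by (intro measurable_restrict_space1 measurable_completion) simp
  show "integrable leb_I (\<lambda>x. (norm (h x))\<^sup>2)"
  proof (rule Bochner_Integration.integrable_bound)
    show "integrable leb_I (\<lambda>x. M)"
      by (intro continuous_imp_integrable_real continuous_intros)
    show "AE x in leb_I. norm ((norm (h x))\<^sup>2) \<le> norm M"
      by (rule AE_I2) (use assms(2) in force)
  qed (use m in measurable)
qed

lemma sq_integrable_conv_fun: "sq_integrable (conv_fun k f)"
proof -
  obtain C where C: "0 \<le> C" "\<And>\<rho>. \<rho> \<le> 0 \<Longrightarrow> (norm (conv_fun k f \<rho>))\<^sup>2 \<le> C * energy f \<rho>"
    using conv_fun_bound[of k] by metis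
  show ?thesis
  proof (rule sq_integrable_of_bounded_borel)
    show "(norm (conv_fun k f \<rho>))\<^sup>2 \<le> C * (norm f)\<^sup>2" if "\<rho> \<in> {-1..0}" for \<rho>
      using C(2)[of \<rho>] that mult_left_mono[OF energy_le_norm[of f \<rho>] C(1)] by simp
  qed simp
qed

lemma conv_fun_eq_0: "\<rho> < -1 \<Longrightarrow> conv_fun k f \<rho> = 0"
proof -
  assume "\<rho> < -1"
  then have "brep k \<tau> *v brep f (\<tau> + \<rho>) = 0" for \<tau>
    using brep_eq_0[of \<tau> k] brep_eq_0[of "\<tau> + \<rho>" f] by (cases "\<tau> \<le> 0") auto
  then show ?thesis by (simp add: conv_fun_def)
qed

lemma brep_conv: "AE x in lborel. x \<in> {-1..0} \<longrightarrow> brep (conv k f) x = conv_fun k f x"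
  unfolding conv_def by (rule AE_brep_L2_of[OF sq_integrable_conv_fun])

lemma AE_translate:
  assumes "AE x in lborel. P x"
  shows "AE x in lborel. P (x + \<rho> :: real)"
  using AE_lborel_affine[OF assms, of 1 \<rho>] by (simp add: add.commute)

lemma conv_fun_add: "conv_fun k (f + g) \<rho> = conv_fun k f \<rho> + conv_fun k g \<rho>"
proof -
  have "conv_fun k (f + g) \<rho> = (\<integral>\<tau>. brep k \<tau> *v brep f (\<tau> + \<rho>) + brep k \<tau> *v brep g (\<tau> + \<rho>) \<partial>lborel)"
    unfolding conv_fun_def using AE_translate[OF brep_add[of f g], of \<rho>]
    by (intro integral_cong_AE) (auto elim!: eventually_mono simp: matrix_vector_right_distrib)
  then show ?thesis by (simp add: conv_fun_def integrable_conv)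
qed

lemma conv_fun_scaleR: "conv_fun k (c *\<^sub>R f) \<rho> = c *\<^sub>R conv_fun k f \<rho>"
proof -
  have "conv_fun k (c *\<^sub>R f) \<rho> = (\<integral>\<tau>. c *\<^sub>R (brep k \<tau> *v brep f (\<tau> + \<rho>)) \<partial>lborel)"
    unfolding conv_fun_def using AE_translate[OF brep_scaleR[of c f], of \<rho>]
    by (intro integral_cong_AE) (auto elim!: eventually_mono simp: matrix_vector_mult_scaleR)
  then show ?thesis by (simp only: conv_fun_def integral_scaleR_right)
qed

lemma bounded_linear_conv: "bounded_linear (conv k)"
proof -
  obtain C where C: "0 \<le> C" "\<And>f \<rho>. \<rho> \<le> 0 \<Longrightarrow> (norm (conv_fun k f \<rho>))\<^sup>2 \<le> C * energy f \<rho>"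
    using conv_fun_bound[of k] by metis
  show ?thesis
  proof (rule bounded_linear_intro)
    show "conv k (f + g) = conv k f + conv k g" for f g
      unfolding conv_def by (subst L2_of_add) (simp_all add: sq_integrable_conv_fun conv_fun_add[abs_def])
    show "conv k (c *\<^sub>R f) = c *\<^sub>R conv k f" for c f
      unfolding conv_def by (subst L2_of_scaleR) (simp_all add: sq_integrable_conv_fun conv_fun_scaleR[abs_def])
    show "norm (conv k f) \<le> norm f * sqrt C" for f
      unfolding conv_def
    proof (rule norm_L2_of_le[OF sq_integrable_conv_fun])
      fix x :: real assume "x \<in> {-1..0}"
      then have "(norm (conv_fun k f x))\<^sup>2 \<le> C * (norm f)\<^sup>2"
        using C(2)[of x f] mult_left_mono[OF energy_le_norm[of f x] C(1)] by simp
      also have "\<dots> = (norm f * sqrt C)\<^sup>2"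
        using C(1) by (simp add: power_mult_distrib)
      finally show "norm (conv_fun k f x) \<le> norm f * sqrt C"
        by (rule power2_le_imp_le) (use C(1) in simp)
    qed
  qed
qed

text \<open>Integration by parts in the convolution; the boundary term is the reflected kernel.\<close>

lemma conv_fun_H1_of:
  fixes k :: "(real^'n^'m) L2"
  assumes \<rho>: "\<rho> \<in> {-1..0}"
  shows "conv_fun k (H1_of a d) \<rho> = prim (conv k d + reflect (mul k a)) \<rho>"
proof -
  obtain K where K: "0 < K" "\<And>(A :: real^'n^'m) (x :: real^'n). norm (A *v x) \<le> norm A * norm x * K"
    by (rule matrix_vector_mult_norm_bound) auto
  have bl: "bounded_linear (\<lambda>x. A *v x)" for A :: "real^'n^'m"
    by simp
  \<comment> \<open>Integrating over \<open>\<sigma>\<close> gives the kernel times the primitive of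
    \<open>d\<close>, integrating over \<open>\<tau>\<close> gives the convolution with
    \<open>d\<close>; Fubini equates the two iterated integrals.\<close>
  define F where "F \<tau> \<sigma> = indicator {..\<rho>} \<sigma> *\<^sub>R (brep k \<tau> *v brep d (\<tau> + \<sigma>))" for \<tau> \<sigma>
  have [measurable]: "case_prod F \<in> borel_measurable (lborel \<Otimes>\<^sub>M lborel)"
    unfolding F_def by measurable
  have nd: "integrable lborel (\<lambda>\<sigma>. norm (brep d (\<tau> + \<sigma>)))" "(\<integral>\<sigma>. norm (brep d (\<tau> + \<sigma>)) \<partial>lborel) = (\<integral>\<sigma>. norm (brep d \<sigma>) \<partial>lborel)" for \<tau>
    using integrable_translate_iff[of "\<lambda>x. norm (brep d x)" \<tau>] integral_translate[of "\<lambda>x. norm (brep d x)" \<tau>]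
      integrable_norm_brep[of d] by (simp_all add: add.commute)
  have intF: "integrable (lborel \<Otimes>\<^sub>M lborel) (case_prod F)"
  proof (rule Bochner_Integration.integrable_bound)
    show "integrable (lborel \<Otimes>\<^sub>M lborel) (\<lambda>(\<tau>, \<sigma>). K * (norm (brep k \<tau>) * norm (brep d (\<tau> + \<sigma>))))"
    proof (rule lborel_pair.Fubini_integrable)
      show "AE \<tau> in lborel. integrable lborel (\<lambda>\<sigma>. case (\<tau>, \<sigma>) of (\<tau>, \<sigma>) \<Rightarrow> K * (norm (brep k \<tau>) * norm (brep d (\<tau> + \<sigma>))))"
        using nd by simp
      have "(\<lambda>\<tau>. \<integral>\<sigma>. norm (case (\<tau>, \<sigma>) of (\<tau>, \<sigma>) \<Rightarrow> K * (norm (brep k \<tau>) * norm (brep d (\<tau> + \<sigma>)))) \<partial>lborel)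
          = (\<lambda>\<tau>. K * (norm (brep k \<tau>) * (\<integral>\<sigma>. norm (brep d \<sigma>) \<partial>lborel)))"
        using K(1) nd by (simp add: abs_mult)
      then show "integrable lborel (\<lambda>\<tau>. \<integral>\<sigma>. norm (case (\<tau>, \<sigma>) of (\<tau>, \<sigma>) \<Rightarrow> K * (norm (brep k \<tau>) * norm (brep d (\<tau> + \<sigma>)))) \<partial>lborel)"
        by (simp add: integrable_norm_brep)
    qed measurable
    have "norm (F \<tau> \<sigma>) \<le> K * (norm (brep k \<tau>) * norm (brep d (\<tau> + \<sigma>)))" for \<tau> \<sigma>
      using K(2)[of "brep k \<tau>" "brep d (\<tau> + \<sigma>)"] K(1) by (auto simp: F_def indicator_def mult_ac)
    then show "AE x in lborel \<Otimes>\<^sub>M lborel. norm (case_prod F x) \<le> norm (case x of (\<tau>, \<sigma>) \<Rightarrow> K * (norm (brep k \<tau>) * norm (brep d (\<tau> + \<sigma>))))"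
      using K(1) by (auto simp: abs_mult)
  qed simp
  have primd: "(\<integral>\<sigma>. F \<tau> \<sigma> \<partial>lborel) = brep k \<tau> *v prim d (\<tau> + \<rho>)" for \<tau>
  proof -
    have "prim d (\<tau> + \<rho>) = (\<integral>\<sigma>. indicator {..\<tau> + \<rho>} (\<sigma> + \<tau>) *\<^sub>R brep d (\<sigma> + \<tau>) \<partial>lborel)"
      unfolding prim_def using integral_translate[of "\<lambda>x. indicator {..\<tau> + \<rho>} x *\<^sub>R brep d x" \<tau>] by simp
    also have "\<dots> = (\<integral>\<sigma>. indicator {..\<rho>} \<sigma> *\<^sub>R brep d (\<tau> + \<sigma>) \<partial>lborel)"
      by (intro Bochner_Integration.integral_cong) (auto simp: indicator_def add.commute)
    finally have "brep k \<tau> *v prim d (\<tau> + \<rho>) = (\<integral>\<sigma>. brep k \<tau> *v (indicator {..\<rho>} \<sigma> *\<^sub>R brep d (\<tau> + \<sigma>)) \<partial>lborel)"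
      using integral_bounded_linear[OF bl[of "brep k \<tau>"], of lborel "\<lambda>\<sigma>. indicator {..\<rho>} \<sigma> *\<^sub>R brep d (\<tau> + \<sigma>)"]
        integrable_translate_iff[of "brep d" \<tau>] integrable_brep[of d]
      by (simp add: integrable_mult_indicator add.commute)
    then show ?thesis
      by (simp add: F_def matrix_vector_mult_scaleR)
  qed
  \<comment> \<open>The condition \<open>-1 - \<tau> \<le> \<rho>\<close> says that
    \<open>\<tau> + \<rho>\<close> has not left the interval on the left. It is written in this form
    for the reflection of the variable that produces the boundary term.\<close>
  have int1: "integrable lborel (\<lambda>\<tau>. indicator {..\<rho>} (-1 - \<tau>) *\<^sub>R (brep k \<tau> *v a))"
  proof -
    have "(\<lambda>\<tau>. indicator {..\<rho>} (-1 - \<tau>) *\<^sub>R (brep k \<tau> *v a)) = (\<lambda>\<tau>. indicator {-1 - \<rho>..} \<tau> *\<^sub>R (brep k \<tau> *v a))"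
      by (intro ext) (auto simp: indicator_def)
    moreover have "integrable lborel (\<lambda>\<tau>. brep k \<tau> *v a)"
      using integrable_bounded_linear[OF bounded_bilinear.bounded_linear_left[OF bounded_bilinear_matrix_vector_mult] integrable_brep[of k]] .
    ultimately show ?thesis
      by (simp add: integrable_mult_indicator)
  qed
  have primd0: "prim d x = 0" if "x < -1" for x
    unfolding prim_def using brep_eq_0[of _ d] that
    by (intro integral_eq_zero_AE AE_I2) (auto simp: indicator_def)
  have "conv_fun k (H1_of a d) \<rho>
      = (\<integral>\<tau>. indicator {..\<rho>} (-1 - \<tau>) *\<^sub>R (brep k \<tau> *v a) + (\<integral>\<sigma>. F \<tau> \<sigma> \<partial>lborel) \<partial>lborel)"
    unfolding conv_fun_def
  proof (rule integral_cong_AE)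
    show "AE \<tau> in lborel. brep k \<tau> *v brep (H1_of a d) (\<tau> + \<rho>)
        = indicator {..\<rho>} (-1 - \<tau>) *\<^sub>R (brep k \<tau> *v a) + (\<integral>\<sigma>. F \<tau> \<sigma> \<partial>lborel)"
      using AE_translate[OF brep_H1_of[of a d], of \<rho>]
    proof eventually_elim
      case (elim \<tau>)
      consider "\<tau> \<notin> {-1..0}" | "\<tau> \<in> {-1..0}" "\<tau> + \<rho> < -1" | "\<tau> \<in> {-1..0}" "-1 \<le> \<tau> + \<rho>" by force
      then show ?case
        using elim \<rho> by cases (auto simp: primd brep_eq_0 primd0 indicator_def matrix_vector_right_distrib)
    qed
  next
    show "(\<lambda>\<tau>. indicator {..\<rho>} (-1 - \<tau>) *\<^sub>R (brep k \<tau> *v a) + (\<integral>\<sigma>. F \<tau> \<sigma> \<partial>lborel)) \<in> borel_measurable lborel"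
      by (intro borel_measurable_add borel_measurable_integrable[OF int1]
          borel_measurable_integrable[OF lborel_pair.integrable_fst[OF intF]])
  qed measurable
  also have "\<dots> = (\<integral>\<tau>. indicator {..\<rho>} (-1 - \<tau>) *\<^sub>R (brep k \<tau> *v a) \<partial>lborel) + (\<integral>\<tau>. \<integral>\<sigma>. F \<tau> \<sigma> \<partial>lborel \<partial>lborel)"
    by (rule Bochner_Integration.integral_add[OF int1 lborel_pair.integrable_fst[OF intF]])
  also have "(\<integral>\<tau>. \<integral>\<sigma>. F \<tau> \<sigma> \<partial>lborel \<partial>lborel) = (\<integral>\<sigma>. \<integral>\<tau>. F \<tau> \<sigma> \<partial>lborel \<partial>lborel)"
    by (rule lborel_pair.Fubini_integral[OF intF, symmetric])
  also have "\<dots> = (\<integral>\<sigma>. indicator {..\<rho>} \<sigma> *\<^sub>R conv_fun k d \<sigma> \<partial>lborel)"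
    by (simp only: F_def conv_fun_def integral_scaleR_right)
  also have "\<dots> = prim (conv k d) \<rho>"
    unfolding prim_def
  proof (rule integral_cong_AE)
    show "AE \<sigma> in lborel. indicator {..\<rho>} \<sigma> *\<^sub>R conv_fun k d \<sigma> = indicator {..\<rho>} \<sigma> *\<^sub>R brep (conv k d) \<sigma>"
      using brep_conv[of k d]
    proof eventually_elim
      case (elim \<sigma>)
      then show ?case
        using \<rho> conv_fun_eq_0[of \<sigma> k d] brep_eq_0[of \<sigma> "conv k d"]
        by (cases "\<sigma> \<in> {-1..0}") (auto simp: indicator_def)
    qed
  qed measurable
  also have "(\<integral>\<tau>. indicator {..\<rho>} (-1 - \<tau>) *\<^sub>R (brep k \<tau> *v a) \<partial>lborel)
      = (\<integral>\<sigma>. indicator {..\<rho>} \<sigma> *\<^sub>R (brep k (-1 - \<sigma>) *v a) \<partial>lborel)"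
    using integral_reflect[of "\<lambda>\<sigma>. indicator {..\<rho>} \<sigma> *\<^sub>R (brep k (-1 - \<sigma>) *v a)"] by simp
  also have "\<dots> = prim (reflect (mul k a)) \<rho>"
    unfolding prim_def
  proof (rule integral_cong_AE)
    show "AE \<sigma> in lborel. indicator {..\<rho>} \<sigma> *\<^sub>R (brep k (-1 - \<sigma>) *v a)
        = indicator {..\<rho>} \<sigma> *\<^sub>R brep (reflect (mul k a)) \<sigma>"
      using brep_reflect[of "mul k a"] AE_reflect[OF brep_mul[of k a]] by eventually_elim simp
  qed measurable
  finally show ?thesis
    by (simp add: prim_add add.commute)
qed

text \<open>The value at -1 is zero because there the range of integration has shrunk to a point.
  This is what keeps the integral terms of F inside the Sobolev space.\<close>

lemma conv_H1_of: "conv k (H1_of a d) = H1_of 0 (conv k d + reflect (mul k a))"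
  unfolding H1_of_def[of 0] conv_def[of k "H1_of a d"]
  by (rule L2_of_cong[OF sq_integrable_const_add_prim]) (simp add: conv_fun_H1_of)

section \<open>Inverting the identity minus a Volterra operator\<close>

text \<open>A geometric bound on the powers replaces the requirement that \<open>N\<close> be a
  contraction; the constant 2 is the sum of the series. For uniqueness, a fixed point of
  \<open>N\<close> is fixed by every power, hence arbitrarily small.\<close>

lemma Neumann_series:
  fixes N :: "'a::banach \<Rightarrow> 'a"
  assumes N: "bounded_linear N" and le: "\<And>m f. norm ((N ^^ m) f) \<le> K * (1/2) ^ m * norm f"
  shows "\<exists>f. f - N f = h \<and> norm f \<le> 2 * K * norm h" and "f - N f = 0 \<Longrightarrow> f = 0"
proof -
  have geo: "(\<lambda>m. K * (1/2) ^ m * norm h) sums (2 * K * norm h)"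
    using sums_mult[OF geometric_sums[of "1/2 :: real"], of "K * norm h"] by (simp add: mult_ac)
  have sn: "summable (\<lambda>m. norm ((N ^^ m) h))"
    by (rule summable_comparison_test'[OF sums_summable[OF geo]]) (simp add: le)
  then have s: "summable (\<lambda>m. (N ^^ m) h)"
    by (rule summable_norm_cancel)
  define f where "f = (\<Sum>m. (N ^^ m) h)"
  have "N f = (\<Sum>m. N ((N ^^ m) h))"
    unfolding f_def by (rule bounded_linear.suminf[OF N s])
  also have "\<dots> = (\<Sum>m. (N ^^ Suc m) h)"
    by simp
  also have "\<dots> = f - h"
    unfolding f_def by (subst suminf_split_head[OF s]) simp
  finally have "f - N f = h" by simp
  moreover have "norm f \<le> (\<Sum>m. norm ((N ^^ m) h))"
    unfolding f_def by (rule summable_norm[OF sn])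
  then have "norm f \<le> 2 * K * norm h"
    using suminf_le[OF le sn sums_summable[OF geo]] sums_unique[OF geo] by simp
  ultimately show "\<exists>f. f - N f = h \<and> norm f \<le> 2 * K * norm h"
    by blast
next
  assume "f - N f = 0"
  then have "N f = f" by simp
  then have it: "(N ^^ m) f = f" for m
    by (induction m) simp_all
  have "(\<lambda>m. K * (1/2) ^ m * norm f) \<longlonglongrightarrow> K * 0 * norm f"
    by (intro tendsto_intros LIMSEQ_power_zero) simp
  then have "norm f \<le> 0"
    using le[of _ f] it by (intro LIMSEQ_le_const[of _ 0]) auto
  then show "f = 0" by simp
qed

text \<open>Cauchy-Schwarz against the indicator of the interval, which has length one.\<close>

lemma norm_prim_sq_le_energy: "(norm (prim g x))\<^sup>2 \<le> energy g x"
proof -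
  let ?q = "\<lambda>y. indicator {..x} y * norm (brep g y)"
  have I2: "(\<lambda>y. (indicator {-1..0::real} y :: real)\<^sup>2) = indicator {-1..0}"
    and q2: "(\<lambda>y. (?q y)\<^sup>2) = (\<lambda>y. indicator {..x} y * (norm (brep g y))\<^sup>2)"
    by (auto simp: indicator_def)
  have Iq: "(\<lambda>y. indicator {-1..0::real} y * ?q y) = (\<lambda>y. norm (indicator {..x} y *\<^sub>R brep g y))"
    using brep_eq_0[of _ g] by (intro ext) (auto simp: indicator_def)
  have "(norm (prim g x))\<^sup>2 \<le> (\<integral>y. norm (indicator {..x} y *\<^sub>R brep g y) \<partial>lborel)\<^sup>2"
    unfolding prim_def by (intro power_mono integral_norm_bound) simp
  also have "\<dots> = (\<integral>y. indicator {-1..0::real} y * ?q y \<partial>lborel)\<^sup>2"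
    unfolding Iq ..
  also have "\<dots> \<le> (\<integral>y. (indicator {-1..0::real} y)\<^sup>2 \<partial>lborel) * (\<integral>y. (?q y)\<^sup>2 \<partial>lborel)"
    by (rule Cauchy_Schwarz_integral(2)) (simp_all only: I2 q2 integrable_indicator_I integrable_energy atMost_borel, measurable)
  also have "\<dots> = energy g x"
    unfolding I2 q2 by (simp add: energy_def)
  finally show ?thesis .
qed

text \<open>The majorant enters with the value of its integral, so that an antiderivative can be
  supplied directly.\<close>

lemma energy_le_integral:
  assumes u: "has_bochner_integral lborel (\<lambda>x. u x * indicator {-1..\<rho>} x) J"
    and AE: "AE x in lborel. x \<in> {-1..\<rho>} \<longrightarrow> (norm (brep h x))\<^sup>2 \<le> u x"
  shows "energy h \<rho> \<le> J"
proof -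
  have "energy h \<rho> \<le> (\<integral>x. u x * indicator {-1..\<rho>} x \<partial>lborel)"
    unfolding energy_def
  proof (rule integral_mono_AE[OF integrable_energy integrable.intros[OF u]])
    show "AE x in lborel. indicator {..\<rho>} x * (norm (brep h x))\<^sup>2 \<le> u x * indicator {-1..\<rho>} x"
      using AE by eventually_elim (use brep_eq_0[of _ h] in \<open>auto simp: indicator_def\<close>)
  qed simp
  then show ?thesis
    using has_bochner_integral_integral_eq[OF u] by simp
qed

text \<open>The part of the integral in F that depends on the derivative \<open>g\<close> alone:
  \<open>H1_of 0 f\<close> is the history with derivative \<open>f\<close> and left value
  zero.\<close>

definition volterra ::
    "(real^'n^'n) L2 \<Rightarrow> (real^'n^'n) L2 \<Rightarrow> (real^'n) L2 \<Rightarrow> (real^'n) L2" where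
  "volterra k2 k3 f = conv k2 f + conv k3 (H1_of 0 f)"

lemma bounded_linear_H1_of_0: "bounded_linear (H1_of 0)"
proof (rule bounded_linear_intro[where K = 1])
  show "H1_of 0 (f + g) = H1_of 0 f + H1_of 0 g" for f g :: "'a L2"
    using H1_of_add[of 0 0 f g] by simp
  show "H1_of 0 (r *\<^sub>R f) = r *\<^sub>R H1_of 0 f" for r and f :: "'a L2"
    using H1_of_scaleR[of r 0 f] by simp
  show "norm (H1_of 0 f) \<le> norm f * 1" for f :: "'a L2"
    using norm_H1_of_le[of 0 f] by simp
qed

lemma bounded_linear_volterra: "bounded_linear (volterra k2 k3)"
  unfolding volterra_def[abs_def]
  by (intro bounded_linear_add bounded_linear_conv bounded_linear_compose[OF bounded_linear_conv bounded_linear_H1_of_0])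

lemma AE_norm_volterra_le:
  obtains C where "0 < C"
    "\<And>f. AE x in lborel. x \<in> {-1..0} \<longrightarrow> (norm (brep (volterra k2 k3 f) x))\<^sup>2 \<le> C * energy f x"
proof -
  obtain C2 where C2: "0 \<le> C2" "\<And>f \<rho>. \<rho> \<le> 0 \<Longrightarrow> (norm (conv_fun k2 f \<rho>))\<^sup>2 \<le> C2 * energy f \<rho>"
    using conv_fun_bound[of k2] by metis
  obtain C3 where C3: "0 \<le> C3" "\<And>f \<rho>. \<rho> \<le> 0 \<Longrightarrow> (norm (conv_fun k3 f \<rho>))\<^sup>2 \<le> C3 * energy f \<rho>"
    using conv_fun_bound[of k3] by metis
  \<comment> \<open>The factors 2 come from squaring a sum of two terms, and the summand 1 makes the
    constant positive even if both kernel bounds are zero.\<close>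
  have "AE x in lborel. x \<in> {-1..0} \<longrightarrow> (norm (brep (volterra k2 k3 f) x))\<^sup>2 \<le> (2 * C2 + 2 * C3 + 1) * energy f x" for f
  proof -
    \<comment> \<open>With left value zero there is no boundary term, so the primitive can be moved
      outside the convolution and estimated by the energy.\<close>
    have 3: "conv k3 (H1_of 0 f) = H1_of 0 (conv k3 f)"
      by (simp add: conv_H1_of linear_0[OF bounded_linear.linear[OF bounded_linear_mul]]
          linear_0[OF bounded_linear.linear[OF bounded_linear_reflect]])
    have en: "(norm (prim (conv k3 f) x))\<^sup>2 \<le> C3 * energy f x" if x: "x \<in> {-1..0}" for x
    proof -
      have "(norm (prim (conv k3 f) x))\<^sup>2 \<le> energy (conv k3 f) x"
        by (rule norm_prim_sq_le_energy)
      also have "\<dots> \<le> C3 * energy f x * (x + 1)"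
      proof (rule energy_le_integral)
        have "has_bochner_integral lborel (\<lambda>y. indicator {-1..x} y *\<^sub>R (C3 * energy f x)) (measure lborel {-1..x} *\<^sub>R (C3 * energy f x))"
          by (intro has_bochner_integral_indicator) (auto simp: emeasure_lborel_Icc_eq)
        then show "has_bochner_integral lborel (\<lambda>y. (C3 * energy f x) * indicator {-1..x} y) (C3 * energy f x * (x + 1))"
          using x by (simp add: mult_ac)
        show "AE y in lborel. y \<in> {-1..x} \<longrightarrow> (norm (brep (conv k3 f) y))\<^sup>2 \<le> C3 * energy f x"
          using brep_conv[of k3 f]
        proof eventually_elim
          case (elim y)
          show ?case
          proof
            assume y: "y \<in> {-1..x}"
            then have "(norm (brep (conv k3 f) y))\<^sup>2 \<le> C3 * energy f y"
              using elim x C3(2)[of y f] by auto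
            also have "\<dots> \<le> C3 * energy f x"
              using y C3(1) by (intro mult_left_mono energy_mono) auto
            finally show "(norm (brep (conv k3 f) y))\<^sup>2 \<le> C3 * energy f x" .
          qed
        qed
      qed
      also have "\<dots> \<le> C3 * energy f x * 1"
        using x C3(1) energy_nonneg[of f x] by (intro mult_left_mono mult_nonneg_nonneg) auto
      finally show ?thesis by simp
    qed
    show ?thesis
      using brep_add[of "conv k2 f" "H1_of 0 (conv k3 f)"] brep_conv[of k2 f] brep_H1_of[of 0 "conv k3 f"]
    proof eventually_elim
      case (elim x)
      show ?case
      proof
        assume x: "x \<in> {-1..0}"
        let ?a = "conv_fun k2 f x" and ?b = "prim (conv k3 f) x"
        have "(norm (brep (volterra k2 k3 f) x))\<^sup>2 = (norm (?a + ?b))\<^sup>2"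
          using elim x by (simp add: volterra_def 3)
        also have "\<dots> \<le> (norm ?a + norm ?b)\<^sup>2"
          by (intro power_mono norm_triangle_ineq) simp
        also have "\<dots> \<le> 2 * (norm ?a)\<^sup>2 + 2 * (norm ?b)\<^sup>2"
          using sum_squares_bound[of "norm ?a" "norm ?b"] by (simp add: power2_sum)
        also have "\<dots> \<le> (2 * C2 + 2 * C3 + 1) * energy f x"
          using C2(2)[of x f] en[OF x] x energy_nonneg[of f x] by (simp add: algebra_simps)
        finally show "(norm (brep (volterra k2 k3 f) x))\<^sup>2 \<le> (2 * C2 + 2 * C3 + 1) * energy f x" .
      qed
    qed
  qed
  then show ?thesis
    using that[of "2 * C2 + 2 * C3 + 1"] C2(1) C3(1) by auto
qed

text \<open>An exponential weight turns the Volterra estimate into a contraction estimate.\<close>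

lemma norm_volterra_power_le:
  obtains K where "\<And>m f. norm ((volterra k2 k3 ^^ m) f) \<le> K * (1/2) ^ m * norm f"
proof -
  obtain C where C: "0 < C"
    "\<And>f. AE x in lborel. x \<in> {-1..0} \<longrightarrow> (norm (brep (volterra k2 k3 f) x))\<^sup>2 \<le> C * energy f x"
    using AE_norm_volterra_le[of k2 k3] by metis
  \<comment> \<open>With rate \<open>4 * C\<close>, integrating \<open>C\<close> times the weight
    yields a quarter of the weight, hence a factor 1/2 for norms in each application. At
    \<open>\<rho> = 0\<close> the weight is \<open>exp (4 * C)\<close>, whose square root is the
    final constant.\<close>
  have en: "energy ((volterra k2 k3 ^^ m) f) \<rho> \<le> (norm f)\<^sup>2 * (1/4) ^ m * exp (4 * C * (\<rho> + 1))"
    if "\<rho> \<in> {-1..0}" for m f \<rho>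
    using that
  proof (induction m arbitrary: \<rho>)
    case 0
    have "1 \<le> exp (4 * C * (\<rho> + 1))" using 0 C(1) by simp
    then have "(norm f)\<^sup>2 * 1 \<le> (norm f)\<^sup>2 * exp (4 * C * (\<rho> + 1))"
      by (intro mult_left_mono) auto
    then show ?case
      using energy_le_norm[of f \<rho>] by simp
  next
    case (Suc m)
    let ?M = "(norm f)\<^sup>2 * (1/4) ^ m"
    let ?g = "(volterra k2 k3 ^^ m) f"
    have "energy (volterra k2 k3 ?g) \<rho> \<le> ?M / 4 * exp (4 * C * (\<rho> + 1)) - ?M / 4 * exp (4 * C * (-1 + 1))"
    proof (rule energy_le_integral)
      show "has_bochner_integral lborel (\<lambda>x. (C * (?M * exp (4 * C * (x + 1)))) * indicator {-1..\<rho>} x)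
          (?M / 4 * exp (4 * C * (\<rho> + 1)) - ?M / 4 * exp (4 * C * (-1 + 1)))"
        using Suc.prems
        by (intro has_bochner_integral_FTC_Icc_real) (auto intro!: derivative_eq_intros continuous_intros)
      show "AE x in lborel. x \<in> {-1..\<rho>} \<longrightarrow> (norm (brep (volterra k2 k3 ?g) x))\<^sup>2 \<le> C * (?M * exp (4 * C * (x + 1)))"
        using C(2)[of ?g]
      proof eventually_elim
        case (elim x)
        show ?case
        proof
          assume x: "x \<in> {-1..\<rho>}"
          then have "C * energy ?g x \<le> C * (?M * exp (4 * C * (x + 1)))"
            using Suc C(1) by (intro mult_left_mono Suc.IH) auto
          then show "(norm (brep (volterra k2 k3 ?g) x))\<^sup>2 \<le> C * (?M * exp (4 * C * (x + 1)))"
            using elim x Suc.prems by auto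
        qed
      qed
    qed
    also have "\<dots> \<le> ?M / 4 * exp (4 * C * (\<rho> + 1))" by simp
    finally show ?case by simp
  qed
  have "norm ((volterra k2 k3 ^^ m) f) \<le> exp (2 * C) * (1/2) ^ m * norm f" for m f
  proof (rule power2_le_imp_le)
    have "(exp (2 * C) * (1/2) ^ m * norm f)\<^sup>2 = (norm f)\<^sup>2 * ((1/2)\<^sup>2) ^ m * (exp (2 * C))\<^sup>2"
      by (simp only: power_mult_distrib power_mult[symmetric] mult_ac)
    also have "\<dots> = (norm f)\<^sup>2 * (1/4) ^ m * exp (4 * C)"
      by (simp add: power2_eq_square exp_add[symmetric])
    finally show "(norm ((volterra k2 k3 ^^ m) f))\<^sup>2 \<le> (exp (2 * C) * (1/2) ^ m * norm f)\<^sup>2"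
      using en[of 0 m f] by (simp only: energy_0) simp
  qed simp
  then show ?thesis by (rule that)
qed

lemma volterra_invertible:
  obtains K where "0 \<le> K" "\<And>h. \<exists>f. f - volterra k2 k3 f = h \<and> norm f \<le> K * norm h"
    "\<And>f g. f - volterra k2 k3 f = g - volterra k2 k3 g \<Longrightarrow> f = g"
proof -
  obtain K where K: "\<And>m f. norm ((volterra k2 k3 ^^ m) f) \<le> K * (1/2) ^ m * norm f"
    using norm_volterra_power_le[of k2 k3] by metis
  \<comment> \<open>The bound on the powers comes with a constant of unspecified sign, hence the
    maximum with 0.\<close>
  have 1: "\<exists>f. f - volterra k2 k3 f = h \<and> norm f \<le> max 0 (2 * K) * norm h" for h
  proof -
    obtain f where "f - volterra k2 k3 f = h" "norm f \<le> 2 * K * norm h"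
      using Neumann_series(1)[OF bounded_linear_volterra K, of h] by auto
    moreover have "2 * K * norm h \<le> max 0 (2 * K) * norm h"
      by (intro mult_right_mono) auto
    ultimately show ?thesis by (intro exI[of _ f]) linarith
  qed
  have 2: "f = g" if "f - volterra k2 k3 f = g - volterra k2 k3 g" for f g
  proof -
    have "(f - g) - volterra k2 k3 (f - g) = 0"
      using that by (simp add: linear_diff[OF bounded_linear.linear[OF bounded_linear_volterra]] algebra_simps)
    from Neumann_series(2)[OF bounded_linear_volterra K this] show ?thesis by simp
  qed
  show ?thesis
    by (rule that[OF _ 1 2]) simp
qed

lemma bounded_linear_H1_of_const: "bounded_linear (\<lambda>c::'a::euclidean_space. H1_of c 0)"
proof (rule bounded_linear_intro[where K = 1])
  show "H1_of (f + g) 0 = H1_of f 0 + H1_of g (0 :: 'a L2)" for f g :: 'a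
    using H1_of_add[of f g 0 0] by simp
  show "H1_of (r *\<^sub>R f) 0 = r *\<^sub>R H1_of f (0 :: 'a L2)" for r and f :: 'a
    using H1_of_scaleR[of r f 0] by simp
qed (simp add: norm_H1_of_const)

lemma bounded_linear_H1_of: "bounded_linear (\<lambda>p. H1_of (fst p) (snd p))"
proof (rule bounded_linear_intro[where K = 2])
  fix p :: "'a::euclidean_space \<times> 'a L2"
  show "norm (H1_of (fst p) (snd p)) \<le> norm p * 2"
    using norm_H1_of_le[of "fst p" "snd p"] norm_fst_le[of "fst p" "snd p"] norm_snd_le[of "snd p" "fst p"]
    by simp
qed (simp_all add: H1_of_add H1_of_scaleR)

text \<open>Point evaluation of a convolution is bounded on L2. At \<rho> = 0 it gives the first
  component of the neutral operator.\<close>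

lemma bounded_linear_conv_fun:
  assumes "\<rho> \<le> 0"
  shows "bounded_linear (\<lambda>f. conv_fun k f \<rho>)"
proof -
  obtain C where C: "0 \<le> C" "\<And>f. (norm (conv_fun k f \<rho>))\<^sup>2 \<le> C * energy f \<rho>"
    using conv_fun_bound[of k] assms by metis
  show ?thesis
  proof (rule bounded_linear_intro[where K = "sqrt C"])
    fix f
    have "(norm (conv_fun k f \<rho>))\<^sup>2 \<le> C * (norm f)\<^sup>2"
      using C(2)[of f] mult_left_mono[OF energy_le_norm[of f \<rho>] C(1)] by simp
    also have "\<dots> = (norm f * sqrt C)\<^sup>2"
      using C(1) by (simp add: power_mult_distrib)
    finally show "norm (conv_fun k f \<rho>) \<le> norm f * sqrt C"
      by (rule power2_le_imp_le) (use C(1) in simp)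
  qed (simp_all add: conv_fun_add conv_fun_scaleR)
qed

section \<open>The operator \<open>F\<close>\<close>

locale neutral_system =
  fixes Am1 :: "real^'n^'n" and A2 A3 :: "real \<Rightarrow> real^'n^'n"
  assumes sq_A2: "sq_integrable A2" and sq_A3: "sq_integrable A3"
begin

abbreviation k2 :: "(real^'n^'n) L2" where "k2 \<equiv> L2_of A2"
abbreviation k3 :: "(real^'n^'n) L2" where "k3 \<equiv> L2_of A3"

text \<open>The first component is z0(0) minus \<open>Am1\<close> applied to z0(-1), with
  \<open>z0 = H1_of c g\<close>, so these pairs exhaust the domain.\<close>

definition state :: "real^'n \<Rightarrow> (real^'n) L2 \<Rightarrow> 'n M2" where
  "state c g = (c + prim g 0 - Am1 *v c, H1_of c g)"

lemma neutral_dom_eq: "neutral_dom Am1 = {state c g | c g. True}"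
  by (auto simp: neutral_dom_def H1_eq state_def cont_rep_H1_of) (metis H1_eq mem_Collect_eq)+

lemma state_in_dom [simp]: "state c g \<in> neutral_dom Am1"
  by (auto simp: neutral_dom_eq)

lemma state_add: "state c g + state c' g' = state (c + c') (g + g')"
  by (simp add: state_def H1_of_add prim_add matrix_vector_right_distrib)

lemma state_scaleR: "r *\<^sub>R state c g = state (r *\<^sub>R c) (r *\<^sub>R g)"
  by (simp add: state_def H1_of_scaleR prim_scaleR matrix_vector_mult_scaleR algebra_simps)

lemma subspace_neutral_dom: "subspace (neutral_dom Am1)"
proof (rule subspaceI)
  have "0 = state 0 0"
    using state_scaleR[of 0 0 0] by simp
  then show "0 \<in> neutral_dom Am1"
    using state_in_dom by metis
qed (auto simp: neutral_dom_eq state_add state_scaleR; blast)+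

text \<open>Common to both integrals of the definitions: \<rho> = 0 gives the neutral operator and
  \<rho> = -1 - \<theta> gives F. The arguments \<open>f\<close> and \<open>h\<close> are prescribed
  only almost everywhere because one definition uses \<open>rep_L2\<close> where the other uses
  \<open>cont_rep\<close>.\<close>

lemma lebesgue_integral_kernels:
  assumes \<rho>: "\<rho> \<in> {-1..0}" and f: "AE \<tau> in lborel. \<tau> + \<rho> \<in> {-1..0} \<longrightarrow> f \<tau> = brep g (\<tau> + \<rho>)"
    and h: "AE \<tau> in lborel. \<tau> + \<rho> \<in> {-1..0} \<longrightarrow> h \<tau> = brep \<phi> (\<tau> + \<rho>)"
  shows "(LINT \<tau>|lebesgue_on {-1 - \<rho>..0}. A2 \<tau> *v f \<tau> + A3 \<tau> *v h \<tau>) = conv_fun k2 g \<rho> + conv_fun k3 \<phi> \<rho>"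
proof -
  let ?G = "\<lambda>\<tau>. brep k2 \<tau> *v brep g (\<tau> + \<rho>) + brep k3 \<tau> *v brep \<phi> (\<tau> + \<rho>)"
  have AE: "AE \<tau> in lborel. \<tau> \<in> {-1 - \<rho>..0} \<longrightarrow> A2 \<tau> *v f \<tau> + A3 \<tau> *v h \<tau> = ?G \<tau>"
    using AE_brep_L2_of[OF sq_A2] AE_brep_L2_of[OF sq_A3] f h
    by eventually_elim (use \<rho> in auto)
  have "(LINT \<tau>|lebesgue_on {-1 - \<rho>..0}. A2 \<tau> *v f \<tau> + A3 \<tau> *v h \<tau>) = (LINT \<tau>|lebesgue_on {-1 - \<rho>..0}. ?G \<tau>)"
  proof (rule integral_cong_AE)
    show "(\<lambda>\<tau>. A2 \<tau> *v f \<tau> + A3 \<tau> *v h \<tau>) \<in> borel_measurable (lebesgue_on {-1 - \<rho>..0})"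
      by (rule borel_measurable_lebesgue_on_AE[OF AE]) measurable
    show "?G \<in> borel_measurable (lebesgue_on {-1 - \<rho>..0})"
      by (rule borel_measurable_lebesgue_on_AE[of _ _ ?G]) (auto, measurable)
    show "AE \<tau> in lebesgue_on {-1 - \<rho>..0}. A2 \<tau> *v f \<tau> + A3 \<tau> *v h \<tau> = ?G \<tau>"
      using AE by (subst AE_restrict_space_iff) (auto simp: AE_completion_iff)
  qed
  also have "\<dots> = (\<integral>\<tau>. indicator {-1 - \<rho>..0} \<tau> *\<^sub>R ?G \<tau> \<partial>lebesgue)"
    by (subst integral_restrict_space) auto
  also have "\<dots> = (\<integral>\<tau>. indicator {-1 - \<rho>..0} \<tau> *\<^sub>R ?G \<tau> \<partial>lborel)"
    by (rule integral_completion) measurable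
  \<comment> \<open>Outside the integration range either the kernels or the shifted functions
    vanish.\<close>
  also have "(\<lambda>\<tau>. indicator {-1 - \<rho>..0} \<tau> *\<^sub>R ?G \<tau>) = ?G"
  proof
    fix \<tau>
    consider "\<tau> \<in> {-1 - \<rho>..0}" | "0 < \<tau>" | "\<tau> + \<rho> < -1" by force
    then show "indicator {-1 - \<rho>..0} \<tau> *\<^sub>R ?G \<tau> = ?G \<tau>"
      by cases (auto simp: brep_eq_0)
  qed
  also have "(\<integral>\<tau>. ?G \<tau> \<partial>lborel) = conv_fun k2 g \<rho> + conv_fun k3 \<phi> \<rho>"
    by (simp add: conv_fun_def integrable_conv)
  finally show ?thesis .
qed

lemma neutral_op_state:
  "neutral_op A2 A3 (state c g) = (conv_fun k2 g 0 + conv_fun k3 (H1_of c g) 0, g)"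
proof -
  have "(LINT \<tau>|lebesgue_on {-1 - 0..0}. A2 \<tau> *v rep_L2 g \<tau> + A3 \<tau> *v rep_L2 (H1_of c g) \<tau>)
      = conv_fun k2 g 0 + conv_fun k3 (H1_of c g) 0"
    using AE_rep_eq_brep[of g] AE_rep_eq_brep[of "H1_of c g"] unfolding AE_leb_I_iff
    by (intro lebesgue_integral_kernels) (auto elim: eventually_mono)
  then show ?thesis
    by (simp add: neutral_op_def state_def H1_deriv_H1_of)
qed

text \<open>The explicit formula in the coordinates \<open>c\<close> and \<open>g\<close>: at \<rho>
  = -1 - \<theta> its integrals are values of convolutions, so all terms except the last are one
  reflected function.\<close>

lemma neutral_F_state:
  "neutral_F A2 A3 (state c g) = (c, reflect (g - conv k2 g - conv k3 (H1_of c g)) - mul k2 c)"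
proof -
  let ?w = "\<lambda>s. cont_rep (H1_of c g) (s - 1)" and ?dw = "\<lambda>s. rep_L2 g (s - 1)"
  let ?I = "\<lambda>\<theta>. LINT \<tau>|lebesgue_on {\<theta>..0}. A2 \<tau> *v ?dw (\<tau> - \<theta>) + A3 \<tau> *v ?w (\<tau> - \<theta>)"
  have w0: "?w 0 = c"
    by (simp add: cont_rep_H1_of)
  have I: "?I \<theta> = conv_fun k2 g (-1 - \<theta>) + conv_fun k3 (H1_of c g) (-1 - \<theta>)" if \<theta>: "\<theta> \<in> {-1..0}" for \<theta>
  proof -
    define \<rho> where "\<rho> = -1 - \<theta>"
    have \<rho>: "\<rho> \<in> {-1..0}" "\<theta> = -1 - \<rho>" "\<And>\<tau>. \<tau> - \<theta> - 1 = \<tau> + \<rho>"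
      using \<theta> by (auto simp: \<rho>_def)
    have "AE \<tau> in lborel. \<tau> + \<rho> \<in> {-1..0} \<longrightarrow> rep_L2 g (\<tau> + \<rho>) = brep g (\<tau> + \<rho>)"
      using AE_rep_eq_brep[of g] unfolding AE_leb_I_iff by (rule AE_translate)
    moreover have "AE \<tau> in lborel. \<tau> + \<rho> \<in> {-1..0} \<longrightarrow> cont_rep (H1_of c g) (\<tau> + \<rho>) = brep (H1_of c g) (\<tau> + \<rho>)"
      using AE_translate[OF brep_H1_of[of c g], of \<rho>] by eventually_elim (simp add: cont_rep_H1_of)
    ultimately have "(LINT \<tau>|lebesgue_on {-1 - \<rho>..0}. A2 \<tau> *v rep_L2 g (\<tau> + \<rho>) + A3 \<tau> *v cont_rep (H1_of c g) (\<tau> + \<rho>))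
        = conv_fun k2 g \<rho> + conv_fun k3 (H1_of c g) \<rho>"
      by (intro lebesgue_integral_kernels \<rho>(1))
    then show ?thesis
      unfolding \<rho>(3) by (simp only: \<rho>(2)[symmetric] \<rho>_def[symmetric])
  qed
  define H where "H \<rho> = brep g \<rho> - conv_fun k2 g \<rho> - conv_fun k3 (H1_of c g) \<rho>" for \<rho>
  have sqH: "sq_integrable H"
    unfolding H_def by (intro sq_integrable_diff sq_integrable_brep sq_integrable_conv_fun)
  have LH: "L2_of H = g - conv k2 g - conv k3 (H1_of c g)"
    unfolding H_def conv_def
    by (simp add: L2_of_diff[symmetric] sq_integrable_diff sq_integrable_brep sq_integrable_conv_fun)
  have AE: "AE \<theta> in leb_I. ?dw (- \<theta>) - ?I \<theta> - A2 \<theta> *v ?w 0 = H (-1 - \<theta>) - A2 \<theta> *v c"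
  proof -
    have "AE \<theta> in lborel. -1 - \<theta> \<in> {-1..0} \<longrightarrow> rep_L2 g (-1 - \<theta>) = brep g (-1 - \<theta>)"
      using AE_rep_eq_brep[of g] unfolding AE_leb_I_iff by (rule AE_reflect)
    then have "AE \<theta> in lborel. \<theta> \<in> {-1..0} \<longrightarrow> ?dw (- \<theta>) - ?I \<theta> - A2 \<theta> *v ?w 0 = H (-1 - \<theta>) - A2 \<theta> *v c"
    proof eventually_elim
      case (elim \<theta>)
      show ?case
      proof
        assume \<theta>: "\<theta> \<in> {-1..0}"
        have e: "- \<theta> - 1 = -1 - \<theta>" by simp
        show "?dw (- \<theta>) - ?I \<theta> - A2 \<theta> *v ?w 0 = H (-1 - \<theta>) - A2 \<theta> *v c"
          unfolding I[OF \<theta>] w0 H_def e using elim \<theta> by simp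
      qed
    qed
    then show ?thesis by (simp add: AE_leb_I_iff)
  qed
  have sqR: "sq_integrable (\<lambda>\<theta>. H (-1 - \<theta>) - A2 \<theta> *v c)"
    by (intro sq_integrable_diff reflect_L2_of(1) sqH sq_integrable_matrix_vector_mult sq_A2)
  \<comment> \<open>The literal formula contains arbitrary representatives, so even its
    measurability must be taken over from the almost everywhere equal right-hand side.\<close>
  have sqL: "sq_integrable (\<lambda>\<theta>. ?dw (- \<theta>) - ?I \<theta> - A2 \<theta> *v ?w 0)"
  proof -
    have "AE \<theta> in lborel. \<theta> \<in> {-1..0} \<longrightarrow> ?dw (- \<theta>) - ?I \<theta> - A2 \<theta> *v ?w 0 = brep (L2_of (\<lambda>\<theta>. H (-1 - \<theta>) - A2 \<theta> *v c)) \<theta>"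
      using AE AE_brep_L2_of[OF sqR] unfolding AE_leb_I_iff by eventually_elim auto
    then have m: "(\<lambda>\<theta>. ?dw (- \<theta>) - ?I \<theta> - A2 \<theta> *v ?w 0) \<in> borel_measurable leb_I"
      by (rule borel_measurable_lebesgue_on_AE) measurable
    moreover have "integrable leb_I (\<lambda>\<theta>. (norm (?dw (- \<theta>) - ?I \<theta> - A2 \<theta> *v ?w 0))\<^sup>2)"
      using sqR m AE unfolding sq_integrable_def
      by (subst integrable_cong_AE[of _ _ "\<lambda>\<theta>. (norm (H (-1 - \<theta>) - A2 \<theta> *v c))\<^sup>2"]) (auto elim!: eventually_mono)
    ultimately show ?thesis by (simp add: sq_integrable_def)
  qed
  have "L2_of (\<lambda>\<theta>. ?dw (- \<theta>) - ?I \<theta> - A2 \<theta> *v ?w 0) = L2_of (\<lambda>\<theta>. H (-1 - \<theta>) - A2 \<theta> *v c)"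
    by (rule L2_of_eqI[OF sqL sqR AE])
  also have "\<dots> = L2_of (\<lambda>\<theta>. H (-1 - \<theta>)) - L2_of (\<lambda>\<theta>. A2 \<theta> *v c)"
    by (rule L2_of_diff[symmetric]) (intro reflect_L2_of(1) sqH sq_integrable_matrix_vector_mult sq_A2)+
  also have "\<dots> = reflect (g - conv k2 g - conv k3 (H1_of c g)) - mul k2 c"
    by (simp add: reflect_L2_of(2)[OF sqH, symmetric] LH mul_L2_of[OF sq_A2])
  finally show ?thesis
    using w0 by (simp add: neutral_F_def state_def H1_deriv_H1_of Let_def)
qed

text \<open>Splitting the history into a constant and a part vanishing at -1 separates the
  dependence on \<open>c\<close> from an invertible operator in \<open>g\<close>.\<close>

lemma neutral_F_state_volterra:
  "neutral_F A2 A3 (state c g)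
    = (c, reflect (g - volterra k2 k3 g) - (reflect (conv k3 (H1_of c 0)) + mul k2 c))"
proof -
  have "conv k3 (H1_of c g) = conv k3 (H1_of c 0) + conv k3 (H1_of 0 g)"
    using H1_of_add[of c 0 0 g] linear_add[OF bounded_linear.linear[OF bounded_linear_conv]] by simp
  then show ?thesis
    by (simp add: neutral_F_state volterra_def linear_diff[OF bounded_linear.linear[OF bounded_linear_reflect]]
        linear_add[OF bounded_linear.linear[OF bounded_linear_reflect]] algebra_simps)
qed

definition F0 :: "(real^'n) \<times> (real^'n) L2 \<Rightarrow> 'n M2" where
  "F0 p = neutral_F A2 A3 (state (fst p) (snd p))"

lemma bounded_linear_F0: "bounded_linear F0"
proof -
  have "F0 = (\<lambda>p. (fst p, reflect (snd p - volterra k2 k3 (snd p)) - (reflect (conv k3 (H1_of (fst p) 0)) + mul k2 (fst p))))"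
    by (simp add: F0_def[abs_def] neutral_F_state_volterra)
  moreover have "bounded_linear \<dots>"
    by (intro bounded_linear_Pair bounded_linear_sub bounded_linear_add bounded_linear_fst bounded_linear_snd
        bounded_linear_compose[OF bounded_linear_reflect] bounded_linear_compose[OF bounded_linear_volterra]
        bounded_linear_compose[OF bounded_linear_conv] bounded_linear_compose[OF bounded_linear_H1_of_const]
        bounded_linear_compose[OF bounded_linear_mul])
  ultimately show ?thesis by simp
qed

lemma bounded_linear_state: "bounded_linear (\<lambda>p. state (fst p) (snd p))"
  unfolding state_def
  by (intro bounded_linear_Pair bounded_linear_sub bounded_linear_add bounded_linear_fst bounded_linear_H1_of
      bounded_linear_compose[OF bounded_linear_prim bounded_linear_snd]
      bounded_linear_compose[OF matrix_vector_mul_bounded_linear bounded_linear_fst])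

lemma bounded_linear_neutral_op_state: "bounded_linear (\<lambda>p. neutral_op A2 A3 (state (fst p) (snd p)))"
  unfolding neutral_op_state
  by (intro bounded_linear_Pair bounded_linear_add bounded_linear_snd
      bounded_linear_compose[OF bounded_linear_conv_fun bounded_linear_snd]
      bounded_linear_compose[OF bounded_linear_conv_fun bounded_linear_H1_of]) simp_all

text \<open>The derivative \<open>g\<close> is the second component of the neutral operator, and the
  trace estimate recovers \<open>c\<close>. That estimate uses \<open>norm g\<close> once more,
  whence the factor 2.\<close>

lemma norm_le_graph_norm: "norm (c, g) \<le> 2 * graph_norm (neutral_op A2 A3) (state c g)"
proof -
  have "norm g \<le> norm (neutral_op A2 A3 (state c g))"
    unfolding neutral_op_state by (rule norm_snd_le)
  moreover have "norm (H1_of c g) \<le> norm (state c g)"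
    unfolding state_def by (rule norm_snd_le)
  moreover have "norm (c, g) \<le> norm c + norm g"
    unfolding norm_Pair by (rule sqrt_sum_squares_le_sum) auto
  ultimately show ?thesis
    using norm_value_le[of c g] norm_ge_zero[of "state c g"] unfolding graph_norm_def distrib_left by linarith
qed

lemma graph_norm_state_le: "\<exists>K\<ge>0. \<forall>c g. graph_norm (neutral_op A2 A3) (state c g) \<le> K * norm (c, g)"
proof -
  obtain K1 where K1: "0 \<le> K1" "\<And>p. norm (state (fst p) (snd p)) \<le> norm p * K1"
    using bounded_linear.nonneg_bounded[OF bounded_linear_state] by blast
  obtain K2 where K2: "0 \<le> K2" "\<And>p. norm (neutral_op A2 A3 (state (fst p) (snd p))) \<le> norm p * K2"
    using bounded_linear.nonneg_bounded[OF bounded_linear_neutral_op_state] by blast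
  have "graph_norm (neutral_op A2 A3) (state c g) \<le> (K1 + K2) * norm (c, g)" for c g
    using K1(2)[of "(c, g)"] K2(2)[of "(c, g)"] by (simp add: graph_norm_def algebra_simps)
  then show ?thesis
    using K1(1) K2(1) by (intro exI[of _ "K1 + K2"]) auto
qed

lemma neutral_F_bounded: "\<exists>C. \<forall>\<xi>\<in>neutral_dom Am1. norm (neutral_F A2 A3 \<xi>) \<le> C * graph_norm (neutral_op A2 A3) \<xi>"
proof -
  obtain K where K: "0 \<le> K" "\<And>p. norm (F0 p) \<le> norm p * K"
    using bounded_linear.nonneg_bounded[OF bounded_linear_F0] by blast
  have "norm (neutral_F A2 A3 (state c g)) \<le> (2 * K) * graph_norm (neutral_op A2 A3) (state c g)" for c g
    using K(2)[of "(c, g)"] mult_left_mono[OF norm_le_graph_norm[of c g] K(1)] by (simp add: F0_def mult_ac)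
  then show ?thesis
    by (intro exI[of _ "2 * K"]) (auto simp: neutral_dom_eq)
qed

lemma neutral_F_linear:
  assumes "\<xi> \<in> neutral_dom Am1" "\<eta> \<in> neutral_dom Am1"
  shows "neutral_F A2 A3 (\<xi> + \<eta>) = neutral_F A2 A3 \<xi> + neutral_F A2 A3 \<eta>"
    and "neutral_F A2 A3 (c *\<^sub>R \<xi>) = c *\<^sub>R neutral_F A2 A3 \<xi>"
proof -
  obtain a g b h where \<xi>: "\<xi> = state a g" and \<eta>: "\<eta> = state b h"
    using assms by (auto simp: neutral_dom_eq)
  have F: "neutral_F A2 A3 (state a g) = F0 (a, g)" for a g
    by (simp add: F0_def)
  interpret bounded_linear F0
    by (rule bounded_linear_F0)
  show "neutral_F A2 A3 (\<xi> + \<eta>) = neutral_F A2 A3 \<xi> + neutral_F A2 A3 \<eta>"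
    using add[of "(a, g)" "(b, h)"] by (simp add: \<xi> \<eta> state_add F)
  show "neutral_F A2 A3 (c *\<^sub>R \<xi>) = c *\<^sub>R neutral_F A2 A3 \<xi>"
    using scaleR[of c "(a, g)"] by (simp add: \<xi> state_scaleR F)
qed

lemma
  shows neutral_F_bij_betw: "bij_betw (neutral_F A2 A3) (neutral_dom Am1) UNIV"
    and neutral_F_inverse_bounded: "\<exists>C. \<forall>x. graph_norm (neutral_op A2 A3) (inv_into (neutral_dom Am1) (neutral_F A2 A3) x) \<le> C * norm x"
proof -
  obtain K where K: "0 \<le> K" "\<And>h. \<exists>f. f - volterra k2 k3 f = h \<and> norm f \<le> K * norm h"
    "\<And>f g. f - volterra k2 k3 f = g - volterra k2 k3 g \<Longrightarrow> f = g"
    using volterra_invertible[of k2 k3] by blast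
  \<comment> \<open>The amount by which \<open>c\<close> lowers the second component of F. Solving
    for \<open>g\<close> means inverting the Volterra part at
    \<open>reflect (\<psi> + B c)\<close>.\<close>
  define B where "B c = reflect (conv k3 (H1_of c 0)) + mul k2 c" for c
  have "bounded_linear B"
    unfolding B_def
    by (intro bounded_linear_add bounded_linear_mul bounded_linear_compose[OF bounded_linear_reflect]
        bounded_linear_compose[OF bounded_linear_conv] bounded_linear_H1_of_const)
  then obtain L where L: "0 \<le> L" "\<And>c. norm (B c) \<le> norm c * L"
    using bounded_linear.nonneg_bounded by blast
  obtain G where G: "0 \<le> G" "\<And>c g. graph_norm (neutral_op A2 A3) (state c g) \<le> G * norm (c, g)"
    using graph_norm_state_le by blast
  have ex: "\<exists>g. neutral_F A2 A3 (state c g) = (c, \<psi>) \<and> norm g \<le> K * (norm \<psi> + norm c * L)" for c \<psi>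
  proof -
    obtain g where g: "g - volterra k2 k3 g = reflect (\<psi> + B c)" "norm g \<le> K * norm (reflect (\<psi> + B c))"
      using K(2) by blast
    have "norm (reflect (\<psi> + B c)) \<le> norm \<psi> + norm c * L"
      using norm_triangle_ineq[of \<psi> "B c"] L(2)[of c] by simp
    with g(2) have "norm g \<le> K * (norm \<psi> + norm c * L)"
      using mult_left_mono[OF _ K(1)] order_trans by blast
    moreover have "neutral_F A2 A3 (state c g) = (c, \<psi>)"
      unfolding neutral_F_state_volterra g(1) by (simp add: B_def)
    ultimately show ?thesis by blast
  qed
  have inj: "inj_on (neutral_F A2 A3) (neutral_dom Am1)"
  proof (rule inj_onI)
    fix \<xi> \<eta> assume "\<xi> \<in> neutral_dom Am1" "\<eta> \<in> neutral_dom Am1" and eq: "neutral_F A2 A3 \<xi> = neutral_F A2 A3 \<eta>"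
    then obtain a g b h where \<xi>: "\<xi> = state a g" and \<eta>: "\<eta> = state b h"
      by (auto simp: neutral_dom_eq)
    from eq have ab: "a = b" and "reflect (g - volterra k2 k3 g) = reflect (h - volterra k2 k3 h)"
      by (auto simp: \<xi> \<eta> neutral_F_state_volterra)
    then have "g - volterra k2 k3 g = h - volterra k2 k3 h"
      using reflect_reflect by metis
    then have "g = h"
      by (rule K(3))
    with ab show "\<xi> = \<eta>"
      by (simp add: \<xi> \<eta>)
  qed
  then show "bij_betw (neutral_F A2 A3) (neutral_dom Am1) UNIV"
    unfolding bij_betw_def
  proof
    show "neutral_F A2 A3 ` neutral_dom Am1 = UNIV"
    proof (rule UNIV_eq_I[symmetric])
      fix x :: "'n M2"
      obtain c \<psi> where x: "x = (c, \<psi>)" by (rule prod.exhaust)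
      obtain g where "neutral_F A2 A3 (state c g) = x"
        using ex[of c \<psi>] x by blast
      then show "x \<in> neutral_F A2 A3 ` neutral_dom Am1"
        using state_in_dom by blast
    qed
  qed
  have "graph_norm (neutral_op A2 A3) (inv_into (neutral_dom Am1) (neutral_F A2 A3) x)
      \<le> G * (1 + K * (1 + L)) * norm x" for x
  proof -
    obtain c \<psi> where x: "x = (c, \<psi>)" by (rule prod.exhaust)
    obtain g where g: "neutral_F A2 A3 (state c g) = x" "norm g \<le> K * (norm \<psi> + norm c * L)"
      using ex[of c \<psi>] x by auto
    have inv: "inv_into (neutral_dom Am1) (neutral_F A2 A3) x = state c g"
      using inv_into_f_f[OF inj state_in_dom[of c g]] g(1) by simp
    have c: "norm c \<le> norm x" and \<psi>: "norm \<psi> \<le> norm x"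
      unfolding x by (rule norm_fst_le, rule norm_snd_le)
    have "norm \<psi> + norm c * L \<le> norm x + norm x * L"
      using c \<psi> L(1) by (intro add_mono mult_right_mono)
    then have "norm g \<le> K * (norm x + norm x * L)"
      using g(2) mult_left_mono[OF _ K(1)] order_trans by blast
    then have "norm (c, g) \<le> (1 + K * (1 + L)) * norm x"
      using c sqrt_sum_squares_le_sum[of "norm c" "norm g"] by (simp add: norm_Pair algebra_simps)
    then show ?thesis
      unfolding inv mult.assoc using G(2)[of c g] mult_left_mono[OF _ G(1)] order_trans by blast
  qed
  then show "\<exists>C. \<forall>x. graph_norm (neutral_op A2 A3) (inv_into (neutral_dom Am1) (neutral_F A2 A3) x) \<le> C * norm x"
    by blast
qed

text \<open>Lying in the domain of the square means that \<open>g\<close> is itself a Sobolev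
  function, with left value \<open>a\<close> and derivative \<open>d\<close>, and that the first
  component of the neutral operator is compatible with it. Integration by parts then puts F of the
  state in the dual domain.\<close>

lemma neutral_F_intertwines:
  assumes "neutral_op A2 A3 (state c g) \<in> neutral_dom Am1"
  shows "neutral_F A2 A3 (state c g) \<in> dual_dom Am1 A2"
    and "dual_op A2 A3 (neutral_F A2 A3 (state c g)) = neutral_F A2 A3 (neutral_op A2 A3 (state c g))"
proof -
  obtain a d where ad: "neutral_op A2 A3 (state c g) = state a d"
    using assms by (auto simp: neutral_dom_eq)
  then have "(conv_fun k2 g 0 + conv_fun k3 (H1_of c g) 0, g) = state a d"
    by (simp only: neutral_op_state)
  then have g: "g = H1_of a d" and \<alpha>: "conv_fun k2 g 0 + conv_fun k3 (H1_of c g) 0 = a + prim d 0 - Am1 *v a"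
    unfolding state_def by blast+
  define e where "e = d - (conv k2 d + reflect (mul k2 a)) - (conv k3 g + reflect (mul k3 c))"
  have h: "g - conv k2 g - conv k3 (H1_of c g) = H1_of a e"
    unfolding e_def g conv_H1_of by (simp add: H1_of_diff[symmetric])
  \<comment> \<open>\<open>dual_r\<close> adds back exactly the term \<open>mul k2 c\<close> that F
    subtracts.\<close>
  have r: "dual_r A2 (neutral_F A2 A3 (state c g)) = H1_of (a + prim e 0) (- reflect e)"
    unfolding dual_r_def neutral_F_state h by (simp add: mul_L2_of[OF sq_A2] reflect_H1_of)
  have re: "prim (reflect e) 0 = prim e 0"
    using prim_eq_total_minus[of 0 e] by simp
  have "prim e 0 = prim d 0 - conv_fun k2 g 0 - conv_fun k3 (H1_of c g) 0"
    unfolding e_def g conv_fun_H1_of[of 0, simplified] by (simp add: prim_diff)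
  \<comment> \<open>This is the dual boundary condition, because \<open>a\<close> and
    \<open>a + prim e 0\<close> are the values of \<open>dual_r\<close> at 0 and at -1.\<close>
  then have "Am1 *v a = a + prim e 0"
    using \<alpha> by (simp add: algebra_simps)
  then show "neutral_F A2 A3 (state c g) \<in> dual_dom Am1 A2"
    by (simp add: dual_dom_def r cont_rep_H1_of H1_eq prim_minus re) blast
  have rl: "linear reflect"
    by (rule bounded_linear.linear[OF bounded_linear_reflect])
  \<comment> \<open>The left side is the second component of the dual operator. Its term with
    \<open>k3\<close> cancels the boundary term of the second convolution, and the boundary term of
    the first becomes the last term of F at \<open>state a d\<close>.\<close>
  have "reflect e + mul k3 c = reflect (d - conv k2 d - conv k3 g) - mul k2 a"
    unfolding e_def by (simp add: linear_diff[OF rl] linear_add[OF rl])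
  then show "dual_op A2 A3 (neutral_F A2 A3 (state c g)) = neutral_F A2 A3 (neutral_op A2 A3 (state c g))"
    unfolding ad neutral_F_state[of a d] g[symmetric]
    unfolding dual_op_def using r by (simp add: neutral_F_state cont_rep_H1_of H1_deriv_H1_of prim_minus re add.commute mul_L2_of[OF sq_A3, symmetric])
qed

end

section \<open>Strongly continuous semigroups\<close>

text \<open>The closed sets \<open>F n\<close> cover the space, so by Baire one of them contains a
  ball; differences of points of that ball bound the operators in every direction.\<close>

lemma uniform_boundedness:
  fixes B :: "'i \<Rightarrow> 'a::banach \<Rightarrow> 'b::real_normed_vector"
  assumes B: "\<And>i. bounded_linear (B i)" and pw: "\<And>x. \<exists>C. \<forall>i. norm (B i x) \<le> C"
  shows "\<exists>M. \<forall>i x. norm (B i x) \<le> M * norm x"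
proof -
  define F where "F n = {x. \<forall>i. norm (B i x) \<le> real n}" for n :: nat
  have closed: "closed (F n)" for n
    unfolding F_def by (intro closed_Collect_all closed_Collect_le continuous_intros
        linear_continuous_on B)
  have "(\<Union>n. F n) = UNIV"
  proof -
    have "\<exists>n. x \<in> F n" for x
    proof -
      obtain C where C: "\<And>i. norm (B i x) \<le> C" using pw by blast
      obtain n where "C \<le> real n" using real_arch_simple by blast
      then have "x \<in> F n" unfolding F_def using C order_trans by blast
      then show ?thesis by blast
    qed
    then show ?thesis by auto
  qed
  moreover have "interior (\<Union>(range F)) = {}" if "\<And>n. interior (F n) = {}"
    using Baire_category_alt[of "euclidean :: 'a topology" "range F"] closed that
    by (auto simp: completely_metrizable_space_euclidean)
  ultimately obtain n where "interior (F n) \<noteq> {}"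
    by fastforce
  then obtain a r where r: "0 < r" and ball: "ball a r \<subseteq> F n"
    by (meson ex_in_conv mem_interior)
  have "norm (B i x) \<le> (4 * real n / r) * norm x" for i x
  proof (cases "x = 0")
    case False
    \<comment> \<open>Scales \<open>x\<close> to half the radius of the ball.\<close>
    define s where "s = r / (2 * norm x)"
    have s: "0 < s" using r False by (simp add: s_def)
    have "a \<in> F n" "a + s *\<^sub>R x \<in> F n"
      using ball r False by (auto simp: subset_eq dist_norm s_def)
    then have "norm (B i a) \<le> real n" "norm (B i (a + s *\<^sub>R x)) \<le> real n"
      unfolding F_def by auto
    moreover have "s *\<^sub>R B i x = B i (a + s *\<^sub>R x) - B i a"
      using bounded_linear.linear[OF B[of i]] by (simp add: linear_add linear_cmul)
    ultimately have "norm (s *\<^sub>R B i x) \<le> 2 * real n"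
      using norm_triangle_ineq4[of "B i (a + s *\<^sub>R x)" "B i a"] by simp
    then show ?thesis
      using s r False by (simp add: s_def field_simps)
  qed (simp add: linear_0[OF bounded_linear.linear[OF B]])
  then show ?thesis by blast
qed

lemma has_vector_derivative_iff_quotient:
  "(f has_vector_derivative f') (at x within S) \<longleftrightarrow>
    ((\<lambda>s. (f s - f x) /\<^sub>R (s - x)) \<longlongrightarrow> f') (at x within S)"
proof -
  have "(f has_vector_derivative f') (at x within S)
      \<longleftrightarrow> ((\<lambda>s. norm ((1 / norm (s - x)) *\<^sub>R (f s - (f x + (s - x) *\<^sub>R f')))) \<longlongrightarrow> 0) (at x within S)"
    unfolding has_vector_derivative_def has_derivative_within tendsto_norm_zero_iff
    by (simp add: bounded_linear_scaleR_left)
  also have "\<dots> \<longleftrightarrow> ((\<lambda>s. norm ((f s - f x) /\<^sub>R (s - x) - f')) \<longlongrightarrow> 0) (at x within S)"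
  proof (rule tendsto_cong)
    have "norm ((1 / norm (s - x)) *\<^sub>R (f s - (f x + (s - x) *\<^sub>R f'))) = norm ((f s - f x) /\<^sub>R (s - x) - f')"
      if "s \<noteq> x" for s
    proof -
      have "(f s - f x) /\<^sub>R (s - x) - f' = (1 / (s - x)) *\<^sub>R (f s - (f x + (s - x) *\<^sub>R f'))"
        using that by (simp add: scaleR_diff_right scaleR_add_right divide_inverse)
      then show ?thesis by simp
    qed
    then show "\<forall>\<^sub>F s in at x within S. norm ((1 / norm (s - x)) *\<^sub>R (f s - (f x + (s - x) *\<^sub>R f')))
        = norm ((f s - f x) /\<^sub>R (s - x) - f')"
      unfolding eventually_at_filter by (intro always_eventually allI impI) blast
  qed
  also have "\<dots> \<longleftrightarrow> ((\<lambda>s. (f s - f x) /\<^sub>R (s - x)) \<longlongrightarrow> f') (at x within S)"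
    by (simp add: tendsto_norm_zero_iff LIM_zero_iff)
  finally show ?thesis .
qed

text \<open>Convergence at the single vector \<open>l\<close> together with a uniform bound
  suffices; this suits strongly continuous families, which need not converge in operator
  norm.\<close>

lemma tendsto_operator_apply:
  fixes U :: "'i \<Rightarrow> 'a::real_normed_vector \<Rightarrow> 'b::real_normed_vector"
  assumes bnd: "\<forall>\<^sub>F s in F. bounded_linear (U s) \<and> (\<forall>x. norm (U s x) \<le> K * norm x)"
    and y: "(y \<longlongrightarrow> l) F" and U: "((\<lambda>s. U s l) \<longlongrightarrow> m) F"
  shows "((\<lambda>s. U s (y s)) \<longlongrightarrow> m) F"
proof -
  have "((\<lambda>s. U s (y s) - U s l) \<longlongrightarrow> 0) F"
  proof (rule Lim_null_comparison)
    show "\<forall>\<^sub>F s in F. norm (U s (y s) - U s l) \<le> K * norm (y s - l)"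
      using bnd
    proof eventually_elim
      case (elim s)
      then show ?case
        using linear_diff[OF bounded_linear.linear, of "U s" "y s" l] by metis
    qed
    have "((\<lambda>s. K * norm (y s - l)) \<longlongrightarrow> K * norm (l - l)) F"
      by (intro tendsto_intros y)
    then show "((\<lambda>s. K * norm (y s - l)) \<longlongrightarrow> 0) F" by simp
  qed
  from tendsto_add[OF this U] show ?thesis by simp
qed

text \<open>Product rule: the quotient splits into \<open>U s\<close> applied to the quotient of
  \<open>y\<close> and the quotient of \<open>U\<close> at the fixed vector \<open>y r\<close>. Used
  for uniqueness of solutions and along characteristics.\<close>

lemma has_vector_derivative_operator_apply:
  fixes U :: "real \<Rightarrow> 'a::real_normed_vector \<Rightarrow> 'b::real_normed_vector"
  assumes bnd: "\<And>s. s \<in> S \<Longrightarrow> bounded_linear (U s)" "\<And>s x. s \<in> S \<Longrightarrow> norm (U s x) \<le> K * norm x"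
    and y: "(y has_vector_derivative y') (at r within S)"
    and U: "((\<lambda>s. U s y') \<longlongrightarrow> U r y') (at r within S)"
    and d: "((\<lambda>s. U s (y r)) has_vector_derivative d) (at r within S)"
  shows "((\<lambda>s. U s (y s)) has_vector_derivative (U r y' + d)) (at r within S)"
proof -
  have ev: "\<forall>\<^sub>F s in at r within S. bounded_linear (U s) \<and> (\<forall>x. norm (U s x) \<le> K * norm x)"
    using bnd by (auto simp: eventually_at_filter intro!: always_eventually)
  have "((\<lambda>s. U s ((y s - y r) /\<^sub>R (s - r)) + (U s (y r) - U r (y r)) /\<^sub>R (s - r)) \<longlongrightarrow> U r y' + d) (at r within S)"
    by (rule tendsto_add[OF tendsto_operator_apply[OF ev _ U]])
      (use y d in \<open>simp_all only: has_vector_derivative_iff_quotient\<close>)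
  moreover have "\<forall>\<^sub>F s in at r within S. U s ((y s - y r) /\<^sub>R (s - r)) + (U s (y r) - U r (y r)) /\<^sub>R (s - r)
      = (U s (y s) - U r (y r)) /\<^sub>R (s - r)"
    using ev
  proof eventually_elim
    case (elim s)
    then have l: "linear (U s)" by (simp add: bounded_linear.linear)
    show ?case
      by (simp add: linear_cmul[OF l] linear_diff[OF l] scaleR_diff_right)
  qed
  ultimately show ?thesis
    unfolding has_vector_derivative_iff_quotient by (rule Lim_transform_eventually)
qed

locale semigroup_with_generator =
  fixes D :: "'a::banach set" and A :: "'a \<Rightarrow> 'a" and T :: "real \<Rightarrow> 'a \<Rightarrow> 'a"
  assumes generates: "generates D A T"
begin

lemma bl: "0 \<le> t \<Longrightarrow> bounded_linear (T t)"
  and T0 [simp]: "T 0 x = x"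
  and T_add: "0 \<le> s \<Longrightarrow> 0 \<le> t \<Longrightarrow> T (s + t) x = T s (T t x)"
  and T_right: "((\<lambda>t. T t x) \<longlongrightarrow> x) (at_right 0)"
  and generator: "((\<lambda>h. (T h x - x) /\<^sub>R h) \<longlongrightarrow> y) (at_right 0) \<longleftrightarrow> x \<in> D \<and> y = A x"
  using generates unfolding generates_def C0_semigroup_def by blast+

lemma T_lin: "0 \<le> t \<Longrightarrow> linear (T t)"
  using bl by (rule bounded_linear.linear)

text \<open>Otherwise there are times tending to 0 with unbounded operators, although strong
  continuity at 0 bounds every orbit along them, against uniform boundedness.\<close>

lemma bounded_near_0: "\<exists>\<delta>>0. \<exists>M. \<forall>t\<in>{0..\<delta>}. \<forall>x. norm (T t x) \<le> M * norm x"
proof (rule ccontr)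
  assume neg: "\<not> ?thesis"
  have "\<exists>t\<in>{0..inverse (real (Suc n))}. \<exists>x. real n * norm x < norm (T t x)" for n
    using neg by (meson inverse_positive_iff_positive not_less of_nat_0_less_iff zero_less_Suc)
  then obtain t where t: "\<And>n. t n \<in> {0..inverse (real (Suc n))}" "\<And>n. \<exists>x. real n * norm x < norm (T (t n) x)"
    by metis
  have t0: "t \<longlonglongrightarrow> 0"
    by (rule tendsto_sandwich[OF _ _ tendsto_const LIMSEQ_inverse_real_of_nat]) (use t(1) in auto)
  have "\<exists>M. \<forall>n x. norm (T (t n) x) \<le> M * norm x"
  proof (rule uniform_boundedness)
    show "bounded_linear (T (t n))" for n
      using t(1)[of n] by (intro bl) auto
    show "\<exists>C. \<forall>n. norm (T (t n) x) \<le> C" for x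
    proof -
      have "((\<lambda>t. T t x) \<longlongrightarrow> T 0 x) (at 0 within {0..})"
        using T_right[of x] by (simp add: at_within_Ici_at_right)
      then have "(\<lambda>n. T (t n) x) \<longlonglongrightarrow> T 0 x"
        using t(1) t0 by (intro continuous_within_tendsto_compose'[of 0 "{0..}" "\<lambda>t. T t x" t sequentially])
          (auto simp: continuous_within)
      then show ?thesis
        using convergent_imp_Bseq[of "\<lambda>n. T (t n) x"] unfolding convergent_def Bseq_def by blast
    qed
  qed
  then obtain M where M: "\<And>n x. norm (T (t n) x) \<le> M * norm x" by blast
  obtain n where "M \<le> real n" using real_arch_simple by blast
  moreover obtain x where "real n * norm x < norm (T (t n) x)" using t(2) by blast
  ultimately show False
    using M[of n x] mult_right_mono[of M "real n" "norm x"] by simp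
qed

text \<open>The semigroup law extends the bound near zero in steps of length
  \<open>\<delta>\<close>.\<close>

lemma locally_bounded: "\<exists>M. \<forall>t\<in>{0..\<tau>}. \<forall>x. norm (T t x) \<le> M * norm x"
proof -
  obtain \<delta> M where \<delta>: "0 < \<delta>" and M: "\<And>t x. t \<in> {0..\<delta>} \<Longrightarrow> norm (T t x) \<le> M * norm x"
    using bounded_near_0 by blast
  have step: "\<exists>M'. \<forall>t\<in>{0..real n * \<delta>}. \<forall>x. norm (T t x) \<le> M' * norm x" for n
  proof (induction n)
    case 0
    then show ?case by (intro exI[of _ 1]) auto
  next
    case (Suc n)
    then obtain M' where M': "\<And>t x. t \<in> {0..real n * \<delta>} \<Longrightarrow> norm (T t x) \<le> M' * norm x" by blast
    have "norm (T t x) \<le> max (\<bar>M\<bar> * \<bar>M'\<bar>) \<bar>M\<bar> * norm x" if t: "t \<in> {0..real (Suc n) * \<delta>}" for t x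
    proof (cases "t \<le> \<delta>")
      case True
      have "norm (T t x) \<le> M * norm x" using M t True by simp
      also have "\<dots> \<le> max (\<bar>M\<bar> * \<bar>M'\<bar>) \<bar>M\<bar> * norm x" by (intro mult_right_mono) auto
      finally show ?thesis .
    next
      case False
      then have t': "t - \<delta> \<in> {0..real n * \<delta>}" using t by (auto simp: algebra_simps)
      have "norm (T t x) = norm (T \<delta> (T (t - \<delta>) x))"
        using T_add[of \<delta> "t - \<delta>" x] \<delta> t' by simp
      also have "\<dots> \<le> M * norm (T (t - \<delta>) x)" using M \<delta> by simp
      also have "\<dots> \<le> \<bar>M\<bar> * norm (T (t - \<delta>) x)" by (intro mult_right_mono) auto
      also have "\<dots> \<le> \<bar>M\<bar> * (M' * norm x)" using M'[OF t'] by (intro mult_left_mono) auto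
      also have "\<dots> \<le> \<bar>M\<bar> * (\<bar>M'\<bar> * norm x)" by (intro mult_left_mono mult_right_mono) auto
      also have "\<dots> \<le> max (\<bar>M\<bar> * \<bar>M'\<bar>) \<bar>M\<bar> * norm x" by (simp add: mult.assoc[symmetric] mult_right_mono)
      finally show ?thesis .
    qed
    then show ?case by blast
  qed
  obtain n where "\<tau> / \<delta> \<le> real n" using real_arch_simple by blast
  then have "\<tau> \<le> real n * \<delta>" using \<delta> by (simp add: field_simps)
  then show ?thesis using step[of n] by fastforce
qed

text \<open>Up to sign the increment is the operator at the earlier time applied to
  \<open>z s\<close>. Local boundedness thus turns right continuity at zero into two-sided
  continuity.\<close>

lemma continuous_orbit: "continuous_on {0..} (\<lambda>t. T t x)"
  unfolding continuous_on_def
proof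
  fix t :: real assume "t \<in> {0..}"
  then have t: "0 \<le> t" by simp
  obtain M where M: "\<And>s x. s \<in> {0..t + 1} \<Longrightarrow> norm (T s x) \<le> M * norm x"
    using locally_bounded by blast
  define z where "z s = T \<bar>s - t\<bar> x - x" for s
  have "((\<lambda>s. norm (z s)) \<longlongrightarrow> 0) (at t within {0..})"
  proof -
    have "((\<lambda>t. T t x) \<longlongrightarrow> T 0 x) (at 0 within {0..})"
      using T_right[of x] by (simp add: at_within_Ici_at_right)
    moreover have "((\<lambda>s. \<bar>s - t\<bar>) \<longlongrightarrow> \<bar>t - t\<bar>) (at t within {0..})"
      by (intro tendsto_intros)
    ultimately have "((\<lambda>s. T \<bar>s - t\<bar> x) \<longlongrightarrow> T 0 x) (at t within {0..})"
      by (intro continuous_within_tendsto_compose'[of 0 "{0..}" "\<lambda>t. T t x"]) (auto simp: continuous_within)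
    then show ?thesis
      unfolding z_def using tendsto_diff[OF _ tendsto_const[of x]] tendsto_norm_zero by fastforce
  qed
  then have lim: "((\<lambda>s. \<bar>M\<bar> * norm (z s)) \<longlongrightarrow> 0) (at t within {0..})"
    by (rule tendsto_mult_right_zero)
  have "((\<lambda>s. T s x - T t x) \<longlongrightarrow> 0) (at t within {0..})"
  proof (rule Lim_null_comparison[OF _ lim])
    have "norm (T s x - T t x) \<le> \<bar>M\<bar> * norm (z s)" if s: "0 \<le> s" "s < t + 1" for s
    proof -
      define m where "m = min s t"
      have m: "m \<in> {0..t + 1}" using s t by (auto simp: m_def)
      have "norm (T s x - T t x) = norm (T m (z s))"
      proof (cases "s \<le> t")
        case True
        then show ?thesis
          using T_add[of s "t - s" x] s by (simp add: m_def z_def linear_diff[OF T_lin] norm_minus_commute)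
      next
        case False
        then show ?thesis
          using T_add[of t "s - t" x] t by (simp add: m_def z_def linear_diff[OF T_lin])
      qed
      also have "\<dots> \<le> \<bar>M\<bar> * norm (z s)"
        using M[OF m, of "z s"] mult_right_mono[OF abs_ge_self[of M] norm_ge_zero[of "z s"]] by linarith
      finally show ?thesis .
    qed
    moreover have "\<forall>\<^sub>F s in at t within {0..}. s < t + 1"
      by (rule order_tendstoD(2)[OF tendsto_ident_at]) simp
    moreover have "\<forall>\<^sub>F s in at t within {0..}. 0 \<le> s"
      by (simp add: eventually_at_filter)
    ultimately show "\<forall>\<^sub>F s in at t within {0..}. norm (T s x - T t x) \<le> \<bar>M\<bar> * norm (z s)"
      by (auto elim: eventually_elim2)
  qed
  then show "((\<lambda>s. T s x) \<longlongrightarrow> T t x) (at t within {0..})"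
    by (simp add: LIM_zero_iff)
qed

end

context semigroup_with_generator
begin

lemma T_generator_commute:
  assumes "x \<in> D" "0 \<le> t"
  shows "T t x \<in> D" "A (T t x) = T t (A x)"
proof -
  have "((\<lambda>h. (T h x - x) /\<^sub>R h) \<longlongrightarrow> A x) (at_right 0)"
    using assms(1) generator[of x "A x"] by simp
  then have "((\<lambda>h. T t ((T h x - x) /\<^sub>R h)) \<longlongrightarrow> T t (A x)) (at_right 0)"
    by (rule bounded_linear.tendsto[OF bl[OF assms(2)]])
  then have "((\<lambda>h. (T h (T t x) - T t x) /\<^sub>R h) \<longlongrightarrow> T t (A x)) (at_right 0)"
  proof (rule Lim_transform_eventually)
    have "T t ((T h x - x) /\<^sub>R h) = (T h (T t x) - T t x) /\<^sub>R h" if "0 < h" for h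
      using that assms(2) T_add[of t h x] T_add[of h t x]
      by (simp add: linear_cmul[OF T_lin] linear_diff[OF T_lin] add.commute)
    then show "\<forall>\<^sub>F h in at_right 0. T t ((T h x - x) /\<^sub>R h) = (T h (T t x) - T t x) /\<^sub>R h"
      by (simp add: eventually_at_filter)
  qed
  then show "T t x \<in> D" "A (T t x) = T t (A x)"
    using generator[of "T t x" "T t (A x)"] by simp_all
qed

text \<open>Linearity of \<open>D\<close> and \<open>A\<close> is inherited from the difference
  quotients, because \<open>generator\<close> characterises both by a limit.\<close>

lemma generator_scaleR:
  assumes "x \<in> D"
  shows "c *\<^sub>R x \<in> D" "A (c *\<^sub>R x) = c *\<^sub>R A x"
proof -
  have "((\<lambda>h. c *\<^sub>R ((T h x - x) /\<^sub>R h)) \<longlongrightarrow> c *\<^sub>R A x) (at_right 0)"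
    using assms generator[of x "A x"] by (intro tendsto_intros) simp
  then have "((\<lambda>h. (T h (c *\<^sub>R x) - c *\<^sub>R x) /\<^sub>R h) \<longlongrightarrow> c *\<^sub>R A x) (at_right 0)"
    by (rule Lim_transform_eventually)
      (auto simp: eventually_at_filter linear_cmul[OF T_lin] scaleR_diff_right mult.commute)
  then show "c *\<^sub>R x \<in> D" "A (c *\<^sub>R x) = c *\<^sub>R A x"
    using generator[of "c *\<^sub>R x" "c *\<^sub>R A x"] by simp_all
qed

lemma generator_diff:
  assumes "x \<in> D" "y \<in> D"
  shows "x - y \<in> D" "A (x - y) = A x - A y"
proof -
  have "((\<lambda>h. (T h x - x) /\<^sub>R h - (T h y - y) /\<^sub>R h) \<longlongrightarrow> A x - A y) (at_right 0)"
    using assms generator[of x "A x"] generator[of y "A y"] by (intro tendsto_intros) simp_all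
  then have "((\<lambda>h. (T h (x - y) - (x - y)) /\<^sub>R h) \<longlongrightarrow> A x - A y) (at_right 0)"
    by (rule Lim_transform_eventually)
      (auto simp: eventually_at_filter linear_diff[OF T_lin] scaleR_diff_right)
  then show "x - y \<in> D" "A (x - y) = A x - A y"
    using generator[of "x - y" "A x - A y"] by simp_all
qed

text \<open>Both one-sided quotients equal the operator at time \<open>min s t\<close> applied to
  the quotient at zero with step \<open>\<bar>s - t\<bar>\<close>, so one limit covers them.\<close>

lemma orbit_has_vector_derivative:
  assumes "x \<in> D" "0 \<le> t"
  shows "((\<lambda>s. T s x) has_vector_derivative T t (A x)) (at t within {0..})"
proof -
  obtain M where M: "\<And>s x. s \<in> {0..t} \<Longrightarrow> norm (T s x) \<le> M * norm x"
    using locally_bounded by blast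
  have "((\<lambda>h. (T h x - x) /\<^sub>R h) \<longlongrightarrow> A x) (at_right 0)"
    using assms(1) generator[of x "A x"] by simp
  moreover have "filterlim (\<lambda>s. \<bar>s - t\<bar>) (at_right 0) (at t within {0..})"
    unfolding filterlim_at
    by (auto simp: eventually_at_filter intro!: tendsto_eq_intros)
  ultimately have q: "((\<lambda>s. (T \<bar>s - t\<bar> x - x) /\<^sub>R \<bar>s - t\<bar>) \<longlongrightarrow> A x) (at t within {0..})"
    by (rule filterlim_compose)
  have c: "((\<lambda>s. T (min s t) (A x)) \<longlongrightarrow> T t (A x)) (at t within {0..})"
  proof (rule continuous_within_tendsto_compose[of t "{0..}" "\<lambda>s. T s (A x)"])
    show "continuous (at t within {0..}) (\<lambda>s. T s (A x))"
      using continuous_orbit[of "A x"] assms(2) by (simp add: continuous_on_eq_continuous_within)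
    have "((\<lambda>s. min s t) \<longlongrightarrow> min t t) (at t within {0..})"
      by (intro tendsto_intros)
    then show "((\<lambda>s. min s t) \<longlongrightarrow> t) (at t within {0..})" by simp
    show "\<forall>\<^sub>F s in at t within {0..}. min s t \<in> {0..}"
      using assms(2) by (simp add: eventually_at_filter)
  qed
  have ev: "\<forall>\<^sub>F s in at t within {0..}. bounded_linear (T (min s t)) \<and> (\<forall>x. norm (T (min s t) x) \<le> M * norm x)"
    unfolding eventually_at_filter using assms(2) M by (intro always_eventually) (auto intro: bl)
  have "((\<lambda>s. T (min s t) ((T \<bar>s - t\<bar> x - x) /\<^sub>R \<bar>s - t\<bar>)) \<longlongrightarrow> T t (A x)) (at t within {0..})"
    by (rule tendsto_operator_apply[OF ev q c])
  then show ?thesis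
    unfolding has_vector_derivative_iff_quotient
  proof (rule Lim_transform_eventually)
    have "T (min s t) ((T \<bar>s - t\<bar> x - x) /\<^sub>R \<bar>s - t\<bar>) = (T s x - T t x) /\<^sub>R (s - t)" if s: "0 \<le> s" "s \<noteq> t" for s
    proof (cases "s < t")
      case True
      have "T t x = T s (T (t - s) x)"
        using T_add[of s "t - s" x] s True by simp
      then have "T s ((T (t - s) x - x) /\<^sub>R (t - s)) = (T t x - T s x) /\<^sub>R (t - s)"
        using s by (simp add: linear_cmul[OF T_lin] linear_diff[OF T_lin])
      also have "\<dots> = (T s x - T t x) /\<^sub>R (s - t)"
        using scaleR_minus_left[of "inverse (t - s)" "T s x - T t x"]
        by (metis inverse_minus_eq minus_diff_eq scaleR_minus_left scaleR_minus_right)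
      finally show ?thesis using True by simp
    next
      case False
      have "T s x = T t (T (s - t) x)"
        using T_add[of t "s - t" x] assms(2) False by simp
      then show ?thesis
        using False assms(2) by (simp add: linear_cmul[OF T_lin] linear_diff[OF T_lin])
    qed
    then show "\<forall>\<^sub>F s in at t within {0..}. T (min s t) ((T \<bar>s - t\<bar> x - x) /\<^sub>R \<bar>s - t\<bar>) = (T s x - T t x) /\<^sub>R (s - t)"
      unfolding eventually_at_filter by (intro always_eventually) auto
  qed
qed

text \<open>The two terms of the product rule for \<open>T (t - s) (y s)\<close> cancel, so this
  function of \<open>s\<close> is constant; its end values are the two sides.\<close>

lemma solution_unique:
  assumes t: "0 \<le> t" and y: "\<And>s. s \<in> {0..t} \<Longrightarrow> y s \<in> D"
    and y': "\<And>s. s \<in> {0..t} \<Longrightarrow> (y has_vector_derivative A (y s)) (at s within {0..t})"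
  shows "y t = T t (y 0)"
proof -
  obtain M where M: "\<And>s x. s \<in> {0..t} \<Longrightarrow> norm (T s x) \<le> M * norm x"
    using locally_bounded by blast
  have der: "((\<lambda>s. T (t - s) (y s)) has_vector_derivative 0) (at r within {0..t})" if r: "r \<in> {0..t}" for r
  proof -
    have sub: "(\<lambda>s. t - s) ` {0..t} \<subseteq> {0..}" by auto
    have m: "((\<lambda>s. t - s) has_vector_derivative -1) (at r within {0..t})"
      by (auto intro!: derivative_eq_intros)
    have o: "((\<lambda>s. T s (y r)) has_vector_derivative T (t - r) (A (y r))) (at (t - r) within (\<lambda>s. t - s) ` {0..t})"
      by (rule has_vector_derivative_within_subset[OF orbit_has_vector_derivative sub]) (use r y in auto)
    have d: "((\<lambda>s. T (t - s) (y r)) has_vector_derivative - T (t - r) (A (y r))) (at r within {0..t})"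
      using vector_diff_chain_within[OF m o] by (simp add: o_def)
    have c: "((\<lambda>s. T (t - s) (A (y r))) \<longlongrightarrow> T (t - r) (A (y r))) (at r within {0..t})"
    proof (rule continuous_within_tendsto_compose[of "t - r" "{0..}" "\<lambda>s. T s (A (y r))"])
      show "continuous (at (t - r) within {0..}) (\<lambda>s. T s (A (y r)))"
        using continuous_orbit[of "A (y r)"] r by (simp add: continuous_on_eq_continuous_within)
      show "((\<lambda>s. t - s) \<longlongrightarrow> t - r) (at r within {0..t})"
        by (intro tendsto_intros)
      show "\<forall>\<^sub>F s in at r within {0..t}. t - s \<in> {0..}"
        by (simp add: eventually_at_filter)
    qed
    have "((\<lambda>s. T (t - s) (y s)) has_vector_derivative (T (t - r) (A (y r)) + - T (t - r) (A (y r)))) (at r within {0..t})"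
      by (rule has_vector_derivative_operator_apply[OF _ _ y'[OF r] c d, of M]) (auto intro: bl M)
    then show ?thesis by simp
  qed
  have "\<exists>c. \<forall>s\<in>{0..t}. T (t - s) (y s) = c"
    using der unfolding has_vector_derivative_def
    by (intro has_derivative_zero_constant) auto
  then have "T (t - t) (y t) = T (t - 0) (y 0)"
    using t by (metis atLeastAtMost_iff order_refl)
  then show ?thesis by simp
qed

lemma mean_tendsto:
  assumes "0 \<le> r"
  shows "((\<lambda>h. (integral {0..r + h} (\<lambda>s. T s x) - integral {0..r} (\<lambda>s. T s x)) /\<^sub>R h) \<longlongrightarrow> T r x) (at_right 0)"
proof -
  let ?\<Phi> = "\<lambda>u. integral {0..u} (\<lambda>s. T s x)"
  have "(?\<Phi> has_vector_derivative T r x) (at r within {0..r + 1})"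
    using assms by (intro integral_has_vector_derivative continuous_on_subset[OF continuous_orbit]) auto
  then have "((\<lambda>s. (?\<Phi> s - ?\<Phi> r) /\<^sub>R (s - r)) \<longlongrightarrow> T r x) (at r within {0..r + 1})"
    by (simp add: has_vector_derivative_iff_quotient)
  moreover have "filterlim (\<lambda>h. r + h) (at r within {0..r + 1}) (at_right 0)"
  proof -
    have "\<forall>\<^sub>F h in at_right 0. h \<in> {0<..<1::real}"
      by (rule eventually_at_right_real) simp
    then have "\<forall>\<^sub>F h in at_right 0. r + h \<in> {0..r + 1} - {r}"
      by eventually_elim (use assms in auto)
    moreover have "((\<lambda>h. r + h) \<longlongrightarrow> r) (at_right 0)"
      by (auto intro!: tendsto_eq_intros)
    ultimately show ?thesis
      unfolding filterlim_at by (auto elim: eventually_mono)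
  qed
  ultimately have "((\<lambda>h. (?\<Phi> (r + h) - ?\<Phi> r) /\<^sub>R (r + h - r)) \<longlongrightarrow> T r x) (at_right 0)"
    by (rule filterlim_compose)
  then show ?thesis by simp
qed

text \<open>Applying \<open>T k\<close> only shifts the window of integration, so the difference
  quotient is a difference of means at the two ends.\<close>

lemma integral_orbit:
  assumes h: "0 \<le> h"
  shows "integral {0..h} (\<lambda>s. T s x) \<in> D" "A (integral {0..h} (\<lambda>s. T s x)) = T h x - x"
proof -
  let ?\<Phi> = "\<lambda>u. integral {0..u} (\<lambda>s. T s x)"
  have int: "(\<lambda>s. T s x) integrable_on {0..u}" for u
    by (intro integrable_continuous_real continuous_on_subset[OF continuous_orbit]) auto
  have shift: "T k (?\<Phi> h) = ?\<Phi> (h + k) - ?\<Phi> k" if k: "0 \<le> k" for k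
  proof -
    have "T k (?\<Phi> h) = integral {0..h} (T k \<circ> (\<lambda>s. T s x))"
      by (rule integral_linear[symmetric, OF int bl[OF k]])
    also have "\<dots> = integral {0..h} ((\<lambda>s. T s x) \<circ> (+) k)"
      by (rule Henstock_Kurzweil_Integration.integral_cong) (use T_add k in auto)
    also have "\<dots> = integral {k..h + k} (\<lambda>s. T s x)"
      using integral_shift_Icc_real[of 0 h "\<lambda>s. T s x" k] by simp
    also have "\<dots> = ?\<Phi> (h + k) - ?\<Phi> k"
      using Henstock_Kurzweil_Integration.integral_combine[of 0 k "h + k" "\<lambda>s. T s x"] int k h
      by (simp add: eq_diff_eq add.commute)
    finally show ?thesis .
  qed
  have "((\<lambda>k. (?\<Phi> (h + k) - ?\<Phi> h) /\<^sub>R k - (?\<Phi> (0 + k) - ?\<Phi> 0) /\<^sub>R k) \<longlongrightarrow> T h x - T 0 x) (at_right 0)"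
    by (intro tendsto_diff mean_tendsto h order_refl)
  then have "((\<lambda>k. (T k (?\<Phi> h) - ?\<Phi> h) /\<^sub>R k) \<longlongrightarrow> T h x - T 0 x) (at_right 0)"
  proof (rule Lim_transform_eventually)
    show "\<forall>\<^sub>F k in at_right 0. (?\<Phi> (h + k) - ?\<Phi> h) /\<^sub>R k - (?\<Phi> (0 + k) - ?\<Phi> 0) /\<^sub>R k
        = (T k (?\<Phi> h) - ?\<Phi> h) /\<^sub>R k"
      by (auto simp: eventually_at_filter shift scaleR_diff_right)
  qed
  then show "?\<Phi> h \<in> D" "A (?\<Phi> h) = T h x - x"
    using generator[of "?\<Phi> h" "T h x - x"] by simp_all
qed

text \<open>Means of the orbit over short times: the generator maps them to difference quotients of
  the orbit, which lie in the domain because \<open>x\<close> does.\<close>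

lemma square_domain_core:
  assumes x: "x \<in> D"
  obtains X where "\<And>n :: nat. X n \<in> D" "\<And>n. A (X n) \<in> D" "X \<longlonglongrightarrow> x" "(\<lambda>n. A (X n)) \<longlonglongrightarrow> A x"
proof -
  define X where "X h = integral {0..h} (\<lambda>s. T s x) /\<^sub>R h" for h
  have X: "X h \<in> D" "A (X h) = (T h x - x) /\<^sub>R h" "A (X h) \<in> D" if "0 < h" for h
    using that x by (auto simp: X_def integral_orbit generator_scaleR generator_diff T_generator_commute)
  have lim: "filterlim (\<lambda>n. inverse (real (Suc n))) (at_right 0) sequentially"
    unfolding filterlim_at using LIMSEQ_inverse_real_of_nat by auto
  have "(X \<longlongrightarrow> x) (at_right 0)"
    using mean_tendsto[of 0 x] by (simp add: X_def[abs_def])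
  then have "(\<lambda>n. X (inverse (real (Suc n)))) \<longlonglongrightarrow> x"
    using lim by (rule filterlim_compose)
  moreover have "((\<lambda>h. (T h x - x) /\<^sub>R h) \<longlongrightarrow> A x) (at_right 0)"
    using x generator[of x "A x"] by simp
  then have "(\<lambda>n. (T (inverse (real (Suc n))) x - x) /\<^sub>R inverse (real (Suc n))) \<longlonglongrightarrow> A x"
    using lim by (rule filterlim_compose)
  then have "(\<lambda>n. A (X (inverse (real (Suc n))))) \<longlonglongrightarrow> A x"
    by (simp add: X(2))
  ultimately show ?thesis
    using X(1,3) by (intro that[of "\<lambda>n. X (inverse (real (Suc n)))"]) auto
qed

end

text \<open>On the domain of the square, \<open>F\<close> maps orbits to solutions of the other Cauchy problem,
  and that domain is a core.\<close>

lemma semigroups_intertwined: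
  fixes F :: "'a::banach \<Rightarrow> 'b::banach"
  assumes S: "generates D A S" and T: "generates D' B T"
    and diff: "\<And>x y. x \<in> D \<Longrightarrow> y \<in> D \<Longrightarrow> F (x - y) = F x - F y"
    and scale: "\<And>c x. x \<in> D \<Longrightarrow> F (c *\<^sub>R x) = c *\<^sub>R F x"
    and bound: "\<And>x. x \<in> D \<Longrightarrow> norm (F x) \<le> C * graph_norm A x"
    and inter: "\<And>x. x \<in> D \<Longrightarrow> A x \<in> D \<Longrightarrow> F x \<in> D' \<and> B (F x) = F (A x)"
    and x: "x \<in> D" and t: "0 \<le> t"
  shows "F (S t x) = T t (F x)"
proof -
  interpret S: semigroup_with_generator D A S
    by standard (rule S)
  interpret T: semigroup_with_generator D' B T
    by standard (rule T)
  \<comment> \<open>Sequential continuity of F for the graph norm, stated for filters so that it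
    also covers difference quotients.\<close>
  have F_lim: "((\<lambda>i. F (y i)) \<longlongrightarrow> F l) G"
    if y: "\<forall>\<^sub>F i in G. y i \<in> D" and l: "l \<in> D" and lim: "(y \<longlongrightarrow> l) G" "((\<lambda>i. A (y i)) \<longlongrightarrow> A l) G"
    for y l and G :: "'i filter"
  proof -
    have "((\<lambda>i. F (y i) - F l) \<longlongrightarrow> 0) G"
    proof (rule Lim_null_comparison)
      show "\<forall>\<^sub>F i in G. norm (F (y i) - F l) \<le> C * (norm (y i - l) + norm (A (y i) - A l))"
        using y
      proof eventually_elim
        case (elim i)
        then show ?case
          using bound[of "y i - l"] l S.generator_diff[of "y i" l] diff[of "y i" l] by (simp add: graph_norm_def)
      qed
      have "((\<lambda>i. C * (norm (y i - l) + norm (A (y i) - A l))) \<longlongrightarrow> C * (norm (l - l) + norm (A l - A l))) G"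
        by (intro tendsto_intros lim)
      then show "((\<lambda>i. C * (norm (y i - l) + norm (A (y i) - A l))) \<longlongrightarrow> 0) G" by simp
    qed
    then show ?thesis by (simp add: LIM_zero_iff)
  qed
  \<comment> \<open>Because \<open>A x\<close> is in the domain, its orbit is differentiable too, so
    the orbit of \<open>x\<close> is differentiable in the graph norm and its image under F solves
    the other Cauchy problem.\<close>
  have square: "F (S t x) = T t (F x)" if x: "x \<in> D" and Ax: "A x \<in> D" for x
  proof -
    have D: "S s x \<in> D" "A (S s x) = S s (A x)" "A (S s x) \<in> D" "A (S s (A x)) = S s (A (A x))" "S s (A x) \<in> D" if "0 \<le> s" for s
      using S.T_generator_commute[of x s] S.T_generator_commute[of "A x" s] x Ax that by auto
    have "((\<lambda>s. F (S s x)) has_vector_derivative B (F (S r x))) (at r within {0..t})" if r: "r \<in> {0..t}" for r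
    proof -
      have r0: "0 \<le> r" using r by simp
      have "((\<lambda>s. F ((S s x - S r x) /\<^sub>R (s - r))) \<longlongrightarrow> F (S r (A x))) (at r within {0..})"
      proof (rule F_lim)
        show "\<forall>\<^sub>F s in at r within {0..}. (S s x - S r x) /\<^sub>R (s - r) \<in> D"
          using D r0 by (simp add: eventually_at_filter S.generator_scaleR S.generator_diff)
        show "((\<lambda>s. (S s x - S r x) /\<^sub>R (s - r)) \<longlongrightarrow> S r (A x)) (at r within {0..})"
          using S.orbit_has_vector_derivative[OF x r0] by (simp add: has_vector_derivative_iff_quotient)
        have "((\<lambda>s. (S s (A x) - S r (A x)) /\<^sub>R (s - r)) \<longlongrightarrow> A (S r (A x))) (at r within {0..})"
          using S.orbit_has_vector_derivative[OF Ax r0] D(4)[OF r0] by (simp add: has_vector_derivative_iff_quotient)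
        then show "((\<lambda>s. A ((S s x - S r x) /\<^sub>R (s - r))) \<longlongrightarrow> A (S r (A x))) (at r within {0..})"
          by (rule Lim_transform_eventually)
            (use D r0 in \<open>auto simp: eventually_at_filter S.generator_scaleR S.generator_diff\<close>)
      qed (use D r0 in auto)
      then have "((\<lambda>s. (F (S s x) - F (S r x)) /\<^sub>R (s - r)) \<longlongrightarrow> F (S r (A x))) (at r within {0..})"
        by (rule Lim_transform_eventually)
          (use D r0 in \<open>auto simp: eventually_at_filter scale diff S.generator_diff\<close>)
      then have "((\<lambda>s. F (S s x)) has_vector_derivative F (S r (A x))) (at r within {0..})"
        by (simp add: has_vector_derivative_iff_quotient)
      moreover have "B (F (S r x)) = F (S r (A x))"
        using inter[OF D(1)[OF r0] D(3)[OF r0]] D(2)[OF r0] by simp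
      ultimately show ?thesis
        by (auto intro: has_vector_derivative_within_subset)
    qed
    then have "F (S t x) = T t (F (S 0 x))"
      using inter D by (intro T.solution_unique t) auto
    then show ?thesis by simp
  qed
  obtain X where X: "\<And>n :: nat. X n \<in> D" "\<And>n. A (X n) \<in> D" "X \<longlonglongrightarrow> x" "(\<lambda>n. A (X n)) \<longlonglongrightarrow> A x"
    using S.square_domain_core[OF x] by metis
  have "(\<lambda>n. F (S t (X n))) \<longlonglongrightarrow> F (S t x)"
  proof (rule F_lim)
    show "(\<lambda>n. S t (X n)) \<longlonglongrightarrow> S t x"
      by (rule bounded_linear.tendsto[OF S.bl[OF t] X(3)])
    show "(\<lambda>n. A (S t (X n))) \<longlonglongrightarrow> A (S t x)"
      using bounded_linear.tendsto[OF S.bl[OF t] X(4)] X(1) x t by (simp add: S.T_generator_commute)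
  qed (use X x t in \<open>auto intro: S.T_generator_commute always_eventually\<close>)
  moreover have "(\<lambda>n. F (S t (X n))) \<longlonglongrightarrow> T t (F x)"
  proof -
    have "(\<lambda>n. F (X n)) \<longlonglongrightarrow> F x"
      by (rule F_lim) (use X x in auto)
    from bounded_linear.tendsto[OF T.bl[OF t] this] show ?thesis
      using square X by simp
  qed
  ultimately show ?thesis
    by (rule LIMSEQ_unique)
qed

section \<open>Trajectories\<close>

lemma prim_L2_of:
  assumes f: "continuous_on {-1..0} f" and b: "b \<in> {-1..0}"
  shows "prim (L2_of f) b = integral {-1..b} f"
proof -
  have sub: "{-1..b} \<subseteq> {-1..0}" using b by auto
  have fb: "continuous_on {-1..b} f"
    using f sub by (rule continuous_on_subset)
  have sq: "sq_integrable f"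
    using f by (rule sq_integrable_continuous)
  have AE: "AE x in lebesgue_on {-1..b}. rep_L2 (L2_of f) x = f x"
    using AE_rep_L2_of[OF sq] sub unfolding AE_leb_I_iff
    by (subst AE_restrict_space_iff) (auto simp: AE_completion_iff elim!: eventually_mono)
  have "prim (L2_of f) b = (LINT s|lebesgue_on {-1..b}. rep_L2 (L2_of f) s)"
    using b by (simp add: lebesgue_integral_rep_eq_prim)
  also have "\<dots> = (LINT s|lebesgue_on {-1..b}. f s)"
    using AE sq_integrable_rep[of "L2_of f"] sq measurable_restrict_mono[OF _ sub]
    by (intro integral_cong_AE) (auto simp: sq_integrable_def)
  also have "\<dots> = integral {-1..b} f"
    by (rule lebesgue_integral_eq_integral[OF continuous_imp_integrable_real[OF fb]]) simp
  finally show ?thesis .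
qed

lemma prim_H1_of_has_vector_derivative:
  assumes b: "b \<in> {-1..0}"
  shows "(prim (H1_of c g) has_vector_derivative (c + prim g b)) (at b within {-1..0})"
proof -
  have "((\<lambda>b. integral {-1..b} (\<lambda>\<theta>. c + prim g \<theta>)) has_vector_derivative (c + prim g b)) (at b within {-1..0})"
    by (rule integral_has_vector_derivative[OF continuous_on_const_add_prim b])
  then show ?thesis
    by (rule has_vector_derivative_transform[OF b, rotated])
      (simp add: H1_of_def prim_L2_of[OF continuous_on_const_add_prim])
qed

locale neutral_semigroups = neutral_system Am1 A2 A3
  for Am1 :: "real^'n^'n" and A2 A3 :: "real \<Rightarrow> real^'n^'n" +
  fixes S T :: "real \<Rightarrow> 'n M2 \<Rightarrow> 'n M2"
  assumes gen_S: "generates (neutral_dom Am1) (neutral_op A2 A3) S"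
    and gen_T: "generates (dual_dom Am1 A2) (dual_op A2 A3) T"
begin

sublocale S: semigroup_with_generator "neutral_dom Am1" "neutral_op A2 A3" S
  by standard (rule gen_S)

sublocale T: semigroup_with_generator "dual_dom Am1 A2" "dual_op A2 A3" T
  by standard (rule gen_T)

lemma neutral_F_semigroup:
  assumes "\<xi> \<in> neutral_dom Am1" "0 \<le> t"
  shows "neutral_F A2 A3 (S t \<xi>) = T t (neutral_F A2 A3 \<xi>)"
proof -
  obtain C where C: "\<And>\<xi>. \<xi> \<in> neutral_dom Am1 \<Longrightarrow> norm (neutral_F A2 A3 \<xi>) \<le> C * graph_norm (neutral_op A2 A3) \<xi>"
    using neutral_F_bounded by blast
  show ?thesis
  proof (rule semigroups_intertwined[OF gen_S gen_T _ _ C _ assms])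
    show "neutral_F A2 A3 (\<xi> - \<eta>) = neutral_F A2 A3 \<xi> - neutral_F A2 A3 \<eta>"
      if "\<xi> \<in> neutral_dom Am1" "\<eta> \<in> neutral_dom Am1" for \<xi> \<eta>
      using neutral_F_linear(1)[of "\<xi> - \<eta>" \<eta>] that subspace_diff[OF subspace_neutral_dom] by simp
    show "neutral_F A2 A3 (c *\<^sub>R \<xi>) = c *\<^sub>R neutral_F A2 A3 \<xi>" if "\<xi> \<in> neutral_dom Am1" for c \<xi>
      by (rule neutral_F_linear(2)[OF that that])
    show "neutral_F A2 A3 \<xi> \<in> dual_dom Am1 A2 \<and>
        dual_op A2 A3 (neutral_F A2 A3 \<xi>) = neutral_F A2 A3 (neutral_op A2 A3 \<xi>)"
      if \<xi>: "\<xi> \<in> neutral_dom Am1" "neutral_op A2 A3 \<xi> \<in> neutral_dom Am1" for \<xi>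
    proof -
      obtain c g where "\<xi> = state c g"
        using \<xi>(1) by (auto simp: neutral_dom_eq)
      then show ?thesis
        using neutral_F_intertwines[of c g] \<xi>(2) by simp
    qed
  qed
qed

text \<open>The dual orbit supplies a continuous \<open>w\<close>, and intertwining identifies
  \<open>w t\<close> with the left end value of the second component \<open>u t\<close> of the
  neutral orbit. Since the time derivative of \<open>u\<close> equals its space derivative, left end
  values travel along characteristics and fill the whole history.\<close>

lemma related_neutral_F:
  assumes \<xi>: "\<xi> \<in> neutral_dom Am1"
  shows "initial_states_related Am1 S T \<xi> (neutral_F A2 A3 \<xi>)"
proof -
  define w where "w t = fst (T t (neutral_F A2 A3 \<xi>))" for t
  define g where "g t = snd (neutral_op A2 A3 (S t \<xi>))" for t
  have w_cont: "continuous_on {0..} w"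
    unfolding w_def[abs_def] by (intro continuous_on_fst T.continuous_orbit)
  have St: "S t \<xi> = state (w t) (g t)" if t: "0 \<le> t" for t
  proof -
    obtain c h where c: "S t \<xi> = state c h"
      using S.T_generator_commute(1)[OF \<xi> t] by (auto simp: neutral_dom_eq)
    have "w t = fst (neutral_F A2 A3 (state c h))"
      unfolding w_def neutral_F_semigroup[OF \<xi> t, symmetric] c ..
    then have "w t = c"
      by (simp add: neutral_F_state)
    moreover have "g t = h"
      by (simp add: g_def c neutral_op_state)
    ultimately show ?thesis by (simp add: c)
  qed
  define u where "u t = H1_of (w t) (g t)" for t
  have u_der: "(u has_vector_derivative g t) (at t within {0..})" if t: "0 \<le> t" for t
  proof -
    have "((\<lambda>s. snd (S s \<xi>)) has_vector_derivative snd (neutral_op A2 A3 (S t \<xi>))) (at t within {0..})"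
      using bounded_linear.has_vector_derivative[OF bounded_linear_snd S.orbit_has_vector_derivative[OF \<xi> t]]
        S.T_generator_commute(2)[OF \<xi> t] by simp
    then have "((\<lambda>s. snd (S s \<xi>)) has_vector_derivative g t) (at t within {0..})"
      by (simp add: g_def)
    then show ?thesis
      by (rule has_vector_derivative_transform[rotated 2]) (use t St in \<open>auto simp: u_def state_def\<close>)
  qed
  \<comment> \<open>Differentiability of \<open>u\<close> in time is known only in L2. The transport
    identity is therefore proved for primitives, which are bounded functionals of
    \<open>u t\<close>.\<close>
  have prim_u: "prim (u t) b = integral {-1..b} (\<lambda>\<theta>. w (t + 1 + \<theta>))" if t: "0 \<le> t" and b: "b \<in> {-1..0}" for t b
  proof -
    \<comment> \<open>Along this characteristic the time derivative and the space derivative cancel, except for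
      the value at the left end point.\<close>
    have der: "((\<lambda>\<theta>. prim (u (t + 1 + \<theta>)) (b - 1 - \<theta>)) has_vector_derivative - w (t + 1 + r)) (at r within {-1..b})"
      if r: "r \<in> {-1..b}" for r
    proof -
      let ?y = "\<lambda>\<theta>. u (t + 1 + \<theta>)"
      have f: "((\<lambda>\<theta>. t + 1 + \<theta>) has_vector_derivative 1) (at r within {-1..b})"
        by (auto intro!: derivative_eq_intros)
      have y: "(?y has_vector_derivative g (t + 1 + r)) (at r within {-1..b})"
        using vector_diff_chain_within[OF f has_vector_derivative_within_subset[OF u_der]] r t by (auto simp: o_def)
      have m: "((\<lambda>\<theta>. b - 1 - \<theta>) has_vector_derivative -1) (at r within {-1..b})"
        by (auto intro!: derivative_eq_intros)
      have p: "(prim (?y r) has_vector_derivative (w (t + 1 + r) + prim (g (t + 1 + r)) (b - 1 - r))) (at (b - 1 - r) within {-1..0})"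
        unfolding u_def by (rule prim_H1_of_has_vector_derivative) (use r b in auto)
      have d: "((\<lambda>\<theta>. prim (?y r) (b - 1 - \<theta>)) has_vector_derivative - (w (t + 1 + r) + prim (g (t + 1 + r)) (b - 1 - r))) (at r within {-1..b})"
        using vector_diff_chain_within[OF m has_vector_derivative_within_subset[OF p]] b by (auto simp: o_def)
      have c: "((\<lambda>\<theta>. prim (g (t + 1 + r)) (b - 1 - \<theta>)) \<longlongrightarrow> prim (g (t + 1 + r)) (b - 1 - r)) (at r within {-1..b})"
      proof -
        have "continuous_on UNIV (\<lambda>\<theta>. prim (g (t + 1 + r)) (b - 1 - \<theta>))"
          by (intro continuous_on_compose2[OF continuous_on_prim] continuous_intros) auto
        then show ?thesis
          by (meson UNIV_I continuous_on_def subset_UNIV tendsto_within_subset)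
      qed
      have "((\<lambda>\<theta>. prim (?y \<theta>) (b - 1 - \<theta>)) has_vector_derivative
          (prim (g (t + 1 + r)) (b - 1 - r) + - (w (t + 1 + r) + prim (g (t + 1 + r)) (b - 1 - r)))) (at r within {-1..b})"
        by (rule has_vector_derivative_operator_apply[where U = "\<lambda>\<theta> h. prim h (b - 1 - \<theta>)" and K = 1, OF _ _ y c d])
          (simp_all add: bounded_linear_prim norm_prim_le)
      then show ?thesis by simp
    qed
    \<comment> \<open>At the upper limit the primitive is evaluated at -1 and vanishes; at the lower
      limit it is \<open>prim (u t) b\<close>.\<close>
    have "((\<lambda>\<theta>. - w (t + 1 + \<theta>)) has_integral (prim (u (t + 1 + b)) (b - 1 - b) - prim (u (t + 1 + -1)) (b - 1 - -1))) {-1..b}"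
      using b by (intro fundamental_theorem_of_calculus der) auto
    then have "((\<lambda>\<theta>. - w (t + 1 + \<theta>)) has_integral - prim (u t) b) {-1..b}"
      by simp
    then have "((\<lambda>\<theta>. w (t + 1 + \<theta>)) has_integral prim (u t) b) {-1..b}"
      using has_integral_neg_iff[of "\<lambda>\<theta>. w (t + 1 + \<theta>)" "- prim (u t) b" "{-1..b}"] by simp
    then show ?thesis
      by (simp add: integral_unique)
  qed
  have wt: "continuous_on {-1..0} (\<lambda>\<theta>. w (t + 1 + \<theta>))" if "0 \<le> t" for t
    using that by (intro continuous_on_compose2[OF w_cont] continuous_intros) auto
  have u_eq: "u t = L2_of (\<lambda>\<theta>. w (t + 1 + \<theta>))" if t: "0 \<le> t" for t
  proof -
    have "u t - L2_of (\<lambda>\<theta>. w (t + 1 + \<theta>)) = 0"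
      by (rule eq_0_if_prim_eq_0) (simp add: prim_diff prim_u[OF t] prim_L2_of[OF wt[OF t]])
    then show ?thesis by simp
  qed
  have "S t \<xi> = (w (t + 1) - Am1 *v w t, L2_of (\<lambda>\<theta>. w (t + 1 + \<theta>)))" if t: "0 \<le> t" for t
  proof -
    have "w t + prim (g t) 0 = cont_rep (u t) 0"
      by (simp add: u_def cont_rep_H1_of)
    also have "\<dots> = w (t + 1)"
      unfolding u_eq[OF t] using cont_rep_eq[OF wt[OF t], of 0] by simp
    finally show ?thesis
      using St[OF t] u_eq[OF t] by (simp add: state_def u_def)
  qed
  then show ?thesis
    unfolding initial_states_related_def using w_cont by (intro exI[of _ w]) (auto simp: w_def)
qed

text \<open>By surjectivity \<open>x\<close> is F of some \<open>\<eta>\<close>. The functions for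
  \<open>\<xi>\<close> and \<open>\<eta>\<close> both equal the first component of the dual orbit of
  \<open>x\<close>, so they agree on nonnegative times, and at time zero they reproduce
  \<open>\<xi>\<close> and \<open>\<eta>\<close>.\<close>

lemma initial_states_related_iff:
  assumes \<xi>: "\<xi> \<in> neutral_dom Am1"
  shows "initial_states_related Am1 S T \<xi> x \<longleftrightarrow> x = neutral_F A2 A3 \<xi>"
proof
  assume "initial_states_related Am1 S T \<xi> x"
  then obtain w where w: "S 0 \<xi> = (w (0 + 1) - Am1 *v w 0, L2_of (\<lambda>\<theta>. w (0 + 1 + \<theta>)))"
    "\<And>t. 0 \<le> t \<Longrightarrow> fst (T t x) = w t"
    unfolding initial_states_related_def by blast
  obtain \<eta> where \<eta>: "\<eta> \<in> neutral_dom Am1" "neutral_F A2 A3 \<eta> = x"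
    using neutral_F_bij_betw by (metis UNIV_I bij_betw_def imageE)
  then obtain v where v: "S 0 \<eta> = (v (0 + 1) - Am1 *v v 0, L2_of (\<lambda>\<theta>. v (0 + 1 + \<theta>)))"
    "\<And>t. 0 \<le> t \<Longrightarrow> fst (T t x) = v t" "continuous_on {0..} v"
    using related_neutral_F[OF \<eta>(1)] unfolding initial_states_related_def by blast
  have wv: "w t = v t" if "0 \<le> t" for t
    using w(2)[OF that] v(2)[OF that] by simp
  have "L2_of (\<lambda>\<theta>. w (0 + 1 + \<theta>)) = L2_of (\<lambda>\<theta>. v (0 + 1 + \<theta>))"
  proof (rule L2_of_cong)
    show "sq_integrable (\<lambda>\<theta>. v (0 + 1 + \<theta>))"
      by (intro sq_integrable_continuous continuous_on_compose2[OF v(3)] continuous_intros) auto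
  qed (simp add: wv)
  then have "\<xi> = \<eta>"
    using w(1) v(1) wv by simp
  then show "x = neutral_F A2 A3 \<xi>"
    using \<eta>(2) by simp
qed (use related_neutral_F[OF \<xi>] in simp)

end

text \<open>Linearity and bounded invertibility concern the explicit formula alone; the first
  conjunct ties that formula to the correspondence of trajectories, for any semigroups with the two
  generators.\<close>

theorem theorem2p4:
  fixes Am1 :: "real^'n^'n" and A2 A3 :: "real \<Rightarrow> real^'n^'n"
  assumes "\<And>i j. sq_integrable (\<lambda>\<theta>. A2 \<theta> $ i $ j)"
    and "\<And>i j. sq_integrable (\<lambda>\<theta>. A3 \<theta> $ i $ j)"
  shows
    "let X1 = neutral_dom Am1;
         norm_X1 = graph_norm (neutral_op A2 A3);
         F = neutral_F A2 A3
     in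
       (\<forall>S T. generates (neutral_dom Am1) (neutral_op A2 A3) S \<longrightarrow>
              generates (dual_dom Am1 A2) (dual_op A2 A3) T \<longrightarrow>
              (\<forall>\<xi>\<in>X1. \<forall>x. initial_states_related Am1 S T \<xi> x \<longleftrightarrow> x = F \<xi>)) \<and>
       subspace X1 \<and>
       (\<forall>\<xi>\<in>X1. \<forall>\<eta>\<in>X1. F (\<xi> + \<eta>) = F \<xi> + F \<eta>) \<and>
       (\<forall>c. \<forall>\<xi>\<in>X1. F (c *\<^sub>R \<xi>) = c *\<^sub>R F \<xi>) \<and>
       (\<exists>C. \<forall>\<xi>\<in>X1. norm (F \<xi>) \<le> C * norm_X1 \<xi>) \<and>
       bij_betw F X1 UNIV \<and>
       (\<exists>C. \<forall>x. norm_X1 (inv_into X1 F x) \<le> C * norm x)"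
proof -
  interpret neutral_system Am1 A2 A3
    by standard (use assms in \<open>auto intro: sq_integrable_matrix\<close>)
  have "initial_states_related Am1 S T \<xi> x \<longleftrightarrow> x = neutral_F A2 A3 \<xi>"
    if "generates (neutral_dom Am1) (neutral_op A2 A3) S" "generates (dual_dom Am1 A2) (dual_op A2 A3) T"
      "\<xi> \<in> neutral_dom Am1" for S T \<xi> x
  proof -
    interpret neutral_semigroups Am1 A2 A3 S T
      by standard (use that in auto)
    show ?thesis
      using that(3) by (rule initial_states_related_iff)
  qed
  then show ?thesis
    unfolding Let_def
    using subspace_neutral_dom neutral_F_linear neutral_F_bounded neutral_F_bij_betw
      neutral_F_inverse_bounded by blast
qed

end
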